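(* Let $p$ be a prime number and let $M^{\ast}$ be a Dieudonné complex. If $M^{\ast}$ is of Cartier type, then the canonical map $M^{\ast} \to \mathcal{W}\mathrm{Sat}(M^{\ast})$ to the completed saturation of $M^{\ast}$ induces an isomorphism on cohomology with mod $p$ coefficients; that is, the induced map of cochain complexes $M^{\ast}/pM^{\ast} \to \mathcal{W}\mathrm{Sat}(M^{\ast})/p\,\mathcal{W}\mathrm{Sat}(M^{\ast})$ is a quasi-isomorphism.
   Context: Fix a prime $p$. A Dieudonné complex is a triple $(M^{\ast},d,F)$ where $(M^{\ast},d)$ is a cochain complex of abelian groups and $F\colon M^{\ast}\to M^{\ast}$ is a (degree-preserving) map of graded abelian groups with $dF(x)=pF(dx)$. Morphisms are maps of graded abelian groups commuting with $d$ and $F$. Cartier type: for $x\in M^{\ast}$ the image of $Fx$ in $M^{\ast}/pM^{\ast}$ is a cocycle, so $F$ induces a map of graded abelian groups $M^{\ast}/pM^{\ast}\to \mathrm{H}^{\ast}(M^{\ast}/pM^{\ast})$. $M^{\ast}$ is of Cartier type if it is $p$-torsion-free and this map is an isomorphism. Saturation: a Dieudonné complex is saturated if it is $p$-torsion-free and for every $n$ the map $F$ induces an isomorphism $M^n\to\{x\in M^n: dx\in pM^{n+1}\}$. Every Dieudonné complex $M^{\ast}$ admits a saturation: a morphism $M^{\ast}\to\mathrm{Sat}(M^{\ast})$ to a saturated Dieudonné complex which is universal among morphisms from $M^{\ast}$ to saturated Dieudonné complexes. Completion: on a saturated Dieudonné complex $N^{\ast}$ the Verschiebung $V\colon N^{\ast}\to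 N^{\ast}$ is the unique map with $F(Vx)=px$. Put $\mathcal{W}_r(N)^{\ast}=N^{\ast}/(\mathrm{im}(V^r)+\mathrm{im}(dV^r))$ and $\mathcal{W}(N)^{\ast}=\varprojlim_r\mathcal{W}_r(N)^{\ast}$, with the induced $d$ and $F$ (where $F\colon \mathcal{W}_r(N)^{\ast}\to\mathcal{W}_{r-1}(N)^{\ast}$ is induced by $F$ on $N^{\ast}$). The completed saturation $\mathcal{W}\mathrm{Sat}(M^{\ast})$ is $\mathcal{W}(N)^{\ast}$ for $N^{\ast}=\mathrm{Sat}(M^{\ast})$; the canonical map is the composite $M^{\ast}\to\mathrm{Sat}(M^{\ast})\to\mathcal{W}\mathrm{Sat}(M^{\ast})$. *)

theory Defs
  imports "HOL-Algebra.Product_Groups" "HOL-Computational_Algebra.Primes"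
begin

text \<open>
  Abelian groups are HOL-Algebra's \<^const>\<open>comm_group\<close>s, hence written multiplicatively:
  multiplication by \<open>p\<close> is \<open>x [^] p\<close> and zero is \<open>\<one>\<close>. Gradings are by the integers; the
  components of one complex share a carrier type but are otherwise unrelated groups.
  Maps are only constrained on carriers.
\<close>

record 'a cochain =
  grp :: "int \<Rightarrow> 'a monoid"
  diff :: "int \<Rightarrow> 'a \<Rightarrow> 'a"

record 'a dieudonne = "'a cochain" +
  frob :: "int \<Rightarrow> 'a \<Rightarrow> 'a"

definition cochain_complex :: "('a, 'm) cochain_scheme \<Rightarrow> bool" where
  "cochain_complex C \<longleftrightarrow>
     (\<forall>n. comm_group (grp C n)) \<and>
     (\<forall>n. diff C n \<in> hom (grp C n) (grp C (n + 1))) \<and>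
     (\<forall>n. \<forall>x \<in> carrier (grp C n). diff C (n + 1) (diff C n x) = \<one>\<^bsub>grp C (n + 1 + 1)\<^esub>)"

definition cochain_map ::
    "('a, 'm) cochain_scheme \<Rightarrow> ('b, 'k) cochain_scheme \<Rightarrow> (int \<Rightarrow> 'a \<Rightarrow> 'b) \<Rightarrow> bool" where
  "cochain_map C D f \<longleftrightarrow>
     cochain_complex C \<and> cochain_complex D \<and>
     (\<forall>n. f n \<in> hom (grp C n) (grp D n)) \<and>
     (\<forall>n. \<forall>x \<in> carrier (grp C n). f (n + 1) (diff C n x) = diff D n (f n x))"

definition dieudonne_complex :: "nat \<Rightarrow> 'a dieudonne \<Rightarrow> bool" where
  "dieudonne_complex p M \<longleftrightarrow>
     cochain_complex M \<and>
     (\<forall>n. frob M n \<in> hom (grp M n) (grp M n)) \<and>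
     (\<forall>n. \<forall>x \<in> carrier (grp M n).
        diff M n (frob M n x) = frob M (n + 1) (diff M n x) [^]\<^bsub>grp M (n + 1)\<^esub> p)"

definition dieudonne_mor ::
    "nat \<Rightarrow> 'a dieudonne \<Rightarrow> 'b dieudonne \<Rightarrow> (int \<Rightarrow> 'a \<Rightarrow> 'b) \<Rightarrow> bool" where
  "dieudonne_mor p M N f \<longleftrightarrow>
     dieudonne_complex p M \<and> dieudonne_complex p N \<and> cochain_map M N f \<and>
     (\<forall>n. \<forall>x \<in> carrier (grp M n). f n (frob M n x) = frob N n (f n x))"

text \<open>
  The map \<open>G Mod A \<rightarrow> H Mod B\<close> induced by \<open>f : G \<rightarrow> H\<close> with \<open>f A \<subseteq> B\<close>: on cosets,
  \<open>A + x \<mapsto> B + f (A + x) = B + f x\<close>.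
\<close>
definition induced :: "('b, 'n) monoid_scheme \<Rightarrow> 'b set \<Rightarrow> ('a \<Rightarrow> 'b) \<Rightarrow> 'a set \<Rightarrow> 'b set" where
  "induced H B f X = B <#>\<^bsub>H\<^esub> (f ` X)"

definition cocycles :: "('a, 'm) cochain_scheme \<Rightarrow> int \<Rightarrow> 'a set" where
  "cocycles C n = kernel (grp C n) (grp C (n + 1)) (diff C n)"

definition coboundaries :: "('a, 'm) cochain_scheme \<Rightarrow> int \<Rightarrow> 'a set" where
  "coboundaries C n = diff C (n - 1) ` carrier (grp C (n - 1))"

definition cohomology :: "('a, 'm) cochain_scheme \<Rightarrow> int \<Rightarrow> 'a set monoid" where
  "cohomology C n = (grp C n)\<lparr>carrier := cocycles C n\<rparr> Mod coboundaries C n"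

definition quasi_isomorphism ::
    "('a, 'm) cochain_scheme \<Rightarrow> ('b, 'k) cochain_scheme \<Rightarrow> (int \<Rightarrow> 'a \<Rightarrow> 'b) \<Rightarrow> bool" where
  "quasi_isomorphism C D f \<longleftrightarrow>
     cochain_map C D f \<and>
     (\<forall>n. induced (grp D n) (coboundaries D n) (f n) \<in> iso (cohomology C n) (cohomology D n))"

definition multiples :: "nat \<Rightarrow> ('a, 'm) monoid_scheme \<Rightarrow> 'a set" where
  "multiples p G = (\<lambda>x. x [^]\<^bsub>G\<^esub> p) ` carrier G"

definition mod_p :: "nat \<Rightarrow> ('a, 'm) cochain_scheme \<Rightarrow> 'a set cochain" where
  "mod_p p C =
     \<lparr>grp = (\<lambda>n. grp C n Mod multiples p (grp C n)),
      diff = (\<lambda>n. induced (grp C (n + 1)) (multiples p (grp C (n + 1))) (diff C n))\<rparr>"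

definition mod_p_map ::
    "nat \<Rightarrow> ('b, 'm) cochain_scheme \<Rightarrow> (int \<Rightarrow> 'a \<Rightarrow> 'b) \<Rightarrow> int \<Rightarrow> 'a set \<Rightarrow> 'b set" where
  "mod_p_map p D f n = induced (grp D n) (multiples p (grp D n)) (f n)"

definition p_torsion_free :: "nat \<Rightarrow> ('a, 'm) cochain_scheme \<Rightarrow> bool" where
  "p_torsion_free p C \<longleftrightarrow>
     (\<forall>n. \<forall>x \<in> carrier (grp C n). x [^]\<^bsub>grp C n\<^esub> p = \<one>\<^bsub>grp C n\<^esub> \<longrightarrow> x = \<one>\<^bsub>grp C n\<^esub>)"

text \<open>The map sends \<open>x mod p\<close> to the cohomology class of \<open>F x mod p\<close>.\<close>
definition cartier_map :: "nat \<Rightarrow> 'a dieudonne \<Rightarrow> int \<Rightarrow> 'a set \<Rightarrow> 'a set set" where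
  "cartier_map p M n X =
     coboundaries (mod_p p M) n #>\<^bsub>grp (mod_p p M) n\<^esub> mod_p_map p M (frob M) n X"

definition cartier_type :: "nat \<Rightarrow> 'a dieudonne \<Rightarrow> bool" where
  "cartier_type p M \<longleftrightarrow>
     dieudonne_complex p M \<and> p_torsion_free p M \<and>
     (\<forall>n. cartier_map p M n \<in> iso (grp (mod_p p M) n) (cohomology (mod_p p M) n))"

definition saturated :: "nat \<Rightarrow> 'a dieudonne \<Rightarrow> bool" where
  "saturated p M \<longleftrightarrow>
     dieudonne_complex p M \<and> p_torsion_free p M \<and>
     (\<forall>n. frob M n \<in> iso (grp M n)
        ((grp M n)\<lparr>carrier :=
           {x \<in> carrier (grp M n). diff M n x \<in> multiples p (grp M (n + 1))}\<rparr>))"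

text \<open>
  \<open>i : M \<rightarrow> N\<close> is universal among morphisms from \<open>M\<close> to those saturated complexes whose
  elements have type \<open>'t\<close>.
\<close>
definition saturation_among ::
    "'t itself \<Rightarrow> nat \<Rightarrow> 'a dieudonne \<Rightarrow> 'b dieudonne \<Rightarrow> (int \<Rightarrow> 'a \<Rightarrow> 'b) \<Rightarrow> bool" where
  "saturation_among _ p M N i \<longleftrightarrow>
     saturated p N \<and> dieudonne_mor p M N i \<and>
     (\<forall>(T :: 't dieudonne) f. saturated p T \<and> dieudonne_mor p M T f \<longrightarrow>
        (\<exists>g. dieudonne_mor p N T g \<and> (\<forall>n. \<forall>x \<in> carrier (grp M n). g n (i n x) = f n x) \<and>
           (\<forall>h. dieudonne_mor p N T h \<and> (\<forall>n. \<forall>x \<in> carrier (grp M n). h n (i n x) = f n x) \<longrightarrow>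
              (\<forall>n. \<forall>y \<in> carrier (grp N n). h n y = g n y))))"

text \<open>
  A HOL formula cannot quantify over types, so the universal property is demanded for
  the type of \<open>N\<close> itself and for \<open>('a \<times> nat) set\<close>. The latter is large enough to carry a
  saturation of \<open>M\<close>, so this is equivalent to universality with respect to complexes over
  every type: see \<open>is_saturation_universal\<close> below. Saturations exist by
  \<open>saturation_exists\<close>.
\<close>
definition is_saturation ::
    "nat \<Rightarrow> 'a dieudonne \<Rightarrow> 'b dieudonne \<Rightarrow> (int \<Rightarrow> 'a \<Rightarrow> 'b) \<Rightarrow> bool" where
  "is_saturation p M N i \<longleftrightarrow>
     saturation_among TYPE('b) p M N i \<and> saturation_among TYPE(('a \<times> nat) set) p M N i"

definition verschiebung :: "nat \<Rightarrow> 'b dieudonne \<Rightarrow> int \<Rightarrow> 'b \<Rightarrow> 'b" where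
  "verschiebung p N n x =
     (THE y. y \<in> carrier (grp N n) \<and> frob N n y = x [^]\<^bsub>grp N n\<^esub> p)"

text \<open>\<open>im V\<^sup>r + im dV\<^sup>r\<close> in degree \<open>n\<close>\<close>
definition fil :: "nat \<Rightarrow> 'b dieudonne \<Rightarrow> nat \<Rightarrow> int \<Rightarrow> 'b set" where
  "fil p N r n =
     ((verschiebung p N n ^^ r) ` carrier (grp N n)) <#>\<^bsub>grp N n\<^esub>
     ((diff N (n - 1) \<circ> (verschiebung p N (n - 1) ^^ r)) ` carrier (grp N (n - 1)))"

definition W_trunc :: "nat \<Rightarrow> 'b dieudonne \<Rightarrow> nat \<Rightarrow> int \<Rightarrow> 'b set monoid" where
  "W_trunc p N r n = grp N n Mod fil p N r n"

text \<open>
  The inverse limit is realised as the compatible sequences in the product of the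
  \<open>W_trunc p N r n\<close>, the transition maps being induced by the identity. The
  index \<open>r = 0\<close> contributes the zero group. The induced \<open>F\<close> lowers \<open>r\<close> by one.
\<close>
definition W_grp :: "nat \<Rightarrow> 'b dieudonne \<Rightarrow> int \<Rightarrow> (nat \<Rightarrow> 'b set) monoid" where
  "W_grp p N n = (product_group UNIV (\<lambda>r. W_trunc p N r n))
     \<lparr>carrier := {X \<in> (\<Pi>\<^sub>E r \<in> UNIV. carrier (W_trunc p N r n)).
                   \<forall>r. induced (grp N n) (fil p N r n) (\<lambda>x. x) (X (Suc r)) = X r}\<rparr>"

definition W :: "nat \<Rightarrow> 'b dieudonne \<Rightarrow> (nat \<Rightarrow> 'b set) dieudonne" where
  "W p N =
     \<lparr>grp = W_grp p N,
      diff = (\<lambda>n X r. induced (grp N (n + 1)) (fil p N r (n + 1)) (diff N n) (X r)),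
      frob = (\<lambda>n X r. induced (grp N n) (fil p N r n) (frob N n) (X (Suc r)))\<rparr>"

definition W_proj :: "nat \<Rightarrow> 'b dieudonne \<Rightarrow> int \<Rightarrow> 'b \<Rightarrow> nat \<Rightarrow> 'b set" where
  "W_proj p N n x r = fil p N r n #>\<^bsub>grp N n\<^esub> x"

lemma hom_pow:
  assumes "h \<in> hom G H" "comm_group G" "comm_group H" "x \<in> carrier G"
  shows "h (x [^]\<^bsub>G\<^esub> (n::nat)) = h x [^]\<^bsub>H\<^esub> n"
  using assms by (simp add: hom_nat_pow comm_group.axioms(2))

lemma hom_funpow: "f \<in> hom G G \<Longrightarrow> f ^^ k \<in> hom G G"
  by (induction k) (auto simp: hom_def Pi_iff)

lemma funpow_comm_apply: "(f ^^ m) ((f ^^ n) x) = (f ^^ n) ((f ^^ m) x)"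
  by (metis add.commute comp_apply funpow_add)

locale dieudonne_cplx =
  fixes p :: nat and M :: "'a dieudonne"
  assumes dieudonne: "dieudonne_complex p M"
begin

abbreviation C :: "int \<Rightarrow> 'a set" where "C n \<equiv> carrier (grp M n)"
abbreviation F :: "int \<Rightarrow> 'a \<Rightarrow> 'a" where "F n \<equiv> frob M n"
abbreviation d :: "int \<Rightarrow> 'a \<Rightarrow> 'a" where "d n \<equiv> diff M n"
abbreviation e :: "int \<Rightarrow> 'a" where "e n \<equiv> \<one>\<^bsub>grp M n\<^esub>"
abbreviation pw :: "int \<Rightarrow> 'a \<Rightarrow> nat \<Rightarrow> 'a" where "pw n x k \<equiv> x [^]\<^bsub>grp M n\<^esub> k"
abbreviation ml :: "int \<Rightarrow> 'a \<Rightarrow> 'a \<Rightarrow> 'a" where "ml n x y \<equiv> x \<otimes>\<^bsub>grp M n\<^esub> y"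

lemma grpM: "comm_group (grp M n)"
  using dieudonne by (simp add: dieudonne_complex_def cochain_complex_def)
lemma grpM': "group (grp M n)" using grpM comm_group.axioms(2) by blast
lemma monM: "monoid (grp M n)" using grpM' group.is_monoid by blast

lemma d_hom: "d n \<in> hom (grp M n) (grp M (n + 1))"
  using dieudonne by (simp add: dieudonne_complex_def cochain_complex_def)
lemma F_hom: "F n \<in> hom (grp M n) (grp M n)"
  using dieudonne by (simp add: dieudonne_complex_def)
lemma dd: "x \<in> C n \<Longrightarrow> d (n + 1) (d n x) = e (n + 1 + 1)"
  using dieudonne by (simp add: dieudonne_complex_def cochain_complex_def)
lemma dF: "x \<in> C n \<Longrightarrow> d n (F n x) = pw (n + 1) (F (n + 1) (d n x)) p"
  using dieudonne by (simp add: dieudonne_complex_def)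

lemma Fk_hom: "F n ^^ k \<in> hom (grp M n) (grp M n)"
  by (intro hom_funpow F_hom)

lemma ml_closed [simp]: "x \<in> C n \<Longrightarrow> y \<in> C n \<Longrightarrow> ml n x y \<in> C n"
  using monM monoid.m_closed by metis
lemma e_closed [simp]: "e n \<in> C n"
  using monM monoid.one_closed by metis
lemma pw_closed [simp]: "x \<in> C n \<Longrightarrow> pw n x k \<in> C n"
  using monM monoid.nat_pow_closed by metis
lemma d_closed [simp]: "x \<in> C n \<Longrightarrow> d n x \<in> C (n + 1)"
  using d_hom hom_in_carrier by metis
lemma F_closed [simp]: "x \<in> C n \<Longrightarrow> F n x \<in> C n"
  using F_hom hom_in_carrier by metis
lemma Fk_closed [simp]: "x \<in> C n \<Longrightarrow> (F n ^^ k) x \<in> C n"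
  using Fk_hom hom_in_carrier by metis
lemma iv_closed [simp]: "x \<in> C n \<Longrightarrow> inv\<^bsub>grp M n\<^esub> x \<in> C n"
  using grpM' group.inv_closed by metis

lemma pw_ml: "x \<in> C n \<Longrightarrow> y \<in> C n \<Longrightarrow> pw n (ml n x y) k = ml n (pw n x k) (pw n y k)"
  using comm_monoid.nat_pow_distrib[OF comm_group.axioms(1)[OF grpM]] by simp
lemma pw_pw: "x \<in> C n \<Longrightarrow> pw n (pw n x k) l = pw n x (k * l)"
  using monoid.nat_pow_pow[OF monM] by simp
lemma l_e [simp]: "x \<in> C n \<Longrightarrow> ml n (e n) x = x"
  using monoid.l_one[OF monM] by simp
lemma pw_e [simp]: "pw n (e n) k = e n"
  using monoid.nat_pow_one[OF monM] by simp

lemma d_ml: "x \<in> C n \<Longrightarrow> y \<in> C n \<Longrightarrow> d n (ml n x y) = ml (n + 1) (d n x) (d n y)"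
  by (rule hom_mult[OF d_hom])
lemma F_ml: "x \<in> C n \<Longrightarrow> y \<in> C n \<Longrightarrow> F n (ml n x y) = ml n (F n x) (F n y)"
  by (rule hom_mult[OF F_hom])
lemma Fk_ml: "x \<in> C n \<Longrightarrow> y \<in> C n \<Longrightarrow> (F n ^^ k) (ml n x y) = ml n ((F n ^^ k) x) ((F n ^^ k) y)"
  by (rule hom_mult[OF Fk_hom])
lemma d_pw: "x \<in> C n \<Longrightarrow> d n (pw n x k) = pw (n + 1) (d n x) k"
  using hom_pow[OF d_hom grpM grpM] .
lemma F_pw: "x \<in> C n \<Longrightarrow> F n (pw n x k) = pw n (F n x) k"
  using hom_pow[OF F_hom grpM grpM] .
lemma Fk_pw: "x \<in> C n \<Longrightarrow> (F n ^^ j) (pw n x k) = pw n ((F n ^^ j) x) k"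
  using hom_pow[OF Fk_hom grpM grpM] .
lemma F_e [simp]: "F n (e n) = e n"
  by (rule hom_one[OF F_hom grpM' grpM'])
lemma Fk_e [simp]: "(F n ^^ k) (e n) = e n"
  by (rule hom_one[OF Fk_hom grpM' grpM'])
lemma d_e [simp]: "d n (e n) = e (n + 1)"
  by (rule hom_one[OF d_hom grpM' grpM'])
lemma iv_d: "x \<in> C n \<Longrightarrow> d n (inv\<^bsub>grp M n\<^esub> x) = inv\<^bsub>grp M (n+1)\<^esub> (d n x)"
  by (rule group_hom.hom_inv[OF group_hom.intro[OF grpM' grpM' group_hom_axioms.intro[OF d_hom]]])
lemma iv_Fk: "x \<in> C n \<Longrightarrow> (F n ^^ k) (inv\<^bsub>grp M n\<^esub> x) = inv\<^bsub>grp M n\<^esub> ((F n ^^ k) x)"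
  by (rule group_hom.hom_inv[OF group_hom.intro[OF grpM' grpM' group_hom_axioms.intro[OF Fk_hom]]])

lemma dFk: "x \<in> C n \<Longrightarrow> d n ((F n ^^ k) x) = pw (n + 1) ((F (n + 1) ^^ k) (d n x)) (p ^ k)"
  by (induction k) (simp_all add: dF F_pw pw_pw mult.commute)

end

text \<open>
  The colimit of \<open>M \<rightarrow> M \<rightarrow> \<dots>\<close> along \<open>pF\<close>, the class of \<open>(x, r)\<close> standing for
  \<open>(pF)\<^sup>-\<^sup>r x\<close>. Since \<open>dF = pFd\<close>, the differential extends by
  \<open>d ((pF)\<^sup>-\<^sup>r x) = (pF)\<^sup>-\<^sup>2\<^sup>r (F\<^sup>r dx)\<close>.
\<close>
context dieudonne_cplx
begin

definition G :: "int \<Rightarrow> 'a \<Rightarrow> 'a" where "G n x = pw n (F n x) p"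

definition cls :: "int \<Rightarrow> 'a \<Rightarrow> nat \<Rightarrow> ('a \<times> nat) set" where
  "cls n x r = {(y, s). y \<in> C n \<and> (\<exists>k. (G n ^^ (s + k)) x = (G n ^^ (r + k)) y)}"

definition L_mult :: "int \<Rightarrow> ('a \<times> nat) set \<Rightarrow> ('a \<times> nat) set \<Rightarrow> ('a \<times> nat) set" where
  "L_mult n A B = (SOME D. \<exists>x \<in> C n. \<exists>y \<in> C n. \<exists>r. A = cls n x r \<and> B = cls n y r \<and> D = cls n (ml n x y) r)"

definition L_diff :: "int \<Rightarrow> ('a \<times> nat) set \<Rightarrow> ('a \<times> nat) set" where
  "L_diff n A = (SOME D. \<exists>x \<in> C n. \<exists>r. A = cls n x r \<and> D = cls (n + 1) ((F (n + 1) ^^ r) (d n x)) (2 * r))"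

definition L_frob :: "int \<Rightarrow> ('a \<times> nat) set \<Rightarrow> ('a \<times> nat) set" where
  "L_frob n A = (SOME D. \<exists>x \<in> C n. \<exists>r. A = cls n x r \<and> D = cls n (F n x) r)"

definition L :: "('a \<times> nat) set dieudonne" where
  "L = \<lparr>grp = (\<lambda>n. \<lparr>carrier = {cls n x r | x r. x \<in> C n}, monoid.mult = L_mult n, one = cls n (e n) 0\<rparr>),
        diff = L_diff, frob = L_frob\<rparr>"

lemma G_hom: "G n \<in> hom (grp M n) (grp M n)"
  by (auto simp: hom_def G_def F_ml pw_ml)
lemma Gk_hom: "G n ^^ k \<in> hom (grp M n) (grp M n)"
  by (intro hom_funpow G_hom)
lemma G_closed [simp]: "x \<in> C n \<Longrightarrow> G n x \<in> C n"
  by (simp add: G_def)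
lemma Gk_closed [simp]: "x \<in> C n \<Longrightarrow> (G n ^^ k) x \<in> C n"
  using Gk_hom hom_in_carrier by metis
lemma Gk_ml: "x \<in> C n \<Longrightarrow> y \<in> C n \<Longrightarrow> (G n ^^ k) (ml n x y) = ml n ((G n ^^ k) x) ((G n ^^ k) y)"
  by (rule hom_mult[OF Gk_hom])
lemma Gk_pw: "x \<in> C n \<Longrightarrow> (G n ^^ j) (pw n x k) = pw n ((G n ^^ j) x) k"
  using hom_pow[OF Gk_hom grpM grpM] .
lemma Gk_e [simp]: "(G n ^^ k) (e n) = e n"
  by (rule hom_one[OF Gk_hom grpM' grpM'])
lemma Gk_add: "(G n ^^ j) ((G n ^^ k) x) = (G n ^^ (j + k)) x"
  by (simp add: funpow_add)

lemma Gk_eq: "x \<in> C n \<Longrightarrow> (G n ^^ k) x = pw n ((F n ^^ k) x) (p ^ k)"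
  by (induction k) (simp_all add: G_def F_pw pw_pw mult.commute)
lemma FG: "x \<in> C n \<Longrightarrow> F n (G n x) = G n (F n x)"
  by (simp add: G_def F_pw)
lemma FkGj: "x \<in> C n \<Longrightarrow> (F n ^^ k) ((G n ^^ j) x) = (G n ^^ j) ((F n ^^ k) x)"
proof -
  have *: "F n ((G n ^^ j) x) = (G n ^^ j) (F n x)" if "x \<in> C n" for x
    using that by (induction j) (simp_all add: FG)
  show "x \<in> C n \<Longrightarrow> ?thesis"
    by (induction k) (simp_all add: *)
qed
lemma dG: "x \<in> C n \<Longrightarrow> d n (G n x) = pw (n + 1) (G (n + 1) (d n x)) p"
  by (simp add: G_def d_pw dF)
lemma dGk: "x \<in> C n \<Longrightarrow> d n ((G n ^^ k) x) = pw (n + 1) ((G (n + 1) ^^ k) (d n x)) (p ^ k)"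
proof (induction k)
  case (Suc k)
  then show ?case
    using Gk_pw[of "(G (n + 1) ^^ k) (d n x)" "n + 1" 1 "p ^ k"]
    by (simp add: dG pw_pw mult.commute)
qed simp

lemma FdGk: "x \<in> C n \<Longrightarrow> (F (n + 1) ^^ k) (d n ((G n ^^ k) x)) = (G (n + 1) ^^ (2 * k)) (d n x)"
proof -
  assume x: "x \<in> C n"
  have "(F (n + 1) ^^ k) (d n ((G n ^^ k) x)) =
        pw (n + 1) ((F (n + 1) ^^ k) ((G (n + 1) ^^ k) (d n x))) (p ^ k)"
    using x by (simp add: dGk Fk_pw)
  also have "\<dots> = (G (n + 1) ^^ k) ((G (n + 1) ^^ k) (d n x))"
    using x by (simp add: Gk_eq[of "(G (n + 1) ^^ k) (d n x)"])
  finally show ?thesis by (simp add: Gk_add mult_2)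
qed

lemma cls_eq:
  assumes "x \<in> C n" "y \<in> C n"
  shows "cls n x r = cls n y s \<longleftrightarrow> (\<exists>k. (G n ^^ (s + k)) x = (G n ^^ (r + k)) y)"
proof
  assume "cls n x r = cls n y s"
  moreover have "(y, s) \<in> cls n y s" using assms by (auto simp: cls_def)
  ultimately have "(y, s) \<in> cls n x r" by simp
  then show "\<exists>k. (G n ^^ (s + k)) x = (G n ^^ (r + k)) y" by (simp add: cls_def)
next
  have sub: "cls n y s \<subseteq> cls n x r" if h: "(G n ^^ (s + k)) x = (G n ^^ (r + k)) y" for k x y r s
  proof
    fix a assume "a \<in> cls n y s"
    then obtain z t l where a: "a = (z, t)" "z \<in> C n" and
      l: "(G n ^^ (t + l)) y = (G n ^^ (s + l)) z" by (auto simp: cls_def)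
    have "(G n ^^ (t + (k + l + s))) x = (G n ^^ (t + l)) ((G n ^^ (s + k)) x)"
      by (simp add: Gk_add ac_simps)
    also have "\<dots> = (G n ^^ (r + k)) ((G n ^^ (t + l)) y)"
      by (simp only: h) (simp add: Gk_add ac_simps)
    also have "\<dots> = (G n ^^ (r + (k + l + s))) z"
      by (simp only: l) (simp add: Gk_add ac_simps)
    finally show "a \<in> cls n x r" using a by (auto simp: cls_def)
  qed
  assume "\<exists>k. (G n ^^ (s + k)) x = (G n ^^ (r + k)) y"
  then obtain k where "(G n ^^ (s + k)) x = (G n ^^ (r + k)) y" ..
  from sub[OF this] sub[OF this[symmetric]] show "cls n x r = cls n y s" by blast
qed

lemma cls_shift: "x \<in> C n \<Longrightarrow> cls n x r = cls n ((G n ^^ k) x) (r + k)"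
  by (subst cls_eq) (auto simp: Gk_add intro!: exI[of _ 0])

lemma cls_eq_same:
  assumes "x \<in> C n" "y \<in> C n"
  shows "cls n x r = cls n y r \<longleftrightarrow> (\<exists>k. (G n ^^ k) x = (G n ^^ k) y)"
proof
  assume "cls n x r = cls n y r"
  then show "\<exists>k. (G n ^^ k) x = (G n ^^ k) y" using assms by (auto simp: cls_eq)
next
  assume "\<exists>k. (G n ^^ k) x = (G n ^^ k) y"
  then obtain k where "(G n ^^ k) x = (G n ^^ k) y" ..
  then have "(G n ^^ (r + k)) x = (G n ^^ (r + k)) y" by (simp add: funpow_add)
  then show "cls n x r = cls n y r" using assms by (auto simp: cls_eq)
qed

lemma L_carrier: "carrier (grp L n) = {cls n x r | x r. x \<in> C n}"
  by (simp add: L_def)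
lemma cls_in [simp]: "x \<in> C n \<Longrightarrow> cls n x r \<in> carrier (grp L n)"
  by (auto simp: L_carrier)
lemma L_rep:
  assumes "A \<in> carrier (grp L n)"
  obtains x r where "x \<in> C n" "A = cls n x r"
  using assms by (auto simp: L_carrier)
lemma L_rep2:
  assumes "A \<in> carrier (grp L n)" "B \<in> carrier (grp L m)"
  obtains x y r where "x \<in> C n" "A = cls n x r" "y \<in> C m" "B = cls m y r"
proof -
  obtain x r where x: "x \<in> C n" "A = cls n x r" using assms(1) by (rule L_rep)
  obtain y s where y: "y \<in> C m" "B = cls m y s" using assms(2) by (rule L_rep)
  show ?thesis
    by (rule that[of "(G n ^^ s) x" "r + s" "(G m ^^ r) y"])
       (use x y cls_shift[of x n r s] cls_shift[of y m s r] in \<open>simp_all add: add.commute\<close>)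
qed
lemma L_rep3:
  assumes "A \<in> carrier (grp L n)" "B \<in> carrier (grp L n)" "D \<in> carrier (grp L n)"
  obtains x y z r where "x \<in> C n" "A = cls n x r" "y \<in> C n" "B = cls n y r" "z \<in> C n" "D = cls n z r"
proof -
  obtain x y r where x: "x \<in> C n" "A = cls n x r" "y \<in> C n" "B = cls n y r"
    using assms(1,2) by (rule L_rep2)
  obtain z s where z: "z \<in> C n" "D = cls n z s" using assms(3) by (rule L_rep)
  show ?thesis
    by (rule that[of "(G n ^^ s) x" "r + s" "(G n ^^ s) y" "(G n ^^ r) z"])
       (use x z cls_shift[of x n r s] cls_shift[of y n r s] cls_shift[of z n s r]
        in \<open>simp_all add: add.commute\<close>)
qed

lemma L_mult_cls [simp]:
  assumes "x \<in> C n" "y \<in> C n"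
  shows "cls n x r \<otimes>\<^bsub>grp L n\<^esub> cls n y r = cls n (ml n x y) r"
proof -
  have *: "cls n (ml n x' y') s = cls n (ml n x y) r"
    if h: "x' \<in> C n" "y' \<in> C n" "cls n x r = cls n x' s" "cls n y r = cls n y' s" for x' y' s
  proof -
    obtain k where k: "(G n ^^ (s + k)) x = (G n ^^ (r + k)) x'" using h assms by (auto simp: cls_eq)
    obtain l where l: "(G n ^^ (s + l)) y = (G n ^^ (r + l)) y'" using h assms by (auto simp: cls_eq)
    have 1: "(G n ^^ (s + (k + l))) x = (G n ^^ (r + (k + l))) x'"
      using arg_cong[OF k, of "G n ^^ l"] by (simp add: Gk_add ac_simps)
    have 2: "(G n ^^ (s + (k + l))) y = (G n ^^ (r + (k + l))) y'"
      using arg_cong[OF l, of "G n ^^ k"] by (simp add: Gk_add ac_simps)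
    have "(G n ^^ (s + (k + l))) (ml n x y) = (G n ^^ (r + (k + l))) (ml n x' y')"
      using 1 2 assms h by (simp only: Gk_ml)
    then have "cls n (ml n x y) r = cls n (ml n x' y') s" using assms h by (subst cls_eq) auto
    then show ?thesis by simp
  qed
  have "L_mult n (cls n x r) (cls n y r) = cls n (ml n x y) r"
    unfolding L_mult_def by (rule some_equality) (use assms * in \<open>blast+\<close>)
  then show ?thesis by (simp add: L_def)
qed

lemma L_diff_cls [simp]:
  assumes "x \<in> C n"
  shows "diff L n (cls n x r) = cls (n + 1) ((F (n + 1) ^^ r) (d n x)) (2 * r)"
proof -
  have *: "cls (n + 1) ((F (n + 1) ^^ s) (d n y)) (2 * s) =
           cls (n + 1) ((F (n + 1) ^^ r) (d n x)) (2 * r)"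
    if y: "y \<in> C n" and h: "cls n x r = cls n y s" for y s
  proof -
    obtain k where k: "(G n ^^ (s + k)) x = (G n ^^ (r + k)) y" using h y assms by (auto simp: cls_eq)
    let ?F = "F (n + 1)" and ?G = "G (n + 1)"
    have e: "(?F ^^ (r + s + k)) (d n ((G n ^^ (a + k)) u)) = (?F ^^ b) ((?G ^^ (2 * (a + k))) (d n u))"
      if "u \<in> C n" "a + b = r + s" for u a b
    proof -
      have ab: "r + s + k = b + (a + k)" using that by simp
      show ?thesis
        unfolding ab funpow_add[of b "a + k" ?F] o_apply
        using FdGk[of u n "a + k"] that(1) by simp
    qed
    have "(?G ^^ (2 * (s + k))) ((?F ^^ r) (d n x)) = (?F ^^ r) ((?G ^^ (2 * (s + k))) (d n x))"
      using assms by (simp add: FkGj)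
    also have "\<dots> = (?F ^^ s) ((?G ^^ (2 * (r + k))) (d n y))"
      using e[of x s r] e[of y r s] k assms y by simp
    also have "\<dots> = (?G ^^ (2 * (r + k))) ((?F ^^ s) (d n y))"
      using y by (simp add: FkGj)
    finally have "cls (n + 1) ((?F ^^ r) (d n x)) (2 * r) = cls (n + 1) ((?F ^^ s) (d n y)) (2 * s)"
      using assms y by (subst cls_eq) (auto simp: distrib_left intro!: exI[of _ "2 * k"])
    then show ?thesis by simp
  qed
  have "L_diff n (cls n x r) = cls (n + 1) ((F (n + 1) ^^ r) (d n x)) (2 * r)"
    unfolding L_diff_def by (rule some_equality) (use assms * in \<open>blast+\<close>)
  then show ?thesis by (simp add: L_def)
qed

lemma L_frob_cls [simp]:
  assumes "x \<in> C n"
  shows "frob L n (cls n x r) = cls n (F n x) r"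
proof -
  have *: "cls n (F n y) s = cls n (F n x) r"
    if y: "y \<in> C n" and h: "cls n x r = cls n y s" for y s
  proof -
    obtain k where k: "(G n ^^ (s + k)) x = (G n ^^ (r + k)) y" using h y assms by (auto simp: cls_eq)
    then have "(G n ^^ (s + k)) (F n x) = (G n ^^ (r + k)) (F n y)"
      using FkGj[of x n 1 "s + k"] FkGj[of y n 1 "r + k"] assms y by simp
    then have "cls n (F n x) r = cls n (F n y) s" using assms y by (subst cls_eq) auto
    then show ?thesis by simp
  qed
  have "L_frob n (cls n x r) = cls n (F n x) r"
    unfolding L_frob_def by (rule some_equality) (use assms * in \<open>blast+\<close>)
  then show ?thesis by (simp add: L_def)
qed

lemma L_one: "\<one>\<^bsub>grp L n\<^esub> = cls n (e n) r"
  using cls_shift[of "e n" n 0 r] by (simp add: L_def)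

lemma L_group: "comm_group (grp L n)"
proof (rule comm_groupI)
  fix A B assume "A \<in> carrier (grp L n)" "B \<in> carrier (grp L n)"
  then obtain x y r where "x \<in> C n" "A = cls n x r" "y \<in> C n" "B = cls n y r" by (rule L_rep2)
  then show "A \<otimes>\<^bsub>grp L n\<^esub> B \<in> carrier (grp L n)" "A \<otimes>\<^bsub>grp L n\<^esub> B = B \<otimes>\<^bsub>grp L n\<^esub> A"
    using comm_monoid.m_comm[OF comm_group.axioms(1)[OF grpM]] by simp_all
next
  fix A B D assume "A \<in> carrier (grp L n)" "B \<in> carrier (grp L n)" "D \<in> carrier (grp L n)"
  then obtain x y z r where "x \<in> C n" "A = cls n x r" "y \<in> C n" "B = cls n y r" "z \<in> C n" "D = cls n z r"
    by (rule L_rep3)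
  then show "A \<otimes>\<^bsub>grp L n\<^esub> B \<otimes>\<^bsub>grp L n\<^esub> D = A \<otimes>\<^bsub>grp L n\<^esub> (B \<otimes>\<^bsub>grp L n\<^esub> D)"
    using monoid.m_assoc[OF monM] by simp
next
  fix A assume "A \<in> carrier (grp L n)"
  then obtain x r where x: "x \<in> C n" "A = cls n x r" by (rule L_rep)
  then show "\<one>\<^bsub>grp L n\<^esub> \<otimes>\<^bsub>grp L n\<^esub> A = A"
    using monoid.l_one[OF monM] by (simp add: L_one[of n r])
  show "\<exists>B \<in> carrier (grp L n). B \<otimes>\<^bsub>grp L n\<^esub> A = \<one>\<^bsub>grp L n\<^esub>"
    by (rule bexI[of _ "cls n (inv\<^bsub>grp M n\<^esub> x) r"])
       (use x group.l_inv[OF grpM'] in \<open>simp_all add: L_one[of n r]\<close>)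
qed (simp add: L_one[of n 0])

lemma L_pow [simp]: "x \<in> C n \<Longrightarrow> cls n x r [^]\<^bsub>grp L n\<^esub> (k::nat) = cls n (pw n x k) r"
  by (induction k) (simp_all add: L_one[of n r])

lemma L_dieudonne: "dieudonne_complex p L"
  unfolding dieudonne_complex_def cochain_complex_def
proof (intro conjI allI ballI)
  fix n show "comm_group (grp L n)" by (rule L_group)
next
  fix n show "diff L n \<in> hom (grp L n) (grp L (n + 1))"
  proof (rule homI)
    fix A assume "A \<in> carrier (grp L n)"
    then show "diff L n A \<in> carrier (grp L (n + 1))" by (auto elim: L_rep)
  next
    fix A B assume "A \<in> carrier (grp L n)" "B \<in> carrier (grp L n)"
    then obtain x y r where "x \<in> C n" "A = cls n x r" "y \<in> C n" "B = cls n y r" by (rule L_rep2)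
    then show "diff L n (A \<otimes>\<^bsub>grp L n\<^esub> B) = diff L n A \<otimes>\<^bsub>grp L (n + 1)\<^esub> diff L n B"
      by (simp add: d_ml Fk_ml)
  qed
next
  fix n show "frob L n \<in> hom (grp L n) (grp L n)"
  proof (rule homI)
    fix A assume "A \<in> carrier (grp L n)"
    then show "frob L n A \<in> carrier (grp L n)" by (auto elim: L_rep)
  next
    fix A B assume "A \<in> carrier (grp L n)" "B \<in> carrier (grp L n)"
    then obtain x y r where "x \<in> C n" "A = cls n x r" "y \<in> C n" "B = cls n y r" by (rule L_rep2)
    then show "frob L n (A \<otimes>\<^bsub>grp L n\<^esub> B) = frob L n A \<otimes>\<^bsub>grp L n\<^esub> frob L n B"
      by (simp add: F_ml)
  qed
next
  fix n A assume "A \<in> carrier (grp L n)"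
  then obtain x r where x: "x \<in> C n" "A = cls n x r" by (rule L_rep)
  show "diff L (n + 1) (diff L n A) = \<one>\<^bsub>grp L (n + 1 + 1)\<^esub>"
    using x unfolding L_one[of "n + 1 + 1" "4 * r"] by (simp add: dFk dd)
  show "diff L n (frob L n A) = frob L (n + 1) (diff L n A) [^]\<^bsub>grp L (n + 1)\<^esub> p"
    using x funpow_swap1[of "F (n + 1)" r "d n x"] by (simp add: dF Fk_pw)
qed

lemma cls_one: "x \<in> C n \<Longrightarrow> cls n x r = \<one>\<^bsub>grp L n\<^esub> \<longleftrightarrow> (\<exists>k. (G n ^^ k) x = e n)"
  by (simp add: L_one[of n r] cls_eq_same)

lemma L_torsion_free: "p_torsion_free p L"
  unfolding p_torsion_free_def
proof (intro allI ballI impI)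
  fix n A assume "A \<in> carrier (grp L n)" and h: "A [^]\<^bsub>grp L n\<^esub> p = \<one>\<^bsub>grp L n\<^esub>"
  then obtain x r where x: "x \<in> C n" "A = cls n x r" by (metis L_rep)
  then obtain k where k: "(G n ^^ k) (pw n x p) = e n" using h by (auto simp: cls_one)
  have "(G n ^^ Suc k) x = F n (pw n ((G n ^^ k) x) p)"
    using x by (simp add: G_def F_pw)
  also have "\<dots> = e n" using k x by (simp add: Gk_pw)
  finally show "A = \<one>\<^bsub>grp L n\<^esub>" using x cls_one by blast
qed

lemma L_frob_inj: "inj_on (frob L n) (carrier (grp L n))"
proof (rule inj_onI)
  fix A B assume A: "A \<in> carrier (grp L n)" "B \<in> carrier (grp L n)" and h: "frob L n A = frob L n B"
  from A obtain x y r where x: "x \<in> C n" "A = cls n x r" "y \<in> C n" "B = cls n y r" by (rule L_rep2)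
  then obtain k where k: "(G n ^^ k) (F n x) = (G n ^^ k) (F n y)"
    using h by (auto simp: cls_eq_same)
  have "(G n ^^ Suc k) z = pw n ((G n ^^ k) (F n z)) p" if "z \<in> C n" for z
    using that FkGj[of z n 1 k] by (simp add: G_def)
  then have "(G n ^^ Suc k) x = (G n ^^ Suc k) y" using k x by simp
  then show "A = B" using x cls_eq_same by blast
qed

lemma L_frob_surj: "frob L n ` carrier (grp L n) = carrier (grp L n)"
proof
  show "frob L n ` carrier (grp L n) \<subseteq> carrier (grp L n)" by (auto elim!: L_rep)
  show "carrier (grp L n) \<subseteq> frob L n ` carrier (grp L n)"
  proof
    fix A assume "A \<in> carrier (grp L n)"
    then obtain x r where x: "x \<in> C n" "A = cls n x r" by (rule L_rep)
    then have "A = frob L n (cls n (pw n x p) (Suc r))"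
      using cls_shift[of x n r 1] by (simp add: G_def F_pw)
    then show "A \<in> frob L n ` carrier (grp L n)" by (rule image_eqI) (use x in simp)
  qed
qed

definition loc :: "int \<Rightarrow> 'a \<Rightarrow> ('a \<times> nat) set" where "loc n x = cls n x 0"

lemma loc_mor: "dieudonne_mor p M L loc"
  unfolding dieudonne_mor_def cochain_map_def
  using dieudonne L_dieudonne
  by (auto simp: loc_def dieudonne_complex_def intro!: homI)

lemma loc_eq: "x \<in> C n \<Longrightarrow> y \<in> C n \<Longrightarrow> loc n x = loc n y \<Longrightarrow> \<exists>k. (G n ^^ k) x = (G n ^^ k) y"
  by (simp add: loc_def cls_eq_same)

end

context dieudonne_cplx
begin

lemma pw_inj:
  assumes "p_torsion_free p M" "x \<in> C n" "y \<in> C n" "pw n x (p ^ k) = pw n y (p ^ k)"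
  shows "x = y"
  using assms(2-4)
proof (induction k arbitrary: x y)
  case (Suc k)
  let ?z = "ml n (pw n x (p ^ k)) (inv\<^bsub>grp M n\<^esub> (pw n y (p ^ k)))"
  have inv_pw: "pw n (inv\<^bsub>grp M n\<^esub> u) j = inv\<^bsub>grp M n\<^esub> (pw n u j)" if "u \<in> C n" for u j
    using group.nat_pow_inv[OF grpM'] that by simp
  have "pw n ?z p = ml n (pw n x (p ^ Suc k)) (inv\<^bsub>grp M n\<^esub> (pw n y (p ^ Suc k)))"
    using Suc.prems by (simp add: pw_ml inv_pw pw_pw mult.commute)
  also have "\<dots> = e n" using Suc.prems group.r_inv[OF grpM'] by simp
  finally have z: "?z = e n" using assms(1) Suc.prems by (simp add: p_torsion_free_def)
  have "inv\<^bsub>grp M n\<^esub> (inv\<^bsub>grp M n\<^esub> (pw n y (p ^ k))) = pw n x (p ^ k)"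
    by (rule group.inv_equality[OF grpM' z]) (use Suc.prems in simp_all)
  then have "pw n x (p ^ k) = pw n y (p ^ k)"
    using group.inv_inv[OF grpM'] Suc.prems by simp
  then show ?case using Suc by simp
qed simp

lemma pw_inj1:
  assumes "p_torsion_free p M" "x \<in> C n" "y \<in> C n" "pw n x p = pw n y p"
  shows "x = y"
  using pw_inj[OF assms(1-3), of 1] assms(4) by simp

lemma sat_F_inj:
  assumes "saturated p M" "x \<in> C n" "y \<in> C n" "F n x = F n y"
  shows "x = y"
  using assms by (auto simp: saturated_def iso_def bij_betw_def dest: inj_onD)

lemma sat_Fk_inj:
  assumes "saturated p M" "x \<in> C n" "y \<in> C n" "(F n ^^ k) x = (F n ^^ k) y"
  shows "x = y"
  using assms(2-4) by (induction k) (auto dest!: sat_F_inj[OF assms(1), rotated 2])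

lemma sat_Gk_inj:
  assumes "saturated p M" "x \<in> C n" "y \<in> C n" "(G n ^^ k) x = (G n ^^ k) y"
  shows "x = y"
proof -
  have "p_torsion_free p M" using assms(1) by (simp add: saturated_def)
  from pw_inj[OF this, of "(F n ^^ k) x" n "(F n ^^ k) y" k] assms
  show ?thesis by (auto simp: Gk_eq intro: sat_Fk_inj)
qed

lemma sat_F_surj:
  assumes "saturated p M" "x \<in> C n" "y \<in> C (n + 1)" "d n x = pw (n + 1) y p"
  obtains t where "t \<in> C n" "F n t = x"
proof -
  have "x \<in> {x \<in> C n. d n x \<in> multiples p (grp M (n + 1))}"
    using assms by (auto simp: multiples_def)
  also have "\<dots> = F n ` C n"
    using assms(1) by (auto simp: saturated_def iso_def bij_betw_def)
  finally show ?thesis using that by auto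
qed

lemma sat_Fk_surj:
  assumes "saturated p M" "x \<in> C n" "y \<in> C (n + 1)" "d n x = pw (n + 1) y (p ^ r)"
  shows "\<exists>t \<in> C n. (F n ^^ r) t = x"
  using assms(2-4)
proof (induction r arbitrary: x y)
  case (Suc r)
  have tf: "p_torsion_free p M" using assms(1) by (simp add: saturated_def)
  have "d n x = pw (n + 1) (pw (n + 1) y (p ^ r)) p"
    using Suc.prems by (simp add: pw_pw mult.commute)
  then obtain t where t: "t \<in> C n" "F n t = x"
    using sat_F_surj[OF assms(1), of x n "pw (n + 1) y (p ^ r)"] Suc.prems by auto
  have "pw (n + 1) (F (n + 1) (d n t)) p = pw (n + 1) (pw (n + 1) y (p ^ r)) p"
    using t Suc.prems by (simp add: dF[symmetric] pw_pw mult.commute)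
  then have Fdt: "F (n + 1) (d n t) = pw (n + 1) y (p ^ r)"
    using pw_inj1[OF tf, of "F (n + 1) (d n t)" "n + 1" "pw (n + 1) y (p ^ r)"] t Suc.prems by simp
  have "pw (n + 1 + 1) (d (n + 1) y) (p ^ r) = d (n + 1) (F (n + 1) (d n t))"
    using Fdt Suc.prems by (simp add: d_pw)
  also have "\<dots> = pw (n + 1 + 1) (F (n + 1 + 1) (d (n + 1) (d n t))) p"
    using t by (intro dF) simp
  also have "\<dots> = e (n + 1 + 1)" using t by (simp only: dd F_e pw_e)
  finally have "pw (n + 1 + 1) (d (n + 1) y) (p ^ r) = pw (n + 1 + 1) (e (n + 1 + 1)) (p ^ r)" by simp
  then have dy: "d (n + 1) y = e (n + 1 + 1)"
    by (rule pw_inj[OF tf, rotated 2]) (use Suc.prems d_closed e_closed in blast)+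
  have "d (n + 1) y = pw (n + 1 + 1) (e (n + 1 + 1)) p" unfolding dy by simp
  then obtain y' where y': "y' \<in> C (n + 1)" "F (n + 1) y' = y"
    using sat_F_surj[OF assms(1), of y "n + 1" "e (n + 1 + 1)"] Suc.prems by auto
  have "F (n + 1) (d n t) = F (n + 1) (pw (n + 1) y' (p ^ r))" using Fdt y' by (simp add: F_pw)
  then have "d n t = pw (n + 1) y' (p ^ r)"
    by (rule sat_F_inj[OF assms(1), rotated 2]) (use t y' in simp_all)
  then obtain u where "u \<in> C n" "(F n ^^ r) u = t" using Suc.IH t y' by blast
  then show ?case using t by auto
qed simp

end

lemma mor_facts:
  assumes "dieudonne_mor p M N f" "x \<in> carrier (grp M n)"
  shows "f n x \<in> carrier (grp N n)"
    "f (n + 1) (diff M n x) = diff N n (f n x)"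
    "f n ((frob M n ^^ k) x) = (frob N n ^^ k) (f n x)"
    "f n (x [^]\<^bsub>grp M n\<^esub> (j::nat)) = f n x [^]\<^bsub>grp N n\<^esub> j"
proof -
  interpret dieudonne_cplx p M using assms by unfold_locales (simp add: dieudonne_mor_def)
  interpret N: dieudonne_cplx p N using assms by unfold_locales (simp add: dieudonne_mor_def)
  have h: "f n \<in> hom (grp M n) (grp N n)" using assms by (simp add: dieudonne_mor_def cochain_map_def)
  show "f n x \<in> carrier (grp N n)" using h assms(2) by (rule hom_in_carrier)
  show "f (n + 1) (diff M n x) = diff N n (f n x)"
    using assms by (simp add: dieudonne_mor_def cochain_map_def)
  have "f n (frob M n y) = frob N n (f n y)" if "y \<in> C n" for y
    using assms that by (simp add: dieudonne_mor_def)
  then show "f n ((frob M n ^^ k) x) = (frob N n ^^ k) (f n x)"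
    using assms(2) by (induction k) simp_all
  show "f n (x [^]\<^bsub>grp M n\<^esub> j) = f n x [^]\<^bsub>grp N n\<^esub> j"
    by (rule hom_pow[OF h grpM N.grpM assms(2)])
qed

lemma mor_mult:
  assumes "dieudonne_mor p M N f" "x \<in> carrier (grp M n)" "y \<in> carrier (grp M n)"
  shows "f n (x \<otimes>\<^bsub>grp M n\<^esub> y) = f n x \<otimes>\<^bsub>grp N n\<^esub> f n y"
  using assms by (simp add: dieudonne_mor_def cochain_map_def hom_mult)

lemma mor_comp:
  assumes "dieudonne_mor p M N f" "dieudonne_mor p N T g"
  shows "dieudonne_mor p M T (\<lambda>n x. g n (f n x))"
proof -
  have "(\<lambda>x. g n (f n x)) \<in> hom (grp M n) (grp T n)" for n
    using assms hom_compose[of "f n" "grp M n" "grp N n" "g n" "grp T n"]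
    by (simp add: dieudonne_mor_def cochain_map_def comp_def)
  then show ?thesis
    using assms mor_facts(1)[OF assms(1)] by (simp add: dieudonne_mor_def cochain_map_def)
qed

lemma mor_id: "dieudonne_complex p M \<Longrightarrow> dieudonne_mor p M M (\<lambda>n x. x)"
  by (simp add: dieudonne_mor_def cochain_map_def dieudonne_complex_def hom_def)

text \<open>
  With \<open>A = M[F\<^sup>-\<^sup>1]\<close> (modulo torsion), the saturation consists of all \<open>z \<in> A\<close> with \<open>dz \<in> A\<close>.
\<close>
context dieudonne_cplx
begin

interpretation L: dieudonne_cplx p L by unfold_locales (rule L_dieudonne)

definition S_set :: "int \<Rightarrow> ('a \<times> nat) set set" where
  "S_set n = {z \<in> carrier (grp L n). \<exists>r. (frob L n ^^ r) z \<in> loc n ` C n \<and>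
                 (frob L (n + 1) ^^ r) (diff L n z) \<in> loc (n + 1) ` C (n + 1)}"

definition S :: "('a \<times> nat) set dieudonne" where
  "S = \<lparr>grp = (\<lambda>n. (grp L n)\<lparr>carrier := S_set n\<rparr>), diff = diff L, frob = frob L\<rparr>"

lemma loc_closed [simp]: "x \<in> C n \<Longrightarrow> loc n x \<in> carrier (grp L n)"
  by (rule mor_facts(1)[OF loc_mor])

lemma img_frob: "z \<in> loc n ` C n \<Longrightarrow> (frob L n ^^ k) z \<in> loc n ` C n"
  using mor_facts(3)[OF loc_mor, symmetric] by (force intro!: imageI)
lemma img_frob_le: "(frob L n ^^ r) z \<in> loc n ` C n \<Longrightarrow> r \<le> s \<Longrightarrow> (frob L n ^^ s) z \<in> loc n ` C n"
  using img_frob[of "(frob L n ^^ r) z" n "s - r"] funpow_add[of "s - r" r "frob L n"] by simp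
lemma img_mult:
  assumes "a \<in> loc n ` C n" "b \<in> loc n ` C n"
  shows "a \<otimes>\<^bsub>grp L n\<^esub> b \<in> loc n ` C n"
  using assms mor_mult[OF loc_mor, symmetric] by (force intro!: imageI)
lemma loc_hom: "loc n \<in> hom (grp M n) (grp L n)"
  using loc_mor by (simp add: dieudonne_mor_def cochain_map_def)
lemma img_one: "\<one>\<^bsub>grp L n\<^esub> \<in> loc n ` C n"
  by (rule image_eqI[of _ _ "e n"]) (simp_all add: hom_one[OF loc_hom grpM' L.grpM'])
lemma img_inv: "a \<in> loc n ` C n \<Longrightarrow> inv\<^bsub>grp L n\<^esub> a \<in> loc n ` C n"
proof -
  assume "a \<in> loc n ` C n"
  then obtain x where x: "x \<in> C n" "a = loc n x" by auto
  then have "inv\<^bsub>grp L n\<^esub> a = loc n (inv\<^bsub>grp M n\<^esub> x)"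
    using group_hom.hom_inv[OF group_hom.intro[OF grpM' L.grpM' group_hom_axioms.intro[OF loc_hom]]]
    by simp
  then show ?thesis using x by simp
qed

lemma S_set_iff:
  "z \<in> S_set n \<longleftrightarrow> z \<in> carrier (grp L n) \<and> (\<exists>r. (frob L n ^^ r) z \<in> loc n ` C n) \<and>
     (\<exists>r. (frob L (n + 1) ^^ r) (diff L n z) \<in> loc (n + 1) ` C (n + 1))" (is "?l \<longleftrightarrow> ?r")
proof
  assume ?r
  then obtain r s where *: "z \<in> carrier (grp L n)" "(frob L n ^^ r) z \<in> loc n ` C n"
    "(frob L (n + 1) ^^ s) (diff L n z) \<in> loc (n + 1) ` C (n + 1)" by blast
  then have "(frob L n ^^ max r s) z \<in> loc n ` C n"
    "(frob L (n + 1) ^^ max r s) (diff L n z) \<in> loc (n + 1) ` C (n + 1)"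
    using img_frob_le[of r n z "max r s"] img_frob_le[of s "n + 1" "diff L n z" "max r s"] by simp_all
  then show ?l using * unfolding S_set_def by blast
qed (auto simp: S_set_def)

lemma S_set_L: "z \<in> S_set n \<Longrightarrow> z \<in> carrier (grp L n)"
  by (simp add: S_set_def)

lemma S_rep:
  assumes "z \<in> S_set n"
  obtains r x y where "x \<in> C n" "y \<in> C (n + 1)" "(frob L n ^^ r) z = loc n x"
    "(frob L (n + 1) ^^ r) (diff L n z) = loc (n + 1) y"
  using assms by (auto simp: S_set_def)

lemma S_rep2:
  assumes "z \<in> S_set n" "w \<in> S_set n"
  obtains r x y x' y' where "x \<in> C n" "y \<in> C (n + 1)" "(frob L n ^^ r) z = loc n x"
    "(frob L (n + 1) ^^ r) (diff L n z) = loc (n + 1) y"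
    "x' \<in> C n" "y' \<in> C (n + 1)" "(frob L n ^^ r) w = loc n x'"
    "(frob L (n + 1) ^^ r) (diff L n w) = loc (n + 1) y'"
proof -
  obtain r where r: "(frob L n ^^ r) z \<in> loc n ` C n"
    "(frob L (n + 1) ^^ r) (diff L n z) \<in> loc (n + 1) ` C (n + 1)" using assms(1) by (auto simp: S_set_def)
  obtain s where s: "(frob L n ^^ s) w \<in> loc n ` C n"
    "(frob L (n + 1) ^^ s) (diff L n w) \<in> loc (n + 1) ` C (n + 1)" using assms(2) by (auto simp: S_set_def)
  let ?m = "max r s"
  have "(frob L n ^^ ?m) z \<in> loc n ` C n" "(frob L (n + 1) ^^ ?m) (diff L n z) \<in> loc (n + 1) ` C (n + 1)"
    "(frob L n ^^ ?m) w \<in> loc n ` C n" "(frob L (n + 1) ^^ ?m) (diff L n w) \<in> loc (n + 1) ` C (n + 1)"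
    using img_frob_le[OF r(1), of ?m] img_frob_le[OF r(2), of ?m]
      img_frob_le[OF s(1), of ?m] img_frob_le[OF s(2), of ?m] by simp_all
  then show ?thesis using that by blast
qed

lemma S_subgroup: "subgroup (S_set n) (grp L n)"
proof
  show "S_set n \<subseteq> carrier (grp L n)" by (auto simp: S_set_def)
  show "\<one>\<^bsub>grp L n\<^esub> \<in> S_set n" by (simp add: S_set_iff img_one)
next
  fix z w assume zw: "z \<in> S_set n" "w \<in> S_set n"
  note c = S_set_L[OF zw(1)] S_set_L[OF zw(2)]
  obtain r where r: "(frob L n ^^ r) z \<in> loc n ` C n" "(frob L n ^^ r) w \<in> loc n ` C n"
    "(frob L (n + 1) ^^ r) (diff L n z) \<in> loc (n + 1) ` C (n + 1)"
    "(frob L (n + 1) ^^ r) (diff L n w) \<in> loc (n + 1) ` C (n + 1)"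
    using zw by (elim S_rep2[of z n w]) auto
  have "(frob L n ^^ r) (z \<otimes>\<^bsub>grp L n\<^esub> w) \<in> loc n ` C n"
    using img_mult[OF r(1,2)] c by (simp add: L.Fk_ml)
  moreover have "(frob L (n + 1) ^^ r) (diff L n (z \<otimes>\<^bsub>grp L n\<^esub> w)) \<in> loc (n + 1) ` C (n + 1)"
    using img_mult[OF r(3,4)] c by (simp add: L.Fk_ml L.d_ml)
  ultimately show "z \<otimes>\<^bsub>grp L n\<^esub> w \<in> S_set n" using c by (auto simp: S_set_def)
next
  fix z assume z: "z \<in> S_set n"
  note c = S_set_L[OF z]
  obtain r where r: "(frob L n ^^ r) z \<in> loc n ` C n"
    "(frob L (n + 1) ^^ r) (diff L n z) \<in> loc (n + 1) ` C (n + 1)"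
    using z by (auto simp: S_set_def)
  have "(frob L n ^^ r) (inv\<^bsub>grp L n\<^esub> z) \<in> loc n ` C n"
    using img_inv[OF r(1)] c by (simp add: L.iv_Fk)
  moreover have "(frob L (n + 1) ^^ r) (diff L n (inv\<^bsub>grp L n\<^esub> z)) \<in> loc (n + 1) ` C (n + 1)"
    using img_inv[OF r(2)] c by (simp add: L.iv_Fk L.iv_d)
  ultimately show "inv\<^bsub>grp L n\<^esub> z \<in> S_set n" using c by (auto simp: S_set_def)
qed

lemma S_diff: "z \<in> S_set n \<Longrightarrow> diff L n z \<in> S_set (n + 1)"
  using S_set_L[of z n] unfolding S_set_iff[of "diff L n z"]
  by (auto simp only: L.dd L.d_closed L.Fk_e img_one S_set_iff)

lemma img_frob_shift:
  assumes "(frob L n ^^ r) z \<in> loc n ` C n"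
  shows "\<exists>r. (frob L n ^^ r) (frob L n z) \<in> loc n ` C n"
  using img_frob[OF assms, of 1] by (auto simp: funpow_swap1)

lemma img_pow:
  assumes "z \<in> carrier (grp L n)" "(frob L n ^^ r) z \<in> loc n ` C n"
  shows "(frob L n ^^ r) (z [^]\<^bsub>grp L n\<^esub> (k::nat)) \<in> loc n ` C n"
proof -
  obtain x where x: "x \<in> C n" "(frob L n ^^ r) z = loc n x" using assms(2) by auto
  have "(frob L n ^^ r) (z [^]\<^bsub>grp L n\<^esub> k) = loc n (pw n x k)"
    using assms(1) x by (simp add: L.Fk_pw mor_facts(4)[OF loc_mor])
  then show ?thesis using x by simp
qed

lemma S_frob: "z \<in> S_set n \<Longrightarrow> frob L n z \<in> S_set n"
proof -
  assume z: "z \<in> S_set n"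
  note c = S_set_L[OF z]
  obtain r s where r: "(frob L n ^^ r) z \<in> loc n ` C n"
    "(frob L (n + 1) ^^ s) (frob L (n + 1) (diff L n z)) \<in> loc (n + 1) ` C (n + 1)"
    using z img_frob_shift unfolding S_set_def by blast
  have "(frob L (n + 1) ^^ s) (diff L n (frob L n z)) \<in> loc (n + 1) ` C (n + 1)"
    unfolding L.dF[OF c] by (rule img_pow) (use r c in simp_all)
  then show ?thesis using c img_frob_shift[OF r(1)] unfolding S_set_iff[of "frob L n z"] by auto
qed

lemma S_simps [simp]:
  "carrier (grp S n) = S_set n" "diff S = diff L" "frob S = frob L"
  "x \<otimes>\<^bsub>grp S n\<^esub> y = x \<otimes>\<^bsub>grp L n\<^esub> y" "\<one>\<^bsub>grp S n\<^esub> = \<one>\<^bsub>grp L n\<^esub>"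
  by (simp_all add: S_def)

lemma S_pow [simp]: "x [^]\<^bsub>grp S n\<^esub> (k::nat) = x [^]\<^bsub>grp L n\<^esub> k"
  using monoid.nat_pow_consistent[OF L.monM] by (simp add: S_def)

lemma S_dieudonne: "dieudonne_complex p S"
  unfolding dieudonne_complex_def cochain_complex_def
proof (intro conjI allI ballI)
  fix n show "comm_group (grp S n)"
  proof (rule group.group_comm_groupI)
    show "group (grp S n)"
      using subgroup.subgroup_is_group[OF S_subgroup L.grpM'] by (simp add: S_def)
    fix x y assume "x \<in> carrier (grp S n)" "y \<in> carrier (grp S n)"
    then show "x \<otimes>\<^bsub>grp S n\<^esub> y = y \<otimes>\<^bsub>grp S n\<^esub> x"
      using comm_monoid.m_comm[OF comm_group.axioms(1)[OF L.grpM]] by (simp add: S_set_L)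
  qed
next
  fix n show "diff S n \<in> hom (grp S n) (grp S (n + 1))"
    by (rule homI) (use S_diff S_set_L L.d_ml in \<open>simp_all only: S_simps\<close>)
next
  fix n show "frob S n \<in> hom (grp S n) (grp S n)"
    by (rule homI) (use S_frob S_set_L L.F_ml in \<open>simp_all only: S_simps\<close>)
next
  fix n x assume "x \<in> carrier (grp S n)"
  then have "x \<in> carrier (grp L n)" by (simp add: S_set_L)
  then show "diff S (n + 1) (diff S n x) = \<one>\<^bsub>grp S (n + 1 + 1)\<^esub>"
    "diff S n (frob S n x) = frob S (n + 1) (diff S n x) [^]\<^bsub>grp S (n + 1)\<^esub> p"
    unfolding S_simps S_pow by (rule L.dd, rule L.dF)
qed

lemma S_saturated: "saturated p S"
  unfolding saturated_def
proof (intro conjI allI)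
  show "dieudonne_complex p S" by (rule S_dieudonne)
  show "p_torsion_free p S"
    using L_torsion_free by (auto simp: p_torsion_free_def S_set_L)
next
  fix n
  let ?Z = "{x \<in> S_set n. diff L n x \<in> multiples p (grp S (n + 1))}"
  have into: "frob L n z \<in> ?Z" if "z \<in> S_set n" for z
  proof -
    have "frob L (n + 1) (diff L n z) \<in> S_set (n + 1)" using that by (intro S_frob S_diff)
    then have "diff L n (frob L n z) \<in> multiples p (grp S (n + 1))"
      unfolding multiples_def L.dF[OF S_set_L[OF that]] S_simps S_pow by (rule imageI)
    then show ?thesis using S_frob[OF that] by simp
  qed
  have "frob L n ` S_set n = ?Z"
  proof
    show "?Z \<subseteq> frob L n ` S_set n"
    proof
      fix x assume "x \<in> ?Z"
      then obtain w where x: "x \<in> S_set n" and w: "w \<in> S_set (n + 1)"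
        "diff L n x = w [^]\<^bsub>grp L (n + 1)\<^esub> p" by (auto simp: multiples_def)
      obtain z where z: "z \<in> carrier (grp L n)" "frob L n z = x"
      proof -
        have "x \<in> frob L n ` carrier (grp L n)" unfolding L_frob_surj using x by (rule S_set_L)
        then show ?thesis using that by auto
      qed
      have "frob L (n + 1) (diff L n z) [^]\<^bsub>grp L (n + 1)\<^esub> p = w [^]\<^bsub>grp L (n + 1)\<^esub> p"
        using w z L.dF[OF z(1)] by simp
      then have Fw: "frob L (n + 1) (diff L n z) = w"
        by (rule L.pw_inj1[OF L_torsion_free, rotated 2]) (use z S_set_L[OF w(1)] in simp_all)
      obtain r where "(frob L n ^^ r) x \<in> loc n ` C n" using x by (auto simp: S_set_def)
      then have 1: "(frob L n ^^ Suc r) z \<in> loc n ` C n" using z by (simp add: funpow_swap1)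
      obtain s where "(frob L (n + 1) ^^ s) w \<in> loc (n + 1) ` C (n + 1)"
        using w by (auto simp: S_set_def)
      then have 2: "(frob L (n + 1) ^^ Suc s) (diff L n z) \<in> loc (n + 1) ` C (n + 1)"
        using Fw by (simp add: funpow_swap1)
      have "z \<in> S_set n" using z 1 2 unfolding S_set_iff by blast
      then show "x \<in> frob L n ` S_set n" using z by auto
    qed
  qed (use into in blast)
  moreover have "inj_on (frob L n) (S_set n)"
    using L_frob_inj by (rule inj_on_subset) (auto simp: S_set_L)
  moreover have "frob L n \<in> hom (grp S n) ((grp S n)\<lparr>carrier := ?Z\<rparr>)"
  proof (rule homI)
    fix z assume "z \<in> carrier (grp S n)"
    then have "frob L n z \<in> ?Z" by (intro into) simp
    then show "frob L n z \<in> carrier ((grp S n)\<lparr>carrier := ?Z\<rparr>)" by simp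
  next
    fix z w assume "z \<in> carrier (grp S n)" "w \<in> carrier (grp S n)"
    then show "frob L n (z \<otimes>\<^bsub>grp S n\<^esub> w) = frob L n z \<otimes>\<^bsub>(grp S n)\<lparr>carrier := ?Z\<rparr>\<^esub> frob L n w"
      by (simp add: S_set_L L.F_ml)
  qed
  ultimately show "frob S n \<in> iso (grp S n)
        ((grp S n)\<lparr>carrier := {x \<in> carrier (grp S n). diff S n x \<in> multiples p (grp S (n + 1))}\<rparr>)"
    unfolding iso_def bij_betw_def S_simps by simp
qed

lemma loc_S: "x \<in> C n \<Longrightarrow> loc n x \<in> S_set n"
  unfolding S_set_iff
  by (intro conjI exI[of _ 0]) (simp_all add: mor_facts(2)[OF loc_mor, symmetric])

lemma loc_S_mor: "dieudonne_mor p M S loc"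
  using loc_mor S_dieudonne loc_S
  by (auto simp: dieudonne_mor_def cochain_map_def dieudonne_complex_def hom_def)

definition extend :: "'t dieudonne \<Rightarrow> (int \<Rightarrow> 'a \<Rightarrow> 't) \<Rightarrow> int \<Rightarrow> ('a \<times> nat) set \<Rightarrow> 't" where
  "extend T f n z = (THE t. t \<in> carrier (grp T n) \<and>
     (\<exists>r. \<exists>x \<in> C n. (frob L n ^^ r) z = loc n x \<and> (frob T n ^^ r) t = f n x))"

lemma S_universal:
  fixes T :: "'t dieudonne"
  assumes T: "saturated p T" and f: "dieudonne_mor p M T f"
  shows "dieudonne_mor p S T (extend T f)"
    and "x \<in> C n \<Longrightarrow> extend T f n (loc n x) = f n x"
    and "dieudonne_mor p S T h \<Longrightarrow> (\<forall>n. \<forall>x \<in> C n. h n (loc n x) = f n x) \<Longrightarrow>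
         z \<in> S_set n \<Longrightarrow> h n z = extend T f n z"
proof -
  interpret T: dieudonne_cplx p T using f by unfold_locales (simp add: dieudonne_mor_def)
  let ?g = "extend T f"
  note fc [simp] = mor_facts(1)[OF f]
  have f_loc: "f n x = f n y" if xy: "x \<in> C n" "y \<in> C n" "loc n x = loc n y" for n x y
  proof -
    obtain k where k: "(G n ^^ k) x = (G n ^^ k) y" using loc_eq[OF xy] ..
    have "(T.G n ^^ k) (f n u) = f n ((G n ^^ k) u)" if "u \<in> C n" for u
      using that by (simp add: T.Gk_eq Gk_eq mor_facts(3,4)[OF f])
    then have "(T.G n ^^ k) (f n x) = (T.G n ^^ k) (f n y)" using xy k by simp
    then show ?thesis by (rule T.sat_Gk_inj[OF T, rotated 2]) (use xy in simp_all)
  qed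
  have uniq: "t = u"
    if "t \<in> T.C n" "x \<in> C n" "(frob L n ^^ r) z = loc n x" "(T.F n ^^ r) t = f n x"
      "u \<in> T.C n" "y \<in> C n" "(frob L n ^^ s) z = loc n y" "(T.F n ^^ s) u = f n y"
    for n t u x y z r s
  proof -
    have "loc n ((F n ^^ s) x) = (frob L n ^^ s) ((frob L n ^^ r) z)"
      using that by (simp add: mor_facts(3)[OF loc_mor])
    also have "\<dots> = (frob L n ^^ r) ((frob L n ^^ s) z)" by (rule funpow_comm_apply)
    also have "\<dots> = loc n ((F n ^^ r) y)" using that by (simp add: mor_facts(3)[OF loc_mor])
    finally have "f n ((F n ^^ s) x) = f n ((F n ^^ r) y)" using that by (intro f_loc) simp_all
    then have "(T.F n ^^ s) ((T.F n ^^ r) t) = (T.F n ^^ r) ((T.F n ^^ s) u)"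
      using that by (simp add: mor_facts(3)[OF f])
    also have "\<dots> = (T.F n ^^ s) ((T.F n ^^ r) u)" by (rule funpow_comm_apply)
    finally have "(T.F n ^^ r) t = (T.F n ^^ r) u"
      by (rule T.sat_Fk_inj[OF T, rotated 2]) (use that in simp_all)
    then show ?thesis by (rule T.sat_Fk_inj[OF T, rotated 2]) (use that in simp_all)
  qed
  have gI: "?g n z = t"
    if "t \<in> T.C n" "x \<in> C n" "(frob L n ^^ r) z = loc n x" "(T.F n ^^ r) t = f n x" for n t x z r
    unfolding extend_def by (rule the_equality) (use that uniq in blast)+
  have ex: "\<exists>t \<in> T.C n. (T.F n ^^ r) t = f n x \<and> (T.F (n + 1) ^^ r) (T.d n t) = f (n + 1) y"
    if z: "z \<in> S_set n" and xy: "x \<in> C n" "y \<in> C (n + 1)" and r: "(frob L n ^^ r) z = loc n x"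
      "(frob L (n + 1) ^^ r) (diff L n z) = loc (n + 1) y" for n x y z r
  proof -
    have "loc (n + 1) (d n x) = diff L n ((frob L n ^^ r) z)"
      using xy r by (simp add: mor_facts(2)[OF loc_mor])
    also have "\<dots> = loc (n + 1) y [^]\<^bsub>grp L (n + 1)\<^esub> (p ^ r)"
      using L.dFk[OF S_set_L[OF z], of r] by (simp only: r)
    also have "\<dots> = loc (n + 1) (pw (n + 1) y (p ^ r))"
      using xy by (simp add: mor_facts(4)[OF loc_mor])
    finally have "f (n + 1) (d n x) = f (n + 1) (pw (n + 1) y (p ^ r))"
      using xy by (intro f_loc) simp_all
    then have *: "T.d n (f n x) = T.pw (n + 1) (f (n + 1) y) (p ^ r)"
      using xy by (simp add: mor_facts(2,4)[OF f])
    then obtain t where t: "t \<in> T.C n" "(T.F n ^^ r) t = f n x"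
      using T.sat_Fk_surj[OF T, of "f n x" n "f (n + 1) y" r] xy by auto
    have "T.pw (n + 1) ((T.F (n + 1) ^^ r) (T.d n t)) (p ^ r) = T.pw (n + 1) (f (n + 1) y) (p ^ r)"
      using t * by (simp add: T.dFk[symmetric])
    then have "(T.F (n + 1) ^^ r) (T.d n t) = f (n + 1) y"
      by (rule T.pw_inj[rotated 3]) (use t xy T in \<open>simp_all add: saturated_def\<close>)
    then show ?thesis using t by blast
  qed
  have gD: "?g n z \<in> T.C n \<and> (T.F n ^^ r) (?g n z) = f n x \<and> ?g (n + 1) (diff L n z) = T.d n (?g n z)"
    if z: "z \<in> S_set n" and xy: "x \<in> C n" "y \<in> C (n + 1)" and r: "(frob L n ^^ r) z = loc n x"
      "(frob L (n + 1) ^^ r) (diff L n z) = loc (n + 1) y" for n x y z r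
  proof -
    obtain t where t: "t \<in> T.C n" "(T.F n ^^ r) t = f n x" "(T.F (n + 1) ^^ r) (T.d n t) = f (n + 1) y"
      using ex[OF z xy r] by blast
    then show ?thesis
      using gI[OF t(1) xy(1) r(1) t(2)] gI[OF _ xy(2) r(2) t(3)] by simp
  qed
  show "dieudonne_mor p S T ?g"
    unfolding dieudonne_mor_def cochain_map_def
  proof (intro conjI allI ballI)
    show "dieudonne_complex p S" "dieudonne_complex p T"
      using S_dieudonne T.dieudonne by simp_all
    then show "cochain_complex S" "cochain_complex T" by (simp_all add: dieudonne_complex_def)
  next
    fix n show "?g n \<in> hom (grp S n) (grp T n)"
    proof (rule homI)
      fix z assume "z \<in> carrier (grp S n)"
      then have "z \<in> S_set n" by simp
      then show "?g n z \<in> carrier (grp T n)" by (rule S_rep) (use gD \<open>z \<in> S_set n\<close> in blast)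
    next
      fix z w assume "z \<in> carrier (grp S n)" "w \<in> carrier (grp S n)"
      then have zw: "z \<in> S_set n" "w \<in> S_set n" by simp_all
      from zw obtain r x y x' y' where *: "x \<in> C n" "y \<in> C (n + 1)" "(frob L n ^^ r) z = loc n x"
        "(frob L (n + 1) ^^ r) (diff L n z) = loc (n + 1) y"
        "x' \<in> C n" "y' \<in> C (n + 1)" "(frob L n ^^ r) w = loc n x'"
        "(frob L (n + 1) ^^ r) (diff L n w) = loc (n + 1) y'" by (rule S_rep2)
      note 1 = gD[OF zw(1) *(1-4)] and 2 = gD[OF zw(2) *(5-8)]
      have "?g n (z \<otimes>\<^bsub>grp L n\<^esub> w) = ?g n z \<otimes>\<^bsub>grp T n\<^esub> ?g n w"
        by (rule gI[of _ n "ml n x x'" r])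
           (use * 1 2 zw in \<open>simp_all add: S_set_L L.Fk_ml T.Fk_ml mor_mult[OF f] mor_mult[OF loc_mor]\<close>)
      then show "?g n (z \<otimes>\<^bsub>grp S n\<^esub> w) = ?g n z \<otimes>\<^bsub>grp T n\<^esub> ?g n w" by simp
    qed
  next
    fix n z assume "z \<in> carrier (grp S n)"
    then have z: "z \<in> S_set n" by simp
    then obtain r x y where *: "x \<in> C n" "y \<in> C (n + 1)" "(frob L n ^^ r) z = loc n x"
        "(frob L (n + 1) ^^ r) (diff L n z) = loc (n + 1) y" by (rule S_rep)
    note 1 = gD[OF z *]
    show "?g (n + 1) (diff S n z) = diff T n (?g n z)" using 1 by simp
    have "?g n (frob L n z) = frob T n (?g n z)"
      by (rule gI[of _ n "F n x" r])
         (use * 1 mor_facts(3)[OF f, of x n 1] mor_facts(3)[OF loc_mor, of x n 1]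
          in \<open>simp_all add: funpow_swap1[symmetric]\<close>)
    then show "?g n (frob S n z) = frob T n (?g n z)" by simp
  qed
  show "?g n (loc n x) = f n x" if "x \<in> C n"
    by (rule gI[of _ n x 0]) (use that in simp_all)
  show "h n z = ?g n z"
    if h: "dieudonne_mor p S T h" "\<forall>n. \<forall>x \<in> C n. h n (loc n x) = f n x" and z: "z \<in> S_set n"
  proof -
    from z obtain r x y where *: "x \<in> C n" "y \<in> C (n + 1)" "(frob L n ^^ r) z = loc n x"
        "(frob L (n + 1) ^^ r) (diff L n z) = loc (n + 1) y" by (rule S_rep)
    have "(T.F n ^^ r) (h n z) = f n x"
      using mor_facts(3)[OF h(1), of z n r] z * h(2) by simp
    moreover have "h n z \<in> T.C n" using mor_facts(1)[OF h(1)] z by simp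
    ultimately show ?thesis using gI * by metis
  qed
qed

lemma S_saturation: "saturation_among TYPE('t) p M S loc"
  unfolding saturation_among_def
proof (intro conjI allI impI)
  fix T :: "'t dieudonne" and f
  assume Tf: "saturated p T \<and> dieudonne_mor p M T f"
  show "\<exists>g. dieudonne_mor p S T g \<and> (\<forall>n. \<forall>x \<in> C n. g n (loc n x) = f n x) \<and>
           (\<forall>h. dieudonne_mor p S T h \<and> (\<forall>n. \<forall>x \<in> C n. h n (loc n x) = f n x) \<longrightarrow>
              (\<forall>n. \<forall>y \<in> carrier (grp S n). h n y = g n y))"
  proof (intro exI[of _ "extend T f"] conjI allI ballI impI)
    note u = S_universal[OF conjunct1[OF Tf] conjunct2[OF Tf]]
    show "dieudonne_mor p S T (extend T f)" by (rule u(1))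
    show "extend T f n (loc n x) = f n x" if "x \<in> C n" for n x using that by (rule u(2))
    fix h n y
    assume h: "dieudonne_mor p S T h \<and> (\<forall>n. \<forall>x \<in> C n. h n (loc n x) = f n x)"
      and y: "y \<in> carrier (grp S n)"
    then have "y \<in> S_set n" by simp
    with conjunct1[OF h] conjunct2[OF h] show "h n y = extend T f n y" by (rule u(3))
  qed
qed (rule S_saturated loc_S_mor)+

end

lemma saturation_amongD:
  fixes T :: "'t dieudonne"
  assumes "saturation_among TYPE('t) p M N i" "saturated p T" "dieudonne_mor p M T f"
  shows "\<exists>g. dieudonne_mor p N T g \<and> (\<forall>n. \<forall>x \<in> carrier (grp M n). g n (i n x) = f n x) \<and>
           (\<forall>h. dieudonne_mor p N T h \<and> (\<forall>n. \<forall>x \<in> carrier (grp M n). h n (i n x) = f n x) \<longrightarrow>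
              (\<forall>n. \<forall>y \<in> carrier (grp N n). h n y = g n y))"
  using assms(1)[unfolded saturation_among_def, THEN conjunct2, THEN conjunct2, rule_format, OF conjI, OF assms(2,3)] .

theorem saturation_exists:
  fixes M :: "'a dieudonne"
  assumes "dieudonne_complex p M"
  shows "\<exists>(N :: ('a \<times> nat) set dieudonne) i. is_saturation p M N i"
proof -
  interpret dieudonne_cplx p M using assms by unfold_locales
  have "is_saturation p M S loc" unfolding is_saturation_def by (intro conjI S_saturation)
  then show ?thesis by blast
qed

theorem is_saturation_universal:
  fixes M :: "'a dieudonne" and N :: "'b dieudonne"
  assumes sat: "is_saturation p M N i"
  shows "saturation_among TYPE('t) p M N i"
proof -
  have N: "saturated p N" "dieudonne_mor p M N i"
    using sat by (simp_all add: is_saturation_def saturation_among_def)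
  interpret dieudonne_cplx p M using N by unfold_locales (simp add: dieudonne_mor_def)
  obtain a where a: "dieudonne_mor p N S a" "\<forall>n. \<forall>x \<in> C n. a n (i n x) = loc n x"
    using saturation_amongD[OF conjunct2[OF sat[unfolded is_saturation_def]] S_saturated loc_S_mor]
    by (elim exE conjE)
  note b = S_universal[OF N]
  let ?b = "extend N i"
  have ba: "?b n (a n y) = y" if "y \<in> carrier (grp N n)" for n y
  proof -
    have 1: "dieudonne_mor p N N (\<lambda>n y. ?b n (a n y))" by (rule mor_comp[OF a(1) b(1)])
    have 2: "dieudonne_mor p N N (\<lambda>n y. y)" using N(1) by (intro mor_id) (simp add: saturated_def)
    obtain g where g: "\<forall>h. dieudonne_mor p N N h \<and> (\<forall>n. \<forall>x \<in> C n. h n (i n x) = i n x) \<longrightarrow>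
              (\<forall>n. \<forall>y \<in> carrier (grp N n). h n y = g n y)"
      using saturation_amongD[OF conjunct1[OF sat[unfolded is_saturation_def]] N] by (elim exE conjE)
    have "?b n (a n y) = g n y"
      using g[rule_format, of "\<lambda>n y. ?b n (a n y)" y n] 1 a(2) b(2) that by simp
    moreover have "y = g n y"
      using g[rule_format, of "\<lambda>n y. y" y n] 2 that by simp
    ultimately show ?thesis by simp
  qed
  show ?thesis
    unfolding saturation_among_def
  proof (intro conjI allI impI)
    fix T :: "'t dieudonne" and f
    assume "saturated p T \<and> dieudonne_mor p M T f"
    then have T: "saturated p T" "dieudonne_mor p M T f" by simp_all
    note u = S_universal[OF T]
    let ?g = "\<lambda>n y. extend T f n (a n y)"
    have "h n y = ?g n y"
      if h: "dieudonne_mor p N T h" "\<forall>n. \<forall>x \<in> C n. h n (i n x) = f n x"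
        and y: "y \<in> carrier (grp N n)" for h n y
    proof -
      have "dieudonne_mor p S T (\<lambda>n z. h n (?b n z))" by (rule mor_comp[OF b(1) h(1)])
      then have "h n (?b n (a n y)) = extend T f n (a n y)"
        by (rule u(3)) (use h b(2) mor_facts(1)[OF a(1)] y in simp_all)
      then show ?thesis using ba y by simp
    qed
    moreover have "dieudonne_mor p N T ?g" by (rule mor_comp[OF a(1) u(1)])
    moreover have "\<forall>n. \<forall>x \<in> C n. ?g n (i n x) = f n x" using a(2) u(2) by simp
    ultimately show "\<exists>g. dieudonne_mor p N T g \<and> (\<forall>n. \<forall>x \<in> C n. g n (i n x) = f n x) \<and>
           (\<forall>h. dieudonne_mor p N T h \<and> (\<forall>n. \<forall>x \<in> C n. h n (i n x) = f n x) \<longrightarrow>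
              (\<forall>n. \<forall>y \<in> carrier (grp N n). h n y = g n y))"
      by blast
  qed (rule N)+
qed

end

theory Submission
  imports Defs
begin

text \<open>
  Written additively, the proof compares \<open>M/p\<close> with \<open>W(N)/p\<close> in two steps, where
  \<open>N = Sat(M)\<close>.

  \<^item> \<open>M/p \<rightarrow> N/p\<close> is a quasi-isomorphism. Let \<open>M\<^sub>r\<close> be the complex of all \<open>x\<close> with
  \<open>dx \<in> p\<^sup>r M\<close>, with differential \<open>x \<mapsto> dx / p\<^sup>r\<close>. Then \<open>F\<close> is a map of complexes
  \<open>M\<^sub>r \<rightarrow> M\<^sub>r\<^sub>+\<^sub>1\<close>, and \<open>N\<close> is the colimit of \<open>M \<rightarrow> M\<^sub>1 \<rightarrow> M\<^sub>2 \<rightarrow> \<dots>\<close>. Being of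
  Cartier type makes the first map a quasi-isomorphism modulo \<open>p\<close>: a cocycle of \<open>M\<^sub>1/p\<close> is
  essentially a class in \<open>H(M/p)\<close>. Passing from \<open>M\<^sub>r\<close> to \<open>M\<^sub>r\<^sub>+\<^sub>1\<close> preserves
  quasi-isomorphisms modulo \<open>p\<close>, because the cohomology of \<open>M\<^sub>r\<^sub>+\<^sub>1/p\<close> is determined by
  that of \<open>M\<^sub>r/p\<close> and its Bockstein map. So every map of the tower is one, and so is the
  map to the colimit: \<open>frob_quasi_iso\<close>, \<open>saturation_inj\<close>, \<open>saturation_surj\<close>.

  \<^item> \<open>N/p \<rightarrow> W(N)/p\<close> is a quasi-isomorphism. For injectivity on cohomology the quotient
  \<open>N/(VN + dVN)\<close> of \<open>W(N)\<close> is enough: if \<open>d(Va) \<in> pN\<close>, then \<open>Va \<in> pN\<close>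
  (\<open>Vk_cocycle_mod_p\<close>). For surjectivity, a class \<open>Z \<in> W(N)\<close> with \<open>dZ \<in> pW(N)\<close> is
  approximated by elements \<open>F x\<^sub>r\<close> with \<open>x\<^sub>r \<in> N\<close>, where
  \<open>x\<^sub>r\<^sub>+\<^sub>1 - x\<^sub>r = V\<^sup>r\<^sup>+\<^sup>1 u\<^sub>r + dV\<^sup>r\<^sup>+\<^sup>1 v\<^sub>r\<close> (\<open>frob_lift\<close>). Since \<open>FV = p\<close> and
  \<open>FdV = d\<close>, the difference \<open>F x\<^sub>r\<^sub>+\<^sub>1 - F x\<^sub>r = p V\<^sup>r u\<^sub>r + dV\<^sup>r v\<^sub>r\<close> splits into a multiple of
  \<open>p\<close> and a coboundary, and both parts can be summed in \<open>W(N)\<close> (\<open>frob_series\<close>). Hence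
  \<open>Z\<close> is cohomologous modulo \<open>p\<close> to \<open>F x\<^sub>0 \<in> N\<close>.

  All of this is argued with elements instead of cosets: \<open>cartier_type_cplx\<close> restates the
  hypothesis and \<open>quasi_isomorphism_mod_pI\<close> the conclusion in these terms, and the elements of
  \<open>W(N)\<close> are represented by coherent sequences in \<open>N\<close>.
\<close>

section \<open>Calculating in a Dieudonne complex\<close>

text \<open>
  Subtraction is mostly avoided: where a difference \<open>x - y\<close> is wanted, \<open>diff_ex\<close> provides
  \<open>z\<close> with \<open>x = z + y\<close>, and \<open>cancel\<close> removes common summands. The remaining equations
  hold by associativity and commutativity.
\<close>

context dieudonne_cplx
begin

abbreviation iv :: "int \<Rightarrow> 'a \<Rightarrow> 'a" where "iv n x \<equiv> inv\<^bsub>grp M n\<^esub> x"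

lemma assoc: "x \<in> C n \<Longrightarrow> y \<in> C n \<Longrightarrow> z \<in> C n \<Longrightarrow> ml n (ml n x y) z = ml n x (ml n y z)"
  using monoid.m_assoc[OF monM] .
lemma comm: "x \<in> C n \<Longrightarrow> y \<in> C n \<Longrightarrow> ml n x y = ml n y x"
  using comm_monoid.m_comm[OF comm_group.axioms(1)[OF grpM]] .
lemma lcomm: "x \<in> C n \<Longrightarrow> y \<in> C n \<Longrightarrow> z \<in> C n \<Longrightarrow> ml n x (ml n y z) = ml n y (ml n x z)"
  using comm_monoid.m_lcomm[OF comm_group.axioms(1)[OF grpM]] .
lemmas ac = assoc comm lcomm

lemma r_e [simp]: "x \<in> C n \<Longrightarrow> ml n x (e n) = x"
  using monoid.r_one[OF monM] .
lemma r_iv [simp]: "x \<in> C n \<Longrightarrow> ml n x (iv n x) = e n"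
  using group.r_inv[OF grpM'] .
lemma l_iv [simp]: "x \<in> C n \<Longrightarrow> ml n (iv n x) x = e n"
  using group.l_inv[OF grpM'] .
lemma cancel: "x \<in> C n \<Longrightarrow> y \<in> C n \<Longrightarrow> z \<in> C n \<Longrightarrow> ml n x y = ml n x z \<Longrightarrow> y = z"
  by (metis group.right_cancel[OF grpM'] comm)
lemma iv_pw: "x \<in> C n \<Longrightarrow> pw n (iv n x) k = iv n (pw n x k)"
  using group.nat_pow_inv[OF grpM'] by simp
lemma diff_ex:
  assumes "x \<in> C n" "y \<in> C n"
  obtains z where "z \<in> C n" "x = ml n z y"
  by (rule that[of "ml n x (iv n y)"]) (use assms in \<open>simp_all add: assoc\<close>)

lemma neg_ex:
  assumes "x \<in> C n"
  obtains z where "z \<in> C n" "ml n x z = e n"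
  by (rule that[of "iv n x"]) (use assms in simp_all)

text \<open>The differential into degree \<open>n\<close>, without the index \<open>n - 1 + 1\<close>.\<close>
lemma dp_closed [simp]: "x \<in> C (n - 1) \<Longrightarrow> d (n - 1) x \<in> C n"
  using d_closed[of x "n - 1"] by simp
lemma dp_ml: "x \<in> C (n - 1) \<Longrightarrow> y \<in> C (n - 1) \<Longrightarrow>
    d (n - 1) (ml (n - 1) x y) = ml n (d (n - 1) x) (d (n - 1) y)"
  using d_ml[of x "n - 1" y] by simp
lemma dp_pw: "x \<in> C (n - 1) \<Longrightarrow> d (n - 1) (pw (n - 1) x k) = pw n (d (n - 1) x) k"
  using d_pw[of x "n - 1"] by simp
lemma dp_F: "x \<in> C (n - 1) \<Longrightarrow> d (n - 1) (F (n - 1) x) = pw n (F n (d (n - 1) x)) p"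
  using dF[of x "n - 1"] by simp
lemma dp_d [simp]: "x \<in> C (n - 1) \<Longrightarrow> d n (d (n - 1) x) = e (n + 1)"
  using dd[of x "n - 1"] by simp
lemma dp_e [simp]: "d (n - 1) (e (n - 1)) = e n"
  using d_e[of "n - 1"] by simp
declare dd [simp]

text \<open>
  Divided differentials: \<open>ddiv r n x y\<close> says that \<open>x\<close> belongs to \<open>M\<^sub>r\<close> and that \<open>y\<close> is a
  value of its differential \<open>dx / p\<^sup>r\<close>. In a \<open>p\<close>-torsion-free complex \<open>y\<close> is unique and a
  cocycle.
\<close>
definition ddiv :: "nat \<Rightarrow> int \<Rightarrow> 'a \<Rightarrow> 'a \<Rightarrow> bool" where
  "ddiv r n x y \<longleftrightarrow> x \<in> C n \<and> y \<in> C (n + 1) \<and> d n x = pw (n + 1) y (p ^ r)"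

lemma ddiv_closed:
  assumes "ddiv r n x y" shows "x \<in> C n" "y \<in> C (n + 1)"
  using assms by (simp_all add: ddiv_def)
lemma ddiv_eq: "ddiv r n x y \<Longrightarrow> d n x = pw (n + 1) y (p ^ r)"
  by (simp add: ddiv_def)
lemma ddivp_closed:
  assumes "ddiv r (n - 1) x y" shows "x \<in> C (n - 1)" "y \<in> C n"
  using assms by (simp_all add: ddiv_def)
lemma ddivp_eq: "ddiv r (n - 1) x y \<Longrightarrow> d (n - 1) x = pw n y (p ^ r)"
  by (simp add: ddiv_def)
lemma ddiv_ml: "ddiv r n x x' \<Longrightarrow> ddiv r n y y' \<Longrightarrow> ddiv r n (ml n x y) (ml (n + 1) x' y')"
  by (simp add: ddiv_def d_ml pw_ml)
lemma ddiv_iv: "ddiv r n x x' \<Longrightarrow> ddiv r n (iv n x) (iv (n + 1) x')"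
  by (simp add: ddiv_def iv_d iv_pw)
text \<open>As \<open>dF = pFd\<close>, Frobenius is a map of complexes from \<open>M\<^sub>r\<close> to \<open>M\<^sub>r\<^sub>+\<^sub>1\<close>.\<close>
lemma ddiv_F: "ddiv r n x x' \<Longrightarrow> ddiv (Suc r) n (F n x) (F (n + 1) x')"
  by (simp add: ddiv_def dF F_pw pw_pw mult.commute)
lemma ddiv_Fk: "ddiv r n x x' \<Longrightarrow> ddiv (k + r) n ((F n ^^ k) x) ((F (n + 1) ^^ k) x')"
  by (induction k) (simp_all add: ddiv_F)
lemma ddiv_pw: "ddiv r n x x' \<Longrightarrow> ddiv (Suc r) n (pw n x p) x'"
  by (simp add: ddiv_def d_pw pw_pw mult.commute)
lemma ddiv_Suc: "ddiv (Suc r) n x x' \<Longrightarrow> ddiv r n x (pw (n + 1) x' p)"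
  by (simp add: ddiv_def pw_pw mult.commute)
lemma ddiv_0: "x \<in> C n \<Longrightarrow> ddiv 0 n x (d n x)"
  by (simp add: ddiv_def)
lemma ddiv_cocycle: "x \<in> C n \<Longrightarrow> d n x = e (n + 1) \<Longrightarrow> ddiv r n x (e (n + 1))"
  by (simp add: ddiv_def)

end

locale torsion_free_cplx = dieudonne_cplx +
  assumes tf: "p_torsion_free p M"
begin

lemma ddiv_uniq: "ddiv r n x y \<Longrightarrow> ddiv r n x z \<Longrightarrow> y = z"
  using pw_inj[OF tf, of y "n + 1" z r] by (simp add: ddiv_def)

lemma ddiv_d:
  assumes "ddiv r n x y"
  shows "d (n + 1) y = e (n + 1 + 1)"
proof -
  have y: "y \<in> C (n + 1)" "x \<in> C n" using assms by (simp_all add: ddiv_def)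
  have "pw (n + 1 + 1) (d (n + 1) y) (p ^ r) = d (n + 1) (d n x)"
    using ddiv_eq[OF assms] y by (simp only: d_pw)
  also have "\<dots> = pw (n + 1 + 1) (e (n + 1 + 1)) (p ^ r)"
    using y by (simp only: dd pw_e)
  finally show ?thesis
    by (rule pw_inj[OF tf, rotated 2]) (use y d_closed e_closed in blast)+
qed

lemma ddivp_d: "ddiv r (n - 1) x y \<Longrightarrow> d n y = e (n + 1)"
  using ddiv_d[of r "n - 1"] by simp

lemma pw_p_cancel: "x \<in> C n \<Longrightarrow> y \<in> C n \<Longrightarrow> pw n x p = pw n y p \<Longrightarrow> x = y"
  using pw_inj1[OF tf] .

end

section \<open>Frobenius on complexes of Cartier type\<close>

text \<open>The two assumptions say that \<open>F : M/p \<rightarrow> H(M/p)\<close> is injective and surjective.\<close>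
locale cartier_cplx = torsion_free_cplx +
  assumes cartier_inj: "x \<in> C n \<Longrightarrow> y \<in> C n \<Longrightarrow> z \<in> C (n - 1) \<Longrightarrow>
      F n x = ml n (pw n y p) (d (n - 1) z) \<Longrightarrow> \<exists>w \<in> C n. x = pw n w p"
    and cartier_surj: "x \<in> C n \<Longrightarrow> x' \<in> C (n + 1) \<Longrightarrow> d n x = pw (n + 1) x' p \<Longrightarrow>
      \<exists>a \<in> C n. \<exists>y \<in> C n. \<exists>z \<in> C (n - 1). x = ml n (F n a) (ml n (pw n y p) (d (n - 1) z))"
begin

text \<open>
  \<open>frob_surj r\<close> and \<open>frob_inj r\<close>: surjectivity and injectivity of
  \<open>F : H(M\<^sub>r/p) \<rightarrow> H(M\<^sub>r\<^sub>+\<^sub>1/p)\<close>, for representatives. A cocycle of \<open>M\<^sub>r/p\<close> is an \<open>x\<close> with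
  \<open>dx \<in> p\<^sup>r\<^sup>+\<^sup>1 M\<close>, and the coboundaries are the values \<open>w'\<close> of the divided differential.
\<close>
definition frob_surj :: "nat \<Rightarrow> bool" where
  "frob_surj r \<longleftrightarrow> (\<forall>n x x'. ddiv (Suc (Suc r)) n x x' \<longrightarrow>
      (\<exists>a a' z z' w w'. ddiv (Suc r) n a a' \<and> ddiv (Suc r) n z z' \<and> ddiv (Suc r) (n - 1) w w' \<and>
        x = ml n (F n a) (ml n (pw n z p) w')))"

definition frob_inj :: "nat \<Rightarrow> bool" where
  "frob_inj r \<longleftrightarrow> (\<forall>n a a' z z' w w'.
      ddiv (Suc r) n a a' \<longrightarrow> ddiv (Suc r) n z z' \<longrightarrow> ddiv (Suc r) (n - 1) w w' \<longrightarrow>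
      F n a = ml n (pw n z p) w' \<longrightarrow>
      (\<exists>y y' t t'. ddiv r n y y' \<and> ddiv r (n - 1) t t' \<and> a = ml n (pw n y p) t'))"

lemmas frob_surjD = frob_surj_def[THEN iffD1, rule_format]
lemmas frob_injD = frob_inj_def[THEN iffD1, rule_format]

text \<open>
  The Cartier condition writes \<open>x = Fa + py + dz\<close>. Applying \<open>d\<close> shows that \<open>F(da)\<close> is a
  coboundary modulo \<open>p\<close>, so \<open>p\<close> divides \<open>da\<close> and then \<open>dy\<close>; and \<open>dz\<close> is the divided
  differential of \<open>pz\<close>.
\<close>
lemma frob_surj_0: "frob_surj 0"
  unfolding frob_surj_def
proof (intro allI impI)
  fix n x x' assume x: "ddiv (Suc (Suc 0)) n x x'"
  note x1 = ddiv_Suc[OF x]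
  obtain a y z where ayz: "a \<in> C n" "y \<in> C n" "z \<in> C (n - 1)"
    "x = ml n (F n a) (ml n (pw n y p) (d (n - 1) z))"
    using cartier_surj[of x n "pw (n + 1) x' p"] ddiv_closed[OF x] ddiv_eq[OF x1] by auto
  have "pw (n + 1) (pw (n + 1) x' p) p = d n x" using ddiv_eq[OF x1] by simp
  also have "\<dots> = pw (n + 1) (ml (n + 1) (F (n + 1) (d n a)) (d n y)) p"
    using ayz by (simp add: d_ml dF d_pw pw_ml)
  finally have eq: "pw (n + 1) x' p = ml (n + 1) (F (n + 1) (d n a)) (d n y)"
    by (rule pw_p_cancel[rotated 2]) (use ayz ddiv_closed[OF x] in simp_all)
  obtain y1 where y1: "y1 \<in> C n" "ml n y y1 = e n" using neg_ex ayz by metis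
  then have dy1: "ml (n + 1) (d n y) (d n y1) = e (n + 1)" using ayz by (simp flip: d_ml)
  have "F (n + 1) (d n a) = ml (n + 1) (pw (n + 1) x' p) (d n y1)"
    unfolding eq using ayz y1 ddiv_closed[OF x] dy1 by (simp add: assoc)
  then obtain a' where a': "a' \<in> C (n + 1)" "d n a = pw (n + 1) a' p"
    using cartier_inj[of "d n a" "n + 1" x' y1] ddiv_closed[OF x] y1 ayz by auto
  then obtain y' where y': "y' \<in> C (n + 1)" "x' = ml (n + 1) y' (F (n + 1) a')"
    using diff_ex[of x' "n + 1" "F (n + 1) a'"] ddiv_closed[OF x] by auto
  have "ml (n + 1) (F (n + 1) (d n a)) (d n y) = ml (n + 1) (F (n + 1) (d n a)) (pw (n + 1) y' p)"
    unfolding eq[symmetric] using a' y' by (simp add: pw_ml F_pw comm)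
  then have "d n y = pw (n + 1) y' p"
    by (rule cancel[rotated 3]) (use ayz y' in simp_all)
  then show "\<exists>a a' z z' w w'. ddiv (Suc 0) n a a' \<and> ddiv (Suc 0) n z z' \<and> ddiv (Suc 0) (n - 1) w w' \<and>
      x = ml n (F n a) (ml n (pw n z p) w')"
    using ayz a' y' by (intro exI[of _ a] exI[of _ a'] exI[of _ y] exI[of _ y']
      exI[of _ "pw (n - 1) z p"] exI[of _ "d (n - 1) z"]) (simp add: ddiv_def dp_pw)
qed

text \<open>
  Here \<open>w\<close> is a cocycle modulo \<open>p\<close>, so \<open>w = Ft + ps + q\<close> with \<open>dq = 0\<close> and
  \<open>w' = dw / p = F(dt) + ds\<close>. Hence \<open>F(a - dt)\<close> is a coboundary modulo \<open>p\<close>.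
\<close>
lemma frob_inj_0: "frob_inj 0"
  unfolding frob_inj_def
proof (intro allI impI)
  fix n a a' z z' w w'
  assume h: "ddiv (Suc 0) n a a'" "ddiv (Suc 0) n z z'" "ddiv (Suc 0) (n - 1) w w'"
    "F n a = ml n (pw n z p) w'"
  note c = ddiv_closed[OF h(1)] ddiv_closed[OF h(2)] ddivp_closed[OF h(3)]
  obtain t s q where t: "t \<in> C (n - 1)" "s \<in> C (n - 1)" "q \<in> C (n - 1)" "d (n - 1) q = e n"
    "w = ml (n - 1) (F (n - 1) t) (ml (n - 1) (pw (n - 1) s p) q)"
  proof -
    obtain t s q where *: "t \<in> C (n - 1)" "s \<in> C (n - 1)" "q \<in> C (n - 1 - 1)"
      "w = ml (n - 1) (F (n - 1) t) (ml (n - 1) (pw (n - 1) s p) (d (n - 1 - 1) q))"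
      using cartier_surj[of w "n - 1" w'] c ddiv_eq[OF h(3)] by auto
    show ?thesis by (rule that[OF *(1,2) dp_closed[OF *(3)] _ *(4)]) (use dp_d[OF *(3)] in simp)
  qed
  have "pw n w' p = d (n - 1) w" using ddiv_eq[OF h(3)] by simp
  also have "\<dots> = pw n (ml n (F n (d (n - 1) t)) (d (n - 1) s)) p"
    using t by (simp add: dp_ml dp_F dp_pw pw_ml)
  finally have w': "w' = ml n (F n (d (n - 1) t)) (d (n - 1) s)"
    by (rule pw_p_cancel[rotated 2]) (use t c in simp_all)
  obtain a1 where a1: "a1 \<in> C n" "a = ml n a1 (d (n - 1) t)"
    using diff_ex[of a n "d (n - 1) t"] c t by auto
  have "ml n (F n (d (n - 1) t)) (F n a1) = ml n (F n (d (n - 1) t)) (ml n (pw n z p) (d (n - 1) s))"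
    using a1 t c h(4) unfolding w' by (simp add: F_ml ac)
  then have "F n a1 = ml n (pw n z p) (d (n - 1) s)"
    by (rule cancel[rotated 3]) (use a1 t c in simp_all)
  then obtain y where "y \<in> C n" "a1 = pw n y p" using cartier_inj a1 t c by meson
  then show "\<exists>y y' t t'. ddiv 0 n y y' \<and> ddiv 0 (n - 1) t t' \<and> a = ml n (pw n y p) t'"
    using a1 t ddiv_0[of y n] ddiv_0[of t "n - 1"] by blast
qed

text \<open>
  Writing \<open>x = Fa + pz + w'\<close> by \<open>frob_surj r\<close> leaves \<open>a\<close> in \<open>M\<^sub>r\<^sub>+\<^sub>1\<close> and \<open>z\<close> in
  \<open>M\<^sub>r\<^sub>+\<^sub>1\<close>; both have to be moved into \<open>M\<^sub>r\<^sub>+\<^sub>2\<close>. As \<open>x\<close> is divisible enough, the divided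
  differential \<open>a'\<close> becomes a coboundary modulo \<open>p\<close> under \<open>F\<close>, hence is one itself by
  \<open>frob_inj r\<close>, and a multiple of \<open>p\<close> moved from \<open>z\<close> to \<open>a\<close> corrects both.
\<close>
lemma frob_surj_Suc:
  assumes "frob_surj r" and "frob_inj r"
  shows "frob_surj (Suc r)"
  unfolding frob_surj_def
proof (intro allI impI)
  note surj = frob_surjD[OF assms(1)] and inj = frob_injD[OF assms(2)]
  fix n x x' assume x: "ddiv (Suc (Suc (Suc r))) n x x'"
  let ?r = "Suc r"
  note x1 = ddiv_Suc[OF x] and cx = ddiv_closed[OF x]
  obtain a a' z z' w w' where h: "ddiv ?r n a a'" "ddiv ?r n z z'" "ddiv ?r (n - 1) w w'"
    "x = ml n (F n a) (ml n (pw n z p) w')"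
    using surj[OF x1] by auto
  note c = ddiv_closed[OF h(1)] ddiv_closed[OF h(2)] ddivp_closed[OF h(3)]
  have "ddiv (Suc ?r) n x (ml (n + 1) (F (n + 1) a') (ml (n + 1) z' (e (n + 1))))"
    unfolding h(4) by (intro ddiv_ml ddiv_F ddiv_pw h ddiv_cocycle c ddivp_d[OF h(3)])
  from ddiv_uniq[OF x1 this] have eq: "pw (n + 1) x' p = ml (n + 1) (F (n + 1) a') z'"
    using c by simp
  have "F (n + 1) a' = ml (n + 1) (pw (n + 1) x' p) (iv (n + 1) z')"
    unfolding eq using c by (simp add: assoc)
  moreover have "ddiv ?r (n + 1) a' (e (n + 1 + 1))" "ddiv ?r (n + 1) x' (e (n + 1 + 1))"
    by (rule ddiv_cocycle c cx ddiv_d[OF h(1)] ddiv_d[OF x])+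
  moreover have "ddiv ?r (n + 1 - 1) (iv n z) (iv (n + 1) z')" using ddiv_iv[OF h(2)] by simp
  ultimately obtain y y' t t' where y: "ddiv r (n + 1) y y'" "ddiv r (n + 1 - 1) t t'"
    "a' = ml (n + 1) (pw (n + 1) y p) t'"
    using inj[of "n + 1"] by meson
  have t: "ddiv r n t t'" using y(2) by simp
  note c = c ddiv_closed[OF y(1)] ddiv_closed[OF t] cx
  define v v' where "v = iv n t" and "v' = iv (n + 1) t'"
  have v: "ddiv r n v v'" unfolding v_def v'_def by (rule ddiv_iv[OF t])
  note c = c ddiv_closed[OF v]
  have a'v': "ml (n + 1) a' v' = pw (n + 1) y p"
    using c y(3) by (simp add: v'_def assoc)
  define b where "b = ml n a (pw n v p)"
  have "ddiv ?r n b (pw (n + 1) y p)"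
    unfolding b_def a'v'[symmetric] by (intro ddiv_ml h ddiv_pw v)
  then have b: "ddiv (Suc ?r) n b y"
    using c by (simp add: ddiv_def pw_pw mult.commute)
  obtain s where s: "s \<in> C n" "z = ml n s (F n v)" using diff_ex[of z n "F n v"] c by auto
  obtain s' where s': "s' \<in> C (n + 1)" "x' = ml (n + 1) s' (F (n + 1) y)"
    using diff_ex[of x' "n + 1" "F (n + 1) y"] c by auto
  have "ml (n + 1) (pw (n + 1) (F (n + 1) v') (p ^ ?r)) (d n s) = d n z"
    using s c ddiv_eq[OF ddiv_F[OF v]] by (simp add: d_ml comm)
  also have "\<dots> = pw (n + 1) z' (p ^ ?r)" by (rule ddiv_eq[OF h(2)])
  also have "z' = ml (n + 1) (F (n + 1) v') (pw (n + 1) s' p)"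
  proof -
    have "ml (n + 1) (F (n + 1) a') z' = ml (n + 1) (pw (n + 1) s' p) (F (n + 1) (ml (n + 1) a' v'))"
      unfolding a'v' eq[symmetric] using s' c by (simp add: pw_ml F_pw)
    also have "\<dots> = ml (n + 1) (F (n + 1) a') (ml (n + 1) (F (n + 1) v') (pw (n + 1) s' p))"
      using s' c by (simp add: F_ml ac)
    finally show ?thesis by (rule cancel[rotated 3]) (use c s' in simp_all)
  qed
  also have "pw (n + 1) \<dots> (p ^ ?r) = ml (n + 1) (pw (n + 1) (F (n + 1) v') (p ^ ?r)) (pw (n + 1) s' (p ^ Suc ?r))"
    using c s' by (simp add: pw_ml pw_pw mult.commute)
  finally have "d n s = pw (n + 1) s' (p ^ Suc ?r)"
    by (rule cancel[rotated 3]) (use c s s' in simp_all)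
  then have "ddiv (Suc ?r) n s s'" using s s' by (simp add: ddiv_def)
  moreover have "x = ml n (F n b) (ml n (pw n s p) w')"
    unfolding h(4) b_def s(2) using c s(1) by (simp add: F_ml F_pw pw_ml ac)
  ultimately show "\<exists>a a' z z' w w'. ddiv (Suc ?r) n a a' \<and> ddiv (Suc ?r) n z z' \<and>
      ddiv (Suc ?r) (n - 1) w w' \<and> x = ml n (F n a) (ml n (pw n z p) w')"
    using b ddiv_pw[OF h(3)] by blast
qed

text \<open>
  As in \<open>frob_inj_0\<close>, now with \<open>frob_surj r\<close> and \<open>frob_inj r\<close> in place of the Cartier
  condition: \<open>w = Ft + ps + q'\<close> gives \<open>w' = Ft' + s'\<close>, and \<open>F(a - t')\<close> is a coboundary modulo
  \<open>p\<close>. Then \<open>a - t' = py + u'\<close> with \<open>p dy = da\<close>, which puts \<open>y\<close> into \<open>M\<^sub>r\<^sub>+\<^sub>1\<close>.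
\<close>
lemma frob_inj_Suc:
  assumes "frob_surj r" and "frob_inj r"
  shows "frob_inj (Suc r)"
  unfolding frob_inj_def
proof (intro allI impI)
  note surj = frob_surjD[OF assms(1)] and inj = frob_injD[OF assms(2)]
  fix n a a' z z' w w'
  let ?r = "Suc r"
  assume h: "ddiv (Suc ?r) n a a'" "ddiv (Suc ?r) n z z'" "ddiv (Suc ?r) (n - 1) w w'"
    "F n a = ml n (pw n z p) w'"
  note c = ddiv_closed[OF h(1)] ddiv_closed[OF h(2)] ddivp_closed[OF h(3)]
  obtain t t' s s' q q' where t: "ddiv ?r (n - 1) t t'" "ddiv ?r (n - 1) s s'"
    "ddiv ?r (n - 1 - 1) q q'" "w = ml (n - 1) (F (n - 1) t) (ml (n - 1) (pw (n - 1) s p) q')"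
    using surj[OF h(3)] by blast
  note c = c ddivp_closed[OF t(1)] ddivp_closed[OF t(2)] ddivp_closed[OF t(3)]
  have "ddiv (Suc ?r) (n - 1) w (ml (n - 1 + 1) (F (n - 1 + 1) t') (ml (n - 1 + 1) s' (e (n - 1 + 1))))"
    unfolding t(4) by (intro ddiv_ml ddiv_F ddiv_pw t ddiv_cocycle c ddivp_d[OF t(3)])
  from ddiv_uniq[OF h(3) this] have w': "w' = ml n (F n t') s'" using c by simp
  obtain b where b: "b \<in> C n" "a = ml n b t'" using diff_ex[of a n t'] c by auto
  have "ml n (F n t') (F n b) = ml n (F n t') (ml n (pw n z p) s')"
    using b c h(4) unfolding w' by (simp add: F_ml ac)
  then have Fb: "F n b = ml n (pw n z p) s'"
    by (rule cancel[rotated 3]) (use b c in simp_all)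
  have db: "d n b = d n a" using b c ddivp_d[OF t(1)] by (simp add: d_ml)
  then have b1: "ddiv ?r n b (pw (n + 1) a' p)"
    using ddiv_Suc[OF h(1)] b by (simp add: ddiv_def)
  obtain y y' u u' where y: "ddiv r n y y'" "ddiv r (n - 1) u u'" "b = ml n (pw n y p) u'"
    using inj[OF b1 ddiv_Suc[OF h(2)] t(2) Fb] by auto
  note c = c ddiv_closed[OF y(1)] ddivp_closed[OF y(2)]
  have "pw (n + 1) (d n y) p = d n b"
    using c ddivp_d[OF y(2)] by (simp add: y(3) d_ml d_pw)
  also have "\<dots> = pw (n + 1) (pw (n + 1) a' (p ^ ?r)) p"
    unfolding db ddiv_eq[OF h(1)] using c by (simp add: pw_pw mult.commute)
  finally have "d n y = pw (n + 1) a' (p ^ ?r)"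
    by (rule pw_p_cancel[rotated 2]) (use c in simp_all)
  then have "ddiv ?r n y a'" using c by (simp add: ddiv_def)
  moreover have "ddiv ?r (n - 1) (ml (n - 1) (pw (n - 1) u p) t) (ml n u' t')"
    using ddiv_ml[OF ddiv_pw[OF y(2)] t(1)] by simp
  moreover have "a = ml n (pw n y p) (ml n u' t')"
    using b y c by (simp add: assoc)
  ultimately show "\<exists>y y' t t'. ddiv ?r n y y' \<and> ddiv ?r (n - 1) t t' \<and> a = ml n (pw n y p) t'"
    by blast
qed

lemma frob_quasi_iso: "frob_surj r \<and> frob_inj r"
  by (induction r) (auto intro: frob_surj_0 frob_inj_0 frob_surj_Suc frob_inj_Suc)

text \<open>The composite \<open>F\<^sup>r : M \<rightarrow> M\<^sub>r\<close> is injective and surjective on cohomology modulo \<open>p\<close>.\<close>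
lemma F_pow_inj:
  assumes "ddiv 1 n m m'" "ddiv r n z z'" "ddiv r (n - 1) w w'"
    "(F n ^^ r) m = ml n (pw n z p) w'"
  shows "\<exists>y \<in> C n. \<exists>t \<in> C (n - 1). m = ml n (pw n y p) (d (n - 1) t)"
  using assms(2-4)
proof (induction r arbitrary: z z' w w')
  case 0
  then show ?case using ddiv_closed[OF 0(1)] ddivp_closed[OF 0(2)] ddivp_eq[OF 0(2)] by auto
next
  case (Suc r)
  have "ddiv (r + 1) n ((F n ^^ r) m) ((F (n + 1) ^^ r) m')" by (rule ddiv_Fk[OF assms(1)])
  then have m: "ddiv (Suc r) n ((F n ^^ r) m) ((F (n + 1) ^^ r) m')" by simp
  obtain y y' t t' where "ddiv r n y y'" "ddiv r (n - 1) t t'" "(F n ^^ r) m = ml n (pw n y p) t'"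
    using frob_injD[OF conjunct2[OF frob_quasi_iso] m Suc.prems(1,2)] Suc.prems(3) by auto
  then show ?case by (rule Suc.IH)
qed

lemma F_pow_surj:
  assumes "ddiv (Suc r) n x x'"
  shows "\<exists>m m' z z' w w'. ddiv 1 n m m' \<and> ddiv r n z z' \<and> ddiv r (n - 1) w w' \<and>
    x = ml n ((F n ^^ r) m) (ml n (pw n z p) w')"
  using assms
proof (induction r arbitrary: x x')
  case 0
  have "ddiv 0 n (e n) (e (n + 1))" "ddiv 0 (n - 1) (e (n - 1)) (e n)"
    by (simp_all add: ddiv_def)
  moreover have "x = ml n ((F n ^^ 0) x) (ml n (pw n (e n) p) (e n))"
    using ddiv_closed[OF 0] by simp
  ultimately show ?case using 0 by (metis One_nat_def)
next
  case (Suc r)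
  obtain a a' z z' w w' where a: "ddiv (Suc r) n a a'" "ddiv (Suc r) n z z'" "ddiv (Suc r) (n - 1) w w'"
     "x = ml n (F n a) (ml n (pw n z p) w')"
    using frob_surjD[OF conjunct1[OF frob_quasi_iso] Suc.prems] by blast
  obtain m m' y y' t t' where m: "ddiv 1 n m m'" "ddiv r n y y'" "ddiv r (n - 1) t t'"
     "a = ml n ((F n ^^ r) m) (ml n (pw n y p) t')"
    using Suc.IH[OF a(1)] by blast
  note c = ddiv_closed[OF a(2)] ddivp_closed[OF a(3)] ddiv_closed[OF m(1)] ddiv_closed[OF m(2)]
     ddivp_closed[OF m(3)]
  have "x = ml n ((F n ^^ Suc r) m) (ml n (pw n (ml n (F n y) z) p) (ml n (F n t') w'))"
    unfolding a(4) m(4) using c by (simp add: F_ml F_pw pw_ml ac)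
  moreover have "ddiv (Suc r) n (ml n (F n y) z) (ml (n + 1) (F (n + 1) y') z')"
    by (intro ddiv_ml ddiv_F m a)
  moreover have "ddiv (Suc r) (n - 1) (ml (n - 1) (F (n - 1) t) w) (ml n (F n t') w')"
    using ddiv_ml[OF ddiv_F[OF m(3)] a(3)] by simp
  ultimately show ?case using m(1) by blast
qed

end

section \<open>Verschiebung and its filtration on saturated complexes\<close>

locale saturated_cplx = dieudonne_cplx +
  assumes saturated: "saturated p M"

sublocale saturated_cplx \<subseteq> torsion_free_cplx
  by unfold_locales (use saturated in \<open>simp add: saturated_def\<close>)

context saturated_cplx
begin

abbreviation V :: "int \<Rightarrow> 'a \<Rightarrow> 'a" where "V n \<equiv> verschiebung p M n"

lemmas F_inj = sat_F_inj[OF saturated]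

lemma V_props:
  assumes "x \<in> C n"
  shows "V n x \<in> C n \<and> F n (V n x) = pw n x p"
proof -
  obtain y where y: "y \<in> C n" "F n y = pw n x p"
    using sat_F_surj[OF saturated, of "pw n x p" n "d n x"] assms by (auto simp: d_pw)
  show ?thesis
    unfolding verschiebung_def
  proof (rule theI[of _ y])
    show "z = y" if "z \<in> C n \<and> F n z = pw n x p" for z
      by (rule F_inj[of _ n]) (use that y in simp_all)
  qed (use y in simp)
qed

lemma V_closed [simp]: "x \<in> C n \<Longrightarrow> V n x \<in> C n"
  and FV: "x \<in> C n \<Longrightarrow> F n (V n x) = pw n x p"
  using V_props by blast+

lemma VF: "x \<in> C n \<Longrightarrow> V n (F n x) = pw n x p"
  by (rule F_inj[of _ n]) (simp_all add: FV F_pw)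
lemma V_hom: "V n \<in> hom (grp M n) (grp M n)"
  by (rule homI, simp, rule F_inj[of _ n]) (simp_all add: FV F_ml pw_ml)
lemma Vk_hom: "V n ^^ k \<in> hom (grp M n) (grp M n)"
  by (intro hom_funpow V_hom)
lemma Vk_closed [simp]: "x \<in> C n \<Longrightarrow> (V n ^^ k) x \<in> C n"
  using Vk_hom hom_in_carrier by metis
lemma Vk_ml: "x \<in> C n \<Longrightarrow> y \<in> C n \<Longrightarrow> (V n ^^ k) (ml n x y) = ml n ((V n ^^ k) x) ((V n ^^ k) y)"
  by (rule hom_mult[OF Vk_hom])
lemma Vk_pw: "x \<in> C n \<Longrightarrow> (V n ^^ j) (pw n x k) = pw n ((V n ^^ j) x) k"
  using hom_pow[OF Vk_hom grpM grpM] .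
lemma Vk_e [simp]: "(V n ^^ k) (e n) = e n"
  by (rule hom_one[OF Vk_hom grpM' grpM'])
lemma iv_Vk: "x \<in> C n \<Longrightarrow> (V n ^^ k) (iv n x) = iv n ((V n ^^ k) x)"
  by (rule group_hom.hom_inv[OF group_hom.intro[OF grpM' grpM' group_hom_axioms.intro[OF Vk_hom]]])

lemma VkF: "x \<in> C n \<Longrightarrow> (V n ^^ k) (F n x) = F n ((V n ^^ k) x)"
  by (induction k) (simp_all add: VF FV)
lemma FkVk: "x \<in> C n \<Longrightarrow> (F n ^^ k) ((V n ^^ k) x) = pw n x (p ^ k)"
proof (induction k)
  case (Suc k)
  then show ?case by (simp add: funpow_swap1[of "F n" k] FV Fk_pw pw_pw mult.commute)
qed simp

lemma FdV: "x \<in> C n \<Longrightarrow> F (n + 1) (d n (V n x)) = d n x"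
  by (rule pw_p_cancel[of _ "n + 1"]) (simp_all flip: dF d_pw add: FV)
lemma FkdVk: "x \<in> C n \<Longrightarrow> (F (n + 1) ^^ k) (d n ((V n ^^ k) x)) = d n x"
proof (induction k)
  case (Suc k)
  then show ?case by (simp add: funpow_swap1[of "F (n + 1)" k] FdV)
qed simp

text \<open>
  Applying \<open>F\<^sup>k\<^sup>+\<^sup>1\<close> to \<open>dV\<^sup>k\<^sup>+\<^sup>1 a \<in> pM\<close> yields \<open>da \<in> pM\<close>. So \<open>a = Fc\<close> by saturation, and
  \<open>V\<^sup>k\<^sup>+\<^sup>1 a = p V\<^sup>k c\<close>.
\<close>
lemma Vk_cocycle_mod_p:
  assumes "a \<in> C n" "y \<in> C (n + 1)" "d n ((V n ^^ Suc k) a) = pw (n + 1) y p"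
  shows "\<exists>c \<in> C n. (V n ^^ Suc k) a = pw n c p"
proof -
  have "d n a = pw (n + 1) ((F (n + 1) ^^ Suc k) y) p"
    unfolding FkdVk[OF assms(1), of "Suc k", symmetric] assms(3) using assms(2)
    by (intro Fk_pw)
  then obtain c where c: "c \<in> C n" "F n c = a"
    using sat_F_surj[OF saturated assms(1), of "(F (n + 1) ^^ Suc k) y"] assms(2) by auto
  have "(V n ^^ Suc k) a = (V n ^^ k) (V n a)" by (simp add: funpow_swap1)
  also have "\<dots> = pw n ((V n ^^ k) c) p" using c by (auto simp: VF Vk_pw)
  finally show ?thesis using c by auto
qed

text \<open>
  \<open>Ft = V\<^sup>k a\<close> gives \<open>p\<^sup>k a = F\<^sup>k\<^sup>+\<^sup>1 t\<close>, hence \<open>da = p F\<^sup>k\<^sup>+\<^sup>1 dt\<close> after division by \<open>p\<^sup>k\<close>. So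
  \<open>a = Fc\<close> by saturation, and \<open>F\<close> can be cancelled in \<open>Ft = V\<^sup>k Fc = F V\<^sup>k c\<close>.
\<close>
lemma F_eq_Vk:
  assumes "a \<in> C n" "t \<in> C n" "F n t = (V n ^^ k) a"
  shows "\<exists>c \<in> C n. t = (V n ^^ k) c"
proof -
  have "pw n a (p ^ k) = (F n ^^ Suc k) t"
    using assms by (simp add: FkVk[symmetric] funpow_swap1)
  then have "pw (n + 1) (d n a) (p ^ k) = d n ((F n ^^ Suc k) t)" using assms by (simp flip: d_pw)
  also have "\<dots> = pw (n + 1) (pw (n + 1) ((F (n + 1) ^^ Suc k) (d n t)) p) (p ^ k)"
    unfolding dFk[OF assms(2)] using assms(2) d_closed Fk_closed by (simp only: pw_pw power_Suc)
  finally have "d n a = pw (n + 1) ((F (n + 1) ^^ Suc k) (d n t)) p"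
    by (rule pw_inj[OF tf, rotated 2]) (use assms d_closed Fk_closed pw_closed in blast)+
  then obtain c where c: "c \<in> C n" "F n c = a"
    using sat_F_surj[OF saturated assms(1), of "(F (n + 1) ^^ Suc k) (d n t)"] assms(2) d_closed Fk_closed
    by blast
  have "F n t = F n ((V n ^^ k) c)" using assms(3) c by (simp add: VkF[symmetric])
  then have "t = (V n ^^ k) c" by (rule F_inj[rotated 2]) (use assms c in simp_all)
  then show ?thesis using c by auto
qed

lemma fil_iff: "x \<in> fil p M r n \<longleftrightarrow>
    (\<exists>a \<in> C n. \<exists>b \<in> C (n - 1). x = ml n ((V n ^^ r) a) (d (n - 1) ((V (n - 1) ^^ r) b)))"
  by (auto simp: fil_def set_mult_def)

lemma filE:
  assumes "x \<in> fil p M r n"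
  obtains a b where "a \<in> C n" "b \<in> C (n - 1)" "x = ml n ((V n ^^ r) a) (d (n - 1) ((V (n - 1) ^^ r) b))"
  using assms by (auto simp: fil_iff)

lemma filI: "a \<in> C n \<Longrightarrow> b \<in> C (n - 1) \<Longrightarrow> ml n ((V n ^^ r) a) (d (n - 1) ((V (n - 1) ^^ r) b)) \<in> fil p M r n"
  by (auto simp: fil_iff)

lemma fil_V: "a \<in> C n \<Longrightarrow> (V n ^^ r) a \<in> fil p M r n"
  using filI[of a n "e (n - 1)" r] by simp
lemma fil_dV: "b \<in> C (n - 1) \<Longrightarrow> d (n - 1) ((V (n - 1) ^^ r) b) \<in> fil p M r n"
  using filI[of "e n" n b r] by simp
lemma fil_closed: "x \<in> fil p M r n \<Longrightarrow> x \<in> C n"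
  by (auto simp: fil_iff)
lemma fil_subgroup: "subgroup (fil p M r n) (grp M n)"
proof
  show "fil p M r n \<subseteq> C n" using fil_closed by blast
  show "e n \<in> fil p M r n" using fil_V[of "e n" n r] by simp
  fix x assume "x \<in> fil p M r n"
  then obtain a b where x: "a \<in> C n" "b \<in> C (n - 1)"
    "x = ml n ((V n ^^ r) a) (d (n - 1) ((V (n - 1) ^^ r) b))" by (rule filE)
  {
    have "iv n x = ml n ((V n ^^ r) (iv n a)) (d (n - 1) ((V (n - 1) ^^ r) (iv (n - 1) b)))"
      using x iv_d[of "(V (n - 1) ^^ r) b" "n - 1"]
      by (simp add: iv_Vk comm_group.inv_mult[OF grpM])
    then show "iv n x \<in> fil p M r n" using x filI by simp
  next
    fix y assume "y \<in> fil p M r n"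
    then obtain a' b' where y: "a' \<in> C n" "b' \<in> C (n - 1)"
      "y = ml n ((V n ^^ r) a') (d (n - 1) ((V (n - 1) ^^ r) b'))" by (rule filE)
    have "ml n x y = ml n ((V n ^^ r) (ml n a a')) (d (n - 1) ((V (n - 1) ^^ r) (ml (n - 1) b b')))"
      using x y by (simp add: Vk_ml dp_ml ac)
    then show "ml n x y \<in> fil p M r n" using x y filI by simp
  }
qed

lemma fil_ml: "x \<in> fil p M r n \<Longrightarrow> y \<in> fil p M r n \<Longrightarrow> ml n x y \<in> fil p M r n"
  using subgroup.m_closed[OF fil_subgroup] .
lemma fil_iv: "x \<in> fil p M r n \<Longrightarrow> iv n x \<in> fil p M r n"
  using subgroup.m_inv_closed[OF fil_subgroup] .
lemma fil_e: "e n \<in> fil p M r n"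
  using subgroup.one_closed[OF fil_subgroup] .

lemma fil_Suc: "fil p M (Suc r) n \<subseteq> fil p M r n"
proof
  fix x assume "x \<in> fil p M (Suc r) n"
  then obtain a b where x: "a \<in> C n" "b \<in> C (n - 1)"
    "x = ml n ((V n ^^ Suc r) a) (d (n - 1) ((V (n - 1) ^^ Suc r) b))" by (rule filE)
  then have "x = ml n ((V n ^^ r) (V n a)) (d (n - 1) ((V (n - 1) ^^ r) (V (n - 1) b)))"
    by (simp add: funpow_swap1)
  then show "x \<in> fil p M r n" using x filI by simp
qed

lemma fil_d: "x \<in> fil p M r n \<Longrightarrow> d n x \<in> fil p M r (n + 1)"
  by (erule filE) (use fil_dV[of _ "n + 1" r] in \<open>simp add: d_ml\<close>)

text \<open>
  Since \<open>dV\<^sup>r b = F(dV\<^sup>r\<^sup>+\<^sup>1 b)\<close>, subtracting \<open>dV\<^sup>r\<^sup>+\<^sup>1 b\<close> from \<open>u\<close> reduces this to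
  \<open>F_eq_Vk\<close>.
\<close>
lemma F_fil:
  assumes "u \<in> C n" "F n u \<in> fil p M r n"
  shows "u \<in> fil p M r n"
proof -
  obtain a b where ab: "a \<in> C n" "b \<in> C (n - 1)"
    "F n u = ml n ((V n ^^ r) a) (d (n - 1) ((V (n - 1) ^^ r) b))" using assms(2) by (rule filE)
  let ?y = "d (n - 1) ((V (n - 1) ^^ r) (V (n - 1) b))"
  have y: "F n ?y = d (n - 1) ((V (n - 1) ^^ r) b)"
    using FdV[of "(V (n - 1) ^^ r) b" "n - 1"] ab by (simp add: funpow_swap1)
  obtain t where t: "t \<in> C n" "u = ml n t ?y" using diff_ex[of u n ?y] assms(1) ab by auto
  have "ml n (F n ?y) (F n t) = ml n (F n ?y) ((V n ^^ r) a)"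
    using ab t y by (simp add: F_ml comm)
  then have "F n t = (V n ^^ r) a" by (rule cancel[rotated 3]) (use ab t in simp_all)
  then obtain c where "c \<in> C n" "t = (V n ^^ r) c" using F_eq_Vk ab t by metis
  then show ?thesis using t ab filI by simp
qed

text \<open>
  Modulo the filtration, an element that is a cocycle modulo \<open>p\<close> lies in the image of \<open>F\<close>.
  If \<open>dz = py + V\<^sup>r\<^sup>+\<^sup>1 a + dV\<^sup>r\<^sup>+\<^sup>1 b\<close>, then \<open>t = z - V\<^sup>r\<^sup>+\<^sup>1 b\<close> has \<open>dt = py + V\<^sup>r\<^sup>+\<^sup>1 a\<close>. From
  \<open>ddt = 0\<close> it follows that \<open>p\<close> divides \<open>dV\<^sup>r\<^sup>+\<^sup>1 a\<close>, hence \<open>V\<^sup>r\<^sup>+\<^sup>1 a\<close>, hence \<open>dt\<close>, and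
  saturation applies to \<open>t\<close>.
\<close>
lemma cocycle_mod_p_fil:
  assumes z: "z \<in> C n" "y \<in> C (n + 1)" "\<phi> \<in> fil p M (Suc r) (n + 1)"
    "d n z = ml (n + 1) (pw (n + 1) y p) \<phi>"
  shows "\<exists>x \<in> C n. \<exists>\<psi> \<in> fil p M (Suc r) n. z = ml n \<psi> (F n x)"
proof -
  obtain a b where ab: "a \<in> C (n + 1)" "b \<in> C n"
    "\<phi> = ml (n + 1) ((V (n + 1) ^^ Suc r) a) (d n ((V n ^^ Suc r) b))"
    using assms(3) by (rule filE) simp
  let ?b = "(V n ^^ Suc r) b" and ?a = "(V (n + 1) ^^ Suc r) a"
  have cl: "?a \<in> C (n + 1)" "?b \<in> C n" using ab by (simp_all del: funpow.simps)
  obtain t where t: "t \<in> C n" "z = ml n t ?b" using diff_ex z(1) cl by metis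
  have "ml (n + 1) (d n ?b) (d n t) = ml (n + 1) (d n ?b) (ml (n + 1) (pw (n + 1) y p) ?a)"
    using assms(4) ab(3) t z(2) cl by (simp add: d_ml ac del: funpow.simps)
  then have dt: "d n t = ml (n + 1) (pw (n + 1) y p) ?a"
    by (rule cancel[rotated 3]) (use t z cl in \<open>simp_all del: funpow.simps\<close>)
  have "ml (n + 1 + 1) (pw (n + 1 + 1) (d (n + 1) y) p) (d (n + 1) ?a) = d (n + 1) (d n t)"
    unfolding dt using z(2) cl(1) d_ml d_pw pw_closed by presburger
  also have "\<dots> = e (n + 1 + 1)" using t by (intro dd)
  finally have *: "ml (n + 1 + 1) (pw (n + 1 + 1) (d (n + 1) y) p) (d (n + 1) ?a) = e (n + 1 + 1)" .
  have "d (n + 1) ?a = pw (n + 1 + 1) (iv (n + 1 + 1) (d (n + 1) y)) p"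
  proof (rule cancel[rotated 3])
    show "ml (n + 1 + 1) (pw (n + 1 + 1) (d (n + 1) y) p) (d (n + 1) ?a) =
      ml (n + 1 + 1) (pw (n + 1 + 1) (d (n + 1) y) p) (pw (n + 1 + 1) (iv (n + 1 + 1) (d (n + 1) y)) p)"
      unfolding * using pw_ml[OF d_closed[OF z(2)] iv_closed[OF d_closed[OF z(2)]]] d_closed[OF z(2)]
      by simp
  qed (use z(2) cl(1) d_closed pw_closed iv_closed in blast)+
  then obtain c where c: "c \<in> C (n + 1)" "?a = pw (n + 1) c p"
    using Vk_cocycle_mod_p[OF ab(1) iv_closed[OF d_closed[OF z(2)]]] by blast
  have "d n t = pw (n + 1) (ml (n + 1) y c) p"
    unfolding dt c(2) using z c by (simp add: pw_ml)
  then obtain x where x: "x \<in> C n" "F n x = t"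
    using sat_F_surj[OF saturated t(1)] z c by (metis ml_closed)
  have "z = ml n ?b (F n x)" using x t cl by (metis comm)
  then show ?thesis using x fil_V[OF ab(2), of "Suc r"] by blast
qed

end

section \<open>A complex of Cartier type and its saturation\<close>

context dieudonne_cplx
begin

text \<open>
  The universal property alone says little about elements. But it identifies any saturation
  with the concrete one, formed from \<open>M\<close> by inverting \<open>pF\<close>, where equality and
  membership are explicit.
\<close>
lemma saturation_loc:
  fixes N :: "'b dieudonne"
  assumes sat: "is_saturation p M N i"
  shows "x \<in> C n \<Longrightarrow> y \<in> C n \<Longrightarrow> i n x = i n y \<Longrightarrow> loc n x = loc n y"
    and "w \<in> carrier (grp N n) \<Longrightarrow> \<exists>r. \<exists>x \<in> C n. (frob N n ^^ r) w = i n x"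
proof -
  have N: "saturated p N" "dieudonne_mor p M N i"
    using sat by (simp_all add: is_saturation_def saturation_among_def)
  obtain a where a: "dieudonne_mor p N S a" "\<forall>n. \<forall>x \<in> C n. a n (i n x) = loc n x"
    using saturation_amongD[OF is_saturation_universal[OF sat] S_saturated loc_S_mor]
    by (elim exE conjE)
  show "loc n x = loc n y" if "x \<in> C n" "y \<in> C n" "i n x = i n y"
    using a(2) that by metis
  note b = S_universal[OF N]
  let ?b = "extend N i"
  assume w: "w \<in> carrier (grp N n)"
  have "?b n (a n w) = w"
  proof -
    have 1: "dieudonne_mor p N N (\<lambda>n y. ?b n (a n y))" by (rule mor_comp[OF a(1) b(1)])
    have 2: "dieudonne_mor p N N (\<lambda>n y. y)" using N(1) by (intro mor_id) (simp add: saturated_def)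
    obtain g where g: "\<forall>h. dieudonne_mor p N N h \<and> (\<forall>n. \<forall>x \<in> C n. h n (i n x) = i n x) \<longrightarrow>
              (\<forall>n. \<forall>y \<in> carrier (grp N n). h n y = g n y)"
      using saturation_amongD[OF conjunct1[OF sat[unfolded is_saturation_def]] N] by (elim exE conjE)
    have "?b n (a n w) = g n w"
      using g[rule_format, of "\<lambda>n y. ?b n (a n y)" w n] 1 a(2) b(2) w by simp
    moreover have "w = g n w"
      using g[rule_format, of "\<lambda>n y. y" w n] 2 w by simp
    ultimately show ?thesis by simp
  qed
  moreover have aw: "a n w \<in> S_set n" using mor_facts(1)[OF a(1) w] by simp
  moreover obtain r x where "x \<in> C n" "(frob L n ^^ r) (a n w) = loc n x"
    using aw by (rule S_rep)
  ultimately show "\<exists>r. \<exists>x \<in> C n. (frob N n ^^ r) w = i n x"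
    using mor_facts(3)[OF b(1), of "a n w" n r] b(2)[of x n]
    by (auto intro!: exI[of _ r] bexI[of _ x])
qed

end

text \<open>
  The facts about elements that characterize \<open>N\<close> as a colimit along \<open>F\<close>: elements of \<open>M\<close>
  are identified when a power of \<open>F\<close> identifies them, and a power of \<open>F\<close> moves every
  element of \<open>N\<close> into the image of \<open>M\<close>.
\<close>
locale saturation_map = torsion_free_cplx p M + N: saturated_cplx p N
  for p and M :: "'a dieudonne" and N :: "'b dieudonne" +
  fixes i :: "int \<Rightarrow> 'a \<Rightarrow> 'b"
  assumes mor: "dieudonne_mor p M N i"
    and kernel: "x \<in> C n \<Longrightarrow> y \<in> C n \<Longrightarrow> i n x = i n y \<Longrightarrow> \<exists>k. (F n ^^ k) x = (F n ^^ k) y"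
    and exhaust: "w \<in> N.C n \<Longrightarrow> \<exists>r. \<exists>x \<in> C n. (N.F n ^^ r) w = i n x"
begin

lemma i_closed [simp]: "x \<in> C n \<Longrightarrow> i n x \<in> N.C n"
  using mor_facts(1)[OF mor] .
lemma i_d: "x \<in> C n \<Longrightarrow> i (n + 1) (d n x) = N.d n (i n x)"
  using mor_facts(2)[OF mor] .
lemma i_Fk: "x \<in> C n \<Longrightarrow> i n ((F n ^^ k) x) = (N.F n ^^ k) (i n x)"
  using mor_facts(3)[OF mor] .
lemma i_pw: "x \<in> C n \<Longrightarrow> i n (pw n x k) = N.pw n (i n x) k"
  using mor_facts(4)[OF mor] .
lemma i_ml: "x \<in> C n \<Longrightarrow> y \<in> C n \<Longrightarrow> i n (ml n x y) = N.ml n (i n x) (i n y)"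
  using mor_mult[OF mor] .
lemma i_ddiv: "ddiv r n x x' \<Longrightarrow> N.ddiv r n (i n x) (i (n + 1) x')"
  by (simp add: ddiv_def N.ddiv_def i_pw flip: i_d)

text \<open>
  \<open>N\<close> is the colimit of the complexes \<open>M\<^sub>r\<close> along \<open>F\<close>: for large \<open>j\<close>, \<open>F\<^sup>j w\<close> comes from
  some \<open>x\<close> in \<open>M\<^sub>j\<close>, and even from \<open>M\<^sub>j\<^sub>+\<^sub>s\<close> if \<open>p\<^sup>s\<close> divides \<open>dw\<close>. Having all large \<open>j\<close> at
  once allows a common \<open>j\<close> for several elements.
\<close>
lemma exhaust_ddiv:
  assumes w: "N.ddiv s n w w'"
  shows "\<exists>r. \<forall>k. \<exists>x x'. ddiv (k + r + s) n x x' \<and> (N.F n ^^ (k + r)) w = i n x \<and>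
    (N.F (n + 1) ^^ (k + r)) w' = i (n + 1) x'"
proof -
  note cw = N.ddiv_closed[OF w]
  obtain r1 x1 where 1: "x1 \<in> C n" "(N.F n ^^ r1) w = i n x1" using exhaust[OF cw(1)] by blast
  obtain r2 x2 where 2: "x2 \<in> C (n + 1)" "(N.F (n + 1) ^^ r2) w' = i (n + 1) x2"
    using exhaust[OF cw(2)] by blast
  let ?r = "r2 + r1" and ?x = "(F n ^^ r2) x1" and ?x' = "(F (n + 1) ^^ r1) x2"
  have x: "(N.F n ^^ ?r) w = i n ?x" using 1 by (simp add: funpow_add i_Fk)
  have x': "(N.F (n + 1) ^^ ?r) w' = i (n + 1) ?x'"
    using 2 by (simp add: add.commute[of r2] funpow_add i_Fk)
  have "i (n + 1) (d n ?x) = N.d n ((N.F n ^^ ?r) w)" using x 1 by (simp add: i_d)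
  also have "\<dots> = N.pw (n + 1) ((N.F (n + 1) ^^ ?r) w') (p ^ (?r + s))"
    by (rule N.ddiv_eq[OF N.ddiv_Fk[OF w]])
  also have "\<dots> = i (n + 1) (pw (n + 1) ?x' (p ^ (?r + s)))" using x' 2 by (simp add: i_pw)
  finally obtain l where l: "(F (n + 1) ^^ l) (d n ?x) = (F (n + 1) ^^ l) (pw (n + 1) ?x' (p ^ (?r + s)))"
    using kernel[of "d n ?x" "n + 1" "pw (n + 1) ?x' (p ^ (?r + s))"] 1 2 by auto
  have "ddiv (l + (?r + s)) n ((F n ^^ l) ?x) ((F (n + 1) ^^ l) ?x')"
    using 1 2 l by (simp add: ddiv_def dFk Fk_pw pw_pw power_add mult_ac)
  from ddiv_Fk[OF this]
  have "ddiv (k + (l + ?r) + s) n ((F n ^^ (k + l)) ?x) ((F (n + 1) ^^ (k + l)) ?x')" for k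
    by (simp add: funpow_add ac_simps)
  moreover have "(N.F n ^^ (k + (l + ?r))) w = i n ((F n ^^ (k + l)) ?x)" for k
    using x i_Fk[of ?x n "k + l"] 1 by (simp add: funpow_add)
  moreover have "(N.F (n + 1) ^^ (k + (l + ?r))) w' = i (n + 1) ((F (n + 1) ^^ (k + l)) ?x')" for k
    using x' i_Fk[of ?x' "n + 1" "k + l"] 2 by (simp add: funpow_add)
  ultimately show ?thesis by blast
qed

end

locale cartier_saturation = cartier_cplx p M + saturation_map p M N i
  for p and M :: "'a dieudonne" and N :: "'b dieudonne" and i
begin

text \<open>
  \<open>H(M/p) \<rightarrow> H(N/p)\<close> is injective: a relation in \<open>N\<close> holds at some finite stage \<open>M\<^sub>j\<close>,
  where \<open>F_pow_inj\<close> applies.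
\<close>
lemma saturation_inj:
  assumes m: "ddiv 1 n m m'" and "y \<in> N.C n" "z \<in> N.C (n - 1)"
    "i n m = N.ml n (N.pw n y p) (N.d (n - 1) z)"
  shows "\<exists>u \<in> C n. \<exists>t \<in> C (n - 1). m = ml n (pw n u p) (d (n - 1) t)"
proof -
  obtain r1 where r1: "\<forall>k. \<exists>x x'. ddiv (k + r1 + 0) n x x' \<and> (N.F n ^^ (k + r1)) y = i n x \<and>
    (N.F (n + 1) ^^ (k + r1)) (N.d n y) = i (n + 1) x'"
    using exhaust_ddiv[OF N.ddiv_0[OF assms(2)]] by (rule exE)
  obtain r2 where r2: "\<forall>k. \<exists>x x'. ddiv (k + r2 + 0) (n - 1) x x' \<and>
    (N.F (n - 1) ^^ (k + r2)) z = i (n - 1) x \<and>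
    (N.F (n - 1 + 1) ^^ (k + r2)) (N.d (n - 1) z) = i (n - 1 + 1) x'"
    using exhaust_ddiv[OF N.ddiv_0[OF assms(3)]] by (rule exE)
  let ?r = "r2 + r1"
  obtain a a' where a: "ddiv ?r n a a'" "(N.F n ^^ ?r) y = i n a" using r1 by fastforce
  obtain b b' where b: "ddiv ?r (n - 1) b b'" "(N.F n ^^ ?r) (N.d (n - 1) z) = i n b'"
    using r2[rule_format, of r1] by (auto simp: add.commute)
  note c = ddiv_closed[OF m] ddiv_closed[OF a(1)] ddivp_closed[OF b(1)]
  have "i n ((F n ^^ ?r) m) = (N.F n ^^ ?r) (N.ml n (N.pw n y p) (N.d (n - 1) z))"
    using i_Fk[OF c(1)] assms(4) by simp
  also have "\<dots> = i n (ml n (pw n a p) b')"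
    using assms(2,3) c a(2) b(2) by (simp add: N.Fk_ml N.Fk_pw i_ml i_pw)
  finally obtain k where "(F n ^^ k) ((F n ^^ ?r) m) = (F n ^^ k) (ml n (pw n a p) b')"
    using kernel[of "(F n ^^ ?r) m" n "ml n (pw n a p) b'"] c by auto
  then have "(F n ^^ (k + ?r)) m = ml n (pw n ((F n ^^ k) a) p) ((F n ^^ k) b')"
    using c by (simp add: funpow_add Fk_ml Fk_pw)
  moreover have "ddiv (k + ?r) (n - 1) ((F (n - 1) ^^ k) b) ((F n ^^ k) b')"
    using ddiv_Fk[OF b(1), of k] by simp
  ultimately show ?thesis by (intro F_pow_inj[OF m ddiv_Fk[OF a(1)]])
qed

text \<open>
  \<open>H(M/p) \<rightarrow> H(N/p)\<close> is surjective: \<open>F\<^sup>r w\<close> comes from \<open>x \<in> M\<^sub>r\<^sub>+\<^sub>1\<close>, to which \<open>F_pow_surj\<close>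
  applies. By saturation the correction terms are values of \<open>F\<^sup>r\<close> on \<open>N\<close>, which can
  then be cancelled.
\<close>
lemma saturation_surj:
  assumes w: "N.ddiv 1 n w w'"
  shows "\<exists>m m'. ddiv 1 n m m' \<and> (\<exists>y \<in> N.C n. \<exists>z \<in> N.C (n - 1).
    w = N.ml n (i n m) (N.ml n (N.pw n y p) (N.d (n - 1) z)))"
proof -
  obtain r where r: "\<forall>k. \<exists>x x'. ddiv (k + r + 1) n x x' \<and> (N.F n ^^ (k + r)) w = i n x \<and>
    (N.F (n + 1) ^^ (k + r)) w' = i (n + 1) x'"
    using exhaust_ddiv[OF w] by (rule exE)
  obtain x x' where x: "ddiv (Suc r) n x x'" "(N.F n ^^ r) w = i n x"
    using r[rule_format, of 0] by auto
  obtain m m' z z' b b' where h: "ddiv 1 n m m'" "ddiv r n z z'" "ddiv r (n - 1) b b'"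
    "x = ml n ((F n ^^ r) m) (ml n (pw n z p) b')"
    using F_pow_surj[OF x(1)] by blast
  note c = ddiv_closed[OF h(1)] ddiv_closed[OF h(2)] ddivp_closed[OF h(3)] N.ddiv_closed[OF w]
  obtain y where y: "y \<in> N.C n" "(N.F n ^^ r) y = i n z"
    using N.sat_Fk_surj[OF N.saturated _ _ N.ddiv_eq[OF i_ddiv[OF h(2)]]] c by auto
  obtain q where q: "q \<in> N.C (n - 1)" "(N.F (n - 1) ^^ r) q = i (n - 1) b"
    using N.sat_Fk_surj[OF N.saturated _ _ N.ddiv_eq[OF i_ddiv[OF h(3)]]] c by auto
  have "N.ddiv r (n - 1) (i (n - 1) b) ((N.F n ^^ r) (N.d (n - 1) q))"
    using N.ddiv_Fk[OF N.ddiv_0[OF q(1)], of r] q by simp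
  from N.ddiv_uniq[OF this] have dq: "(N.F n ^^ r) (N.d (n - 1) q) = i n b'"
    using i_ddiv[OF h(3)] by simp
  have "(N.F n ^^ r) w = (N.F n ^^ r) (N.ml n (i n m) (N.ml n (N.pw n y p) (N.d (n - 1) q)))"
    unfolding x(2) h(4) using c y q dq by (simp add: N.Fk_ml N.Fk_pw i_ml i_pw i_Fk)
  then have "w = N.ml n (i n m) (N.ml n (N.pw n y p) (N.d (n - 1) q))"
    by (rule N.sat_Fk_inj[OF N.saturated, rotated 2]) (use c y q in simp_all)
  then show ?thesis using h(1) y(1) q(1) by blast
qed

end

section \<open>Maps of quotient groups\<close>

locale comm_quotient = comm_group G + subgroup A G for G (structure) and A
begin

lemma coset_eq_iff:
  assumes "x \<in> carrier G" "y \<in> carrier G"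
  shows "A #> x = A #> y \<longleftrightarrow> (\<exists>a \<in> A. x = a \<otimes> y)"
proof
  assume "A #> x = A #> y"
  then have "x \<in> A #> y" using rcos_self[OF assms(1) subgroup_axioms] by simp
  then show "\<exists>a \<in> A. x = a \<otimes> y" by (auto simp: r_coset_def)
next
  assume "\<exists>a \<in> A. x = a \<otimes> y"
  then have "x \<in> A #> y" by (auto simp: r_coset_def)
  then show "A #> x = A #> y" using repr_independence[OF _ assms(2) subgroup_axioms] by simp
qed

lemma coset_trivial_iff: "x \<in> carrier G \<Longrightarrow> A #> x = A \<longleftrightarrow> x \<in> A"
  using coset_eq_iff[of x \<one>] coset_mult_one[OF subset] by (auto simp: subset[THEN subsetD])

lemma Mod_carrier: "carrier (G Mod A) = (\<lambda>x. A #> x) ` carrier G"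
  by (rule carrier_FactGroup)

lemma Mod_mult: "x \<in> carrier G \<Longrightarrow> y \<in> carrier G \<Longrightarrow> (A #> x) \<otimes>\<^bsub>G Mod A\<^esub> (A #> y) = A #> (x \<otimes> y)"
  using normal.rcos_sum[OF subgroup_imp_normal[OF subgroup_axioms]] by simp

lemma Mod_group: "comm_group (G Mod A)"
  by (rule abelian_FactGroup[OF subgroup_axioms])

end

locale coset_map = G: comm_quotient G A + H: comm_quotient H B
  for G :: "('a, 'm) monoid_scheme" (structure) and A and H :: "('b, 'n) monoid_scheme" and B +
  fixes f
  assumes f_hom: "f \<in> hom G H" and f_sub: "a \<in> A \<Longrightarrow> f a \<in> B"
begin

lemma f_closed: "x \<in> carrier G \<Longrightarrow> f x \<in> carrier H"
  using f_hom by (rule hom_in_carrier)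

lemma induced_coset:
  assumes x: "x \<in> carrier G"
  shows "induced H B f (A #> x) = B #>\<^bsub>H\<^esub> f x"
proof -
  have f: "f (a \<otimes> x) = f a \<otimes>\<^bsub>H\<^esub> f x" if "a \<in> A" for a
    using that x f_hom by (simp add: hom_mult G.subset[THEN subsetD])
  show ?thesis
  proof
    show "induced H B f (A #> x) \<subseteq> B #>\<^bsub>H\<^esub> f x"
    proof
      fix y assume "y \<in> induced H B f (A #> x)"
      then obtain a b where ab: "a \<in> A" "b \<in> B" "y = b \<otimes>\<^bsub>H\<^esub> f (a \<otimes> x)"
        by (auto simp: induced_def set_mult_def r_coset_def)
      then have "y = (b \<otimes>\<^bsub>H\<^esub> f a) \<otimes>\<^bsub>H\<^esub> f x"
        using f[OF ab(1)] f_sub[OF ab(1)] f_closed[OF x] by (simp add: H.m_assoc)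
      then show "y \<in> B #>\<^bsub>H\<^esub> f x"
        using H.m_closed[OF ab(2) f_sub[OF ab(1)]] by (auto simp: r_coset_def)
    qed
    show "B #>\<^bsub>H\<^esub> f x \<subseteq> induced H B f (A #> x)"
    proof
      fix y assume "y \<in> B #>\<^bsub>H\<^esub> f x"
      then obtain b where b: "b \<in> B" "y = b \<otimes>\<^bsub>H\<^esub> f x" by (auto simp: r_coset_def)
      have "f x \<in> f ` (A #> x)" using G.rcos_self[OF x G.subgroup_axioms] by (rule imageI)
      then show "y \<in> induced H B f (A #> x)" unfolding induced_def set_mult_def b(2) using b(1) by blast
    qed
  qed
qed

lemma induced_hom: "induced H B f \<in> hom (G Mod A) (H Mod B)"
proof (rule homI)
  fix X assume "X \<in> carrier (G Mod A)"
  then show "induced H B f X \<in> carrier (H Mod B)"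
    by (auto simp: G.Mod_carrier H.Mod_carrier induced_coset f_closed)
next
  fix X Y assume "X \<in> carrier (G Mod A)" "Y \<in> carrier (G Mod A)"
  then obtain x y where "x \<in> carrier G" "X = A #> x" "y \<in> carrier G" "Y = A #> y"
    by (auto simp: G.Mod_carrier)
  then show "induced H B f (X \<otimes>\<^bsub>G Mod A\<^esub> Y) = induced H B f X \<otimes>\<^bsub>H Mod B\<^esub> induced H B f Y"
    by (simp add: G.Mod_mult H.Mod_mult induced_coset f_closed hom_mult[OF f_hom] del: mult_FactGroup)
qed

lemma induced_iso:
  assumes surj: "\<And>y. y \<in> carrier H \<Longrightarrow> \<exists>x \<in> carrier G. \<exists>b \<in> B. y = b \<otimes>\<^bsub>H\<^esub> f x"
    and inj: "\<And>x. x \<in> carrier G \<Longrightarrow> f x \<in> B \<Longrightarrow> x \<in> A"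
  shows "induced H B f \<in> iso (G Mod A) (H Mod B)"
  unfolding iso_iff
proof (intro conjI)
  show "induced H B f \<in> hom (G Mod A) (H Mod B)" by (rule induced_hom)
  show "induced H B f ` carrier (G Mod A) = carrier (H Mod B)"
  proof
    show "induced H B f ` carrier (G Mod A) \<subseteq> carrier (H Mod B)"
      using induced_hom by (auto simp: hom_def)
    show "carrier (H Mod B) \<subseteq> induced H B f ` carrier (G Mod A)"
    proof
      fix Y assume "Y \<in> carrier (H Mod B)"
      then obtain y where y: "y \<in> carrier H" "Y = B #>\<^bsub>H\<^esub> y" by (auto simp: H.Mod_carrier)
      obtain x b where "x \<in> carrier G" "b \<in> B" "y = b \<otimes>\<^bsub>H\<^esub> f x" using surj[OF y(1)] by blast
      then have "Y = induced H B f (A #> x)"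
        using y H.coset_eq_iff[of y "f x"] by (auto simp: induced_coset f_closed)
      then show "Y \<in> induced H B f ` carrier (G Mod A)"
        using \<open>x \<in> carrier G\<close> by (auto simp: G.Mod_carrier)
    qed
  qed
  interpret group_hom "G Mod A" "H Mod B" "induced H B f"
    using induced_hom G.Mod_group H.Mod_group
    by (intro group_hom.intro group_hom_axioms.intro) (auto simp: comm_group_def)
  show "inj_on (induced H B f) (carrier (G Mod A))"
  proof (rule inj_on_one_iff[THEN iffD2], intro allI impI)
    fix X assume "X \<in> carrier (G Mod A)" and X: "induced H B f X = \<one>\<^bsub>H Mod B\<^esub>"
    then obtain x where x: "x \<in> carrier G" "X = A #> x" by (auto simp: G.Mod_carrier)
    then have "f x \<in> B" using X by (simp add: induced_coset H.coset_trivial_iff f_closed)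
    then show "X = \<one>\<^bsub>G Mod A\<^esub>" using x inj by (simp add: G.coset_trivial_iff)
  qed
qed

end

section \<open>Cohomology of cochain complexes\<close>

lemma diff_closed: "cochain_complex C \<Longrightarrow> x \<in> carrier (grp C n) \<Longrightarrow> diff C n x \<in> carrier (grp C (n + 1))"
  by (auto simp: cochain_complex_def hom_def)

lemma grp_comm: "cochain_complex C \<Longrightarrow> comm_group (grp C n)"
  by (simp add: cochain_complex_def)
lemma grp_group: "cochain_complex C \<Longrightarrow> group (grp C n)"
  by (simp add: cochain_complex_def comm_group_def)

lemma diff_group_hom: "cochain_complex C \<Longrightarrow> group_hom (grp C n) (grp C (n + 1)) (diff C n)"
  by (intro group_hom.intro group_hom_axioms.intro grp_group) (auto simp: cochain_complex_def)

lemma cocycles_iff: "x \<in> cocycles C n \<longleftrightarrow> x \<in> carrier (grp C n) \<and> diff C n x = \<one>\<^bsub>grp C (n + 1)\<^esub>"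
  by (simp add: cocycles_def kernel_def)

lemma coboundaries_iff:
  "x \<in> coboundaries C n \<longleftrightarrow> (\<exists>z \<in> carrier (grp C (n - 1)). x = diff C (n - 1) z)"
  by (auto simp: coboundaries_def)

lemma cohomology_quotient:
  assumes C: "cochain_complex C"
  shows "comm_quotient ((grp C n)\<lparr>carrier := cocycles C n\<rparr>) (coboundaries C n)"
proof -
  interpret comm_group "grp C n" using C by (rule grp_comm)
  interpret d: group_hom "grp C n" "grp C (n + 1)" "diff C n" by (rule diff_group_hom[OF C])
  interpret d': group_hom "grp C (n - 1)" "grp C n" "diff C (n - 1)"
    using diff_group_hom[OF C, of "n - 1"] by simp
  have Z: "subgroup (cocycles C n) (grp C n)" unfolding cocycles_def by (rule d.subgroup_kernel)
  have "subgroup (coboundaries C n) (grp C n)"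
    unfolding coboundaries_def by (rule d'.img_is_subgroup)
  moreover have "coboundaries C n \<subseteq> cocycles C n"
  proof
    fix x assume "x \<in> coboundaries C n"
    then obtain z where z: "z \<in> carrier (grp C (n - 1))" "x = diff C (n - 1) z"
      by (auto simp: coboundaries_iff)
    have "diff C (n - 1 + 1) (diff C (n - 1) z) = \<one>\<^bsub>grp C (n - 1 + 1 + 1)\<^esub>"
      using C z(1) by (simp only: cochain_complex_def)
    then show "x \<in> cocycles C n" using z d'.hom_closed by (simp add: cocycles_iff)
  qed
  ultimately have "subgroup (coboundaries C n) ((grp C n)\<lparr>carrier := cocycles C n\<rparr>)"
    using subgroup_incl Z by blast
  moreover have "comm_group ((grp C n)\<lparr>carrier := cocycles C n\<rparr>)"
  proof (rule group.group_comm_groupI)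
    show "group ((grp C n)\<lparr>carrier := cocycles C n\<rparr>)" by (rule subgroup.subgroup_is_group[OF Z is_group])
  qed (use subgroup.subset[OF Z] m_comm in auto)
  ultimately show ?thesis by (simp add: comm_quotient_def)
qed

lemma quasi_isomorphismI:
  assumes f: "cochain_map C D f"
    and surj: "\<And>n y. y \<in> cocycles D n \<Longrightarrow>
      \<exists>x \<in> cocycles C n. \<exists>b \<in> coboundaries D n. y = b \<otimes>\<^bsub>grp D n\<^esub> f n x"
    and inj: "\<And>n x. x \<in> cocycles C n \<Longrightarrow> f n x \<in> coboundaries D n \<Longrightarrow> x \<in> coboundaries C n"
  shows "quasi_isomorphism C D f"
  unfolding quasi_isomorphism_def
proof (intro conjI allI)
  fix n
  have CD: "cochain_complex C" "cochain_complex D" and h: "\<And>n. f n \<in> hom (grp C n) (grp D n)"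
    and fd: "\<And>n x. x \<in> carrier (grp C n) \<Longrightarrow> f (n + 1) (diff C n x) = diff D n (f n x)"
    using f by (auto simp: cochain_map_def)
  let ?C = "(grp C n)\<lparr>carrier := cocycles C n\<rparr>" and ?D = "(grp D n)\<lparr>carrier := cocycles D n\<rparr>"
  have one: "f n \<one>\<^bsub>grp C n\<^esub> = \<one>\<^bsub>grp D n\<^esub>" for n by (rule hom_one[OF h grp_group[OF CD(1)] grp_group[OF CD(2)]])
  have cyc: "f n x \<in> cocycles D n" if "x \<in> cocycles C n" for x
    using that fd[of x n, symmetric] one hom_in_carrier[OF h] by (auto simp: cocycles_iff)
  have bd: "f n x \<in> coboundaries D n" if "x \<in> coboundaries C n" for x
  proof -
    obtain z where z: "z \<in> carrier (grp C (n - 1))" "x = diff C (n - 1) z"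
      using \<open>x \<in> coboundaries C n\<close> by (auto simp: coboundaries_iff)
    then have "f n x = diff D (n - 1) (f (n - 1) z)" using fd[of z "n - 1"] by simp
    then show ?thesis using hom_in_carrier[OF h z(1)] by (auto simp: coboundaries_iff)
  qed
  have "f n \<in> hom ?C ?D" using h[of n] cyc by (auto simp: hom_def cocycles_iff)
  then have "coset_map ?C (coboundaries C n) ?D (coboundaries D n) (f n)"
    using cohomology_quotient[OF CD(1), of n] cohomology_quotient[OF CD(2), of n] bd
    by (simp add: coset_map_def coset_map_axioms_def)
  then interpret coset_map ?C "coboundaries C n" ?D "coboundaries D n" "f n" .
  have "induced ?D (coboundaries D n) (f n) \<in> iso (?C Mod coboundaries C n) (?D Mod coboundaries D n)"
    by (rule induced_iso) (use surj inj in auto)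
  then show "induced (grp D n) (coboundaries D n) (f n) \<in> iso (cohomology C n) (cohomology D n)"
    unfolding cohomology_def by (simp add: induced_def[abs_def] set_mult_def)
qed (rule f)

section \<open>Reduction modulo p\<close>

lemma multiples_quotient:
  assumes "comm_group G"
  shows "comm_quotient G (multiples p G)"
proof -
  interpret comm_group G by fact
  have "(\<lambda>x. x [^]\<^bsub>G\<^esub> p) \<in> hom G G" by (rule homI) (simp_all add: nat_pow_distrib)
  then interpret group_hom G G "\<lambda>x. x [^]\<^bsub>G\<^esub> p"
    by (intro group_hom.intro group_hom_axioms.intro) auto
  show ?thesis
    using img_is_subgroup comm_group_axioms by (simp add: comm_quotient_def multiples_def)
qed

lemma multiples_map:
  assumes "comm_group G" "comm_group H" "f \<in> hom G H"
  shows "coset_map G (multiples p G) H (multiples p H) f"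
proof -
  have "f a \<in> multiples p H" if "a \<in> multiples p G" for a
    using that hom_pow[OF assms(3,1,2)] hom_in_carrier[OF assms(3)] by (auto simp: multiples_def)
  then show ?thesis
    using assms multiples_quotient[OF assms(1), of p] multiples_quotient[OF assms(2), of p] by (simp add: coset_map_def coset_map_axioms_def)
qed

abbreviation (input) red :: "nat \<Rightarrow> ('a, 'm) cochain_scheme \<Rightarrow> int \<Rightarrow> 'a \<Rightarrow> 'a set" where
  "red p C n x \<equiv> multiples p (grp C n) #>\<^bsub>grp C n\<^esub> x"

lemma mod_p_sel: "grp (mod_p p C) n = grp C n Mod multiples p (grp C n)"
  "diff (mod_p p C) n = induced (grp C (n + 1)) (multiples p (grp C (n + 1))) (diff C n)"
  by (simp_all add: mod_p_def)

lemma mod_p_carrier: "carrier (grp (mod_p p C) n) = red p C n ` carrier (grp C n)"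
  by (simp add: mod_p_sel carrier_FactGroup)

lemma mod_p_diff:
  assumes "cochain_complex C" "x \<in> carrier (grp C n)"
  shows "diff (mod_p p C) n (red p C n x) = red p C (n + 1) (diff C n x)"
  unfolding mod_p_sel
  by (rule coset_map.induced_coset[OF multiples_map])
    (use assms in \<open>auto simp: cochain_complex_def\<close>)

lemma mod_p_map_red:
  assumes "comm_group (grp C n)" "comm_group (grp D n)" "f n \<in> hom (grp C n) (grp D n)"
    "x \<in> carrier (grp C n)"
  shows "mod_p_map p D f n (red p C n x) = red p D n (f n x)"
  unfolding mod_p_map_def
  by (rule coset_map.induced_coset[OF multiples_map]) (use assms in auto)

lemma mod_p_mult:
  assumes "comm_group (grp C n)" "x \<in> carrier (grp C n)" "y \<in> carrier (grp C n)"
  shows "red p C n x \<otimes>\<^bsub>grp (mod_p p C) n\<^esub> red p C n y = red p C n (x \<otimes>\<^bsub>grp C n\<^esub> y)"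
  unfolding mod_p_sel by (rule comm_quotient.Mod_mult[OF multiples_quotient]) (use assms in auto)

lemma mod_p_one: "\<one>\<^bsub>grp (mod_p p C) n\<^esub> = multiples p (grp C n)"
  by (simp add: mod_p_sel)

lemma red_eq_iff:
  assumes "comm_group (grp C n)" "x \<in> carrier (grp C n)" "y \<in> carrier (grp C n)"
  shows "red p C n x = red p C n y \<longleftrightarrow>
    (\<exists>u \<in> carrier (grp C n). x = u [^]\<^bsub>grp C n\<^esub> p \<otimes>\<^bsub>grp C n\<^esub> y)"
  using comm_quotient.coset_eq_iff[OF multiples_quotient, of "grp C n" x y p] assms
  by (auto simp: multiples_def)

lemma red_trivial_iff:
  assumes "comm_group (grp C n)" "x \<in> carrier (grp C n)"
  shows "red p C n x = multiples p (grp C n) \<longleftrightarrow> (\<exists>u \<in> carrier (grp C n). x = u [^]\<^bsub>grp C n\<^esub> p)"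
  using comm_quotient.coset_trivial_iff[OF multiples_quotient, of "grp C n" x p] assms
  by (auto simp: multiples_def)

lemma mod_p_complex:
  assumes C: "cochain_complex C"
  shows "cochain_complex (mod_p p C)"
  unfolding cochain_complex_def
proof (intro conjI allI ballI)
  fix n
  show "comm_group (grp (mod_p p C) n)"
    unfolding mod_p_sel by (rule comm_quotient.Mod_group[OF multiples_quotient[OF grp_comm[OF C]]])
  show "diff (mod_p p C) n \<in> hom (grp (mod_p p C) n) (grp (mod_p p C) (n + 1))"
    unfolding mod_p_sel by (rule coset_map.induced_hom[OF multiples_map])
      (use C in \<open>auto simp: cochain_complex_def\<close>)
  fix X assume "X \<in> carrier (grp (mod_p p C) n)"
  then obtain x where x: "x \<in> carrier (grp C n)" "X = red p C n x" by (auto simp: mod_p_carrier)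
  have "diff (mod_p p C) (n + 1) (diff (mod_p p C) n X) = red p C (n + 1 + 1) \<one>\<^bsub>grp C (n + 1 + 1)\<^esub>"
    unfolding x(2) mod_p_diff[OF C x(1)] mod_p_diff[OF C diff_closed[OF C x(1)]]
    using C x(1) by (simp add: cochain_complex_def)
  also have "\<dots> = \<one>\<^bsub>grp (mod_p p C) (n + 1 + 1)\<^esub>"
    unfolding mod_p_one using comm_quotient.coset_trivial_iff[OF multiples_quotient[OF grp_comm[OF C]]]
    by (metis C group.is_monoid grp_comm grp_group monoid.one_closed multiples_quotient comm_quotient_def subgroup.one_closed)
  finally show "diff (mod_p p C) (n + 1) (diff (mod_p p C) n X) = \<one>\<^bsub>grp (mod_p p C) (n + 1 + 1)\<^esub>" .
qed

lemma mod_p_cocycle_iff: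
  assumes C: "cochain_complex C" and x: "x \<in> carrier (grp C n)"
  shows "red p C n x \<in> cocycles (mod_p p C) n \<longleftrightarrow>
    (\<exists>y \<in> carrier (grp C (n + 1)). diff C n x = y [^]\<^bsub>grp C (n + 1)\<^esub> p)"
  using x by (simp add: cocycles_iff mod_p_carrier mod_p_diff[OF C] mod_p_one
      red_trivial_iff[OF grp_comm[OF C] diff_closed[OF C]])

lemma mod_p_coboundaries:
  assumes C: "cochain_complex C"
  shows "coboundaries (mod_p p C) n = (\<lambda>z. red p C n (diff C (n - 1) z)) ` carrier (grp C (n - 1))"
  using mod_p_diff[OF C, of _ "n - 1"] by (auto simp: coboundaries_iff mod_p_carrier)

lemma mod_p_coboundary_iff:
  assumes C: "cochain_complex C" and x: "x \<in> carrier (grp C n)"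
  shows "red p C n x \<in> coboundaries (mod_p p C) n \<longleftrightarrow>
    (\<exists>u \<in> carrier (grp C n). \<exists>z \<in> carrier (grp C (n - 1)).
       x = u [^]\<^bsub>grp C n\<^esub> p \<otimes>\<^bsub>grp C n\<^esub> diff C (n - 1) z)"
proof -
  have "red p C n x = red p C n (diff C (n - 1) z) \<longleftrightarrow> (\<exists>u \<in> carrier (grp C n).
      x = u [^]\<^bsub>grp C n\<^esub> p \<otimes>\<^bsub>grp C n\<^esub> diff C (n - 1) z)" if "z \<in> carrier (grp C (n - 1))" for z
    using red_eq_iff[OF grp_comm[OF C] x] diff_closed[OF C that] by simp
  then show ?thesis unfolding mod_p_coboundaries[OF C] by blast
qed

text \<open>
  Surjectivity and injectivity on the cohomology modulo \<open>p\<close>, for representatives in \<open>C\<close>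
  and \<open>D\<close>.
\<close>
lemma quasi_isomorphism_mod_pI:
  assumes f: "cochain_map C D f"
    and surj: "\<And>n y y'. y \<in> carrier (grp D n) \<Longrightarrow> y' \<in> carrier (grp D (n + 1)) \<Longrightarrow>
      diff D n y = y' [^]\<^bsub>grp D (n + 1)\<^esub> p \<Longrightarrow>
      \<exists>x \<in> carrier (grp C n). \<exists>x' \<in> carrier (grp C (n + 1)). diff C n x = x' [^]\<^bsub>grp C (n + 1)\<^esub> p \<and>
        (\<exists>u \<in> carrier (grp D n). \<exists>z \<in> carrier (grp D (n - 1)).
          y = f n x \<otimes>\<^bsub>grp D n\<^esub> (u [^]\<^bsub>grp D n\<^esub> p \<otimes>\<^bsub>grp D n\<^esub> diff D (n - 1) z))"
    and inj: "\<And>n x x' u z. x \<in> carrier (grp C n) \<Longrightarrow> x' \<in> carrier (grp C (n + 1)) \<Longrightarrow>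
      diff C n x = x' [^]\<^bsub>grp C (n + 1)\<^esub> p \<Longrightarrow> u \<in> carrier (grp D n) \<Longrightarrow> z \<in> carrier (grp D (n - 1)) \<Longrightarrow>
      f n x = u [^]\<^bsub>grp D n\<^esub> p \<otimes>\<^bsub>grp D n\<^esub> diff D (n - 1) z \<Longrightarrow>
      \<exists>v \<in> carrier (grp C n). \<exists>t \<in> carrier (grp C (n - 1)).
        x = v [^]\<^bsub>grp C n\<^esub> p \<otimes>\<^bsub>grp C n\<^esub> diff C (n - 1) t"
  shows "quasi_isomorphism (mod_p p C) (mod_p p D) (mod_p_map p D f)"
proof (rule quasi_isomorphismI)
  have C: "cochain_complex C" and D: "cochain_complex D" and h: "\<And>n. f n \<in> hom (grp C n) (grp D n)"
    and fd: "\<And>n x. x \<in> carrier (grp C n) \<Longrightarrow> f (n + 1) (diff C n x) = diff D n (f n x)"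
    using f by (auto simp: cochain_map_def)
  note fc = hom_in_carrier[OF h]
  note f_red = mod_p_map_red[where f = f, OF grp_comm[OF C] grp_comm[OF D] h]
  have dc: "diff D (n - 1) z \<in> carrier (grp D n)" if "z \<in> carrier (grp D (n - 1))" for n z
    using diff_closed[OF D that] by simp
  show "cochain_map (mod_p p C) (mod_p p D) (mod_p_map p D f)"
    unfolding cochain_map_def
  proof (intro conjI allI ballI mod_p_complex C D)
    fix n
    show "mod_p_map p D f n \<in> hom (grp (mod_p p C) n) (grp (mod_p p D) n)"
      unfolding mod_p_sel mod_p_map_def
      by (rule coset_map.induced_hom[OF multiples_map[OF grp_comm[OF C] grp_comm[OF D] h]])
    fix X assume "X \<in> carrier (grp (mod_p p C) n)"
    then obtain x where x: "x \<in> carrier (grp C n)" "X = red p C n x" by (auto simp: mod_p_carrier)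
    then show "mod_p_map p D f (n + 1) (diff (mod_p p C) n X) = diff (mod_p p D) n (mod_p_map p D f n X)"
      by (simp add: mod_p_diff C D f_red fc diff_closed fd)
  qed
  fix n
  show "\<exists>X \<in> cocycles (mod_p p C) n. \<exists>B \<in> coboundaries (mod_p p D) n.
      Y = B \<otimes>\<^bsub>grp (mod_p p D) n\<^esub> mod_p_map p D f n X" if Y: "Y \<in> cocycles (mod_p p D) n" for Y
  proof -
    obtain y where y: "y \<in> carrier (grp D n)" "Y = red p D n y"
      using Y by (auto simp: cocycles_iff mod_p_carrier)
    obtain y' where y': "y' \<in> carrier (grp D (n + 1))" "diff D n y = y' [^]\<^bsub>grp D (n + 1)\<^esub> p"
      using Y y mod_p_cocycle_iff[OF D] by metis
    obtain x x' u z where h: "x \<in> carrier (grp C n)" "x' \<in> carrier (grp C (n + 1))"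
      "diff C n x = x' [^]\<^bsub>grp C (n + 1)\<^esub> p" "u \<in> carrier (grp D n)" "z \<in> carrier (grp D (n - 1))"
      "y = f n x \<otimes>\<^bsub>grp D n\<^esub> (u [^]\<^bsub>grp D n\<^esub> p \<otimes>\<^bsub>grp D n\<^esub> diff D (n - 1) z)"
      using surj[OF y(1) y'] by blast
    interpret D: comm_group "grp D n" by (rule grp_comm[OF D])
    have "y = u [^]\<^bsub>grp D n\<^esub> p \<otimes>\<^bsub>grp D n\<^esub> (diff D (n - 1) z \<otimes>\<^bsub>grp D n\<^esub> f n x)"
      using h fc dc by (simp add: D.m_ac)
    then have "Y = red p D n (diff D (n - 1) z) \<otimes>\<^bsub>grp (mod_p p D) n\<^esub> mod_p_map p D f n (red p C n x)"
      using h y dc[of z n] fc red_eq_iff[OF grp_comm[OF D] y(1)] by (auto simp: f_red mod_p_mult grp_comm D)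
    moreover have "red p C n x \<in> cocycles (mod_p p C) n" using mod_p_cocycle_iff[OF C] h by blast
    ultimately show ?thesis using h by (auto simp: mod_p_coboundaries[OF D])
  qed
  show "X \<in> coboundaries (mod_p p C) n"
    if X: "X \<in> cocycles (mod_p p C) n" and b: "mod_p_map p D f n X \<in> coboundaries (mod_p p D) n" for X
  proof -
    obtain x where x: "x \<in> carrier (grp C n)" "X = red p C n x"
      using X by (auto simp: cocycles_iff mod_p_carrier)
    obtain x' where x': "x' \<in> carrier (grp C (n + 1))" "diff C n x = x' [^]\<^bsub>grp C (n + 1)\<^esub> p"
      using X x mod_p_cocycle_iff[OF C] by metis
    obtain u z where "u \<in> carrier (grp D n)" "z \<in> carrier (grp D (n - 1))"
      "f n x = u [^]\<^bsub>grp D n\<^esub> p \<otimes>\<^bsub>grp D n\<^esub> diff D (n - 1) z"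
      using b mod_p_coboundary_iff[OF D fc[OF x(1)]] unfolding x(2) f_red[OF x(1)] by metis
    from inj[OF x(1) x' this] show ?thesis
      using mod_p_coboundary_iff[OF C x(1)] x(2) by metis
  qed
qed

section \<open>The Cartier condition for elements\<close>

text \<open>
  The Cartier map sends \<open>x mod p\<close> to the class of \<open>Fx mod p\<close>, so its bijectivity is read off
  by choosing representatives, first of the cohomology class and then modulo \<open>p\<close>.
\<close>
lemma cartier_type_cplx:
  assumes "cartier_type p M"
  shows "cartier_cplx p M"
proof -
  interpret torsion_free_cplx p M
    using assms by unfold_locales (auto simp: cartier_type_def)
  have M: "cochain_complex M" using dieudonne by (simp add: dieudonne_complex_def)
  note MM = mod_p_complex[OF M, of p]
  have iso: "cartier_map p M n \<in> iso (grp (mod_p p M) n) (cohomology (mod_p p M) n)" for n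
    using assms by (simp add: cartier_type_def)
  have coset: "B #>\<^bsub>(grp (mod_p p M) n)\<lparr>carrier := cocycles (mod_p p M) n\<rparr>\<^esub> X = B #>\<^bsub>grp (mod_p p M) n\<^esub> X"
    for B X n by (simp add: r_coset_def)
  have map: "cartier_map p M n (red p M n x) =
     coboundaries (mod_p p M) n #>\<^bsub>grp (mod_p p M) n\<^esub> red p M n (F n x)" if "x \<in> C n" for n x
    unfolding cartier_map_def using that by (simp add: mod_p_map_red grpM F_hom)
  have cyc: "red p M n (F n x) \<in> cocycles (mod_p p M) n" if "x \<in> C n" for n x
    unfolding mod_p_cocycle_iff[OF M F_closed[OF that]] using that dF[OF that] by auto
  show ?thesis
  proof unfold_locales
    fix n x y z
    let ?Z = "(grp (mod_p p M) n)\<lparr>carrier := cocycles (mod_p p M) n\<rparr>"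
    interpret Q: comm_quotient ?Z "coboundaries (mod_p p M) n" by (rule cohomology_quotient[OF MM])
    have tr: "coboundaries (mod_p p M) n #>\<^bsub>grp (mod_p p M) n\<^esub> X = coboundaries (mod_p p M) n"
      if "X \<in> coboundaries (mod_p p M) n" "X \<in> cocycles (mod_p p M) n" for X
      using Q.coset_trivial_iff[of X] that by (simp add: coset)
    {
      assume h: "x \<in> C n" "y \<in> C n" "z \<in> C (n - 1)" "F n x = ml n (pw n y p) (d (n - 1) z)"
      have "red p M n (F n x) \<in> coboundaries (mod_p p M) n"
        using mod_p_coboundary_iff[OF M F_closed[OF h(1)]] h by blast
      moreover have "red p M n (F n (e n)) \<in> coboundaries (mod_p p M) n"
        unfolding mod_p_coboundary_iff[OF M F_closed[OF e_closed]]
        by (intro bexI[of _ "e n"] bexI[of _ "e (n - 1)"]) simp_all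
      ultimately have "cartier_map p M n (red p M n x) = cartier_map p M n (red p M n (e n))"
        using tr[OF _ cyc[OF h(1)]] tr[OF _ cyc[OF e_closed]]
        by (simp only: map[OF h(1)] map[OF e_closed])
      then have "red p M n x = red p M n (e n)"
        by (rule inj_onD[of "cartier_map p M n" "carrier (grp (mod_p p M) n)", rotated])
          (use iso[of n] h(1) in \<open>auto simp: iso_def bij_betw_def mod_p_carrier\<close>)
      then show "\<exists>w \<in> C n. x = pw n w p"
        using red_eq_iff[OF grpM h(1) e_closed] by auto
    next
      fix x'
      assume h: "x \<in> C n" "x' \<in> C (n + 1)" "d n x = pw (n + 1) x' p"
      have x: "red p M n x \<in> cocycles (mod_p p M) n" using mod_p_cocycle_iff[OF M h(1)] h by blast
      then have "coboundaries (mod_p p M) n #>\<^bsub>grp (mod_p p M) n\<^esub> red p M n x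
          \<in> carrier (cohomology (mod_p p M) n)"
        unfolding cohomology_def Q.Mod_carrier by (auto simp: coset)
      then obtain a where a: "a \<in> C n" "coboundaries (mod_p p M) n #>\<^bsub>grp (mod_p p M) n\<^esub> red p M n x =
          cartier_map p M n (red p M n a)"
        using iso[of n] by (auto simp: iso_iff mod_p_carrier)
      then obtain b where "b \<in> coboundaries (mod_p p M) n"
        "red p M n x = b \<otimes>\<^bsub>grp (mod_p p M) n\<^esub> red p M n (F n a)"
        using Q.coset_eq_iff[of "red p M n x" "red p M n (F n a)"] x cyc by (auto simp: map coset)
      then obtain z where z: "z \<in> C (n - 1)"
        "red p M n x = red p M n (ml n (d (n - 1) z) (F n a))"
        using a by (auto simp: mod_p_coboundaries[OF M] mod_p_mult grpM)
      then obtain u where u: "u \<in> C n" "x = ml n (pw n u p) (ml n (d (n - 1) z) (F n a))"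
        using red_eq_iff[OF grpM h(1)] a by auto
      have "x = ml n (F n a) (ml n (pw n u p) (d (n - 1) z))"
        using u z(1) a(1) by (simp add: ac)
      then show "\<exists>a \<in> C n. \<exists>y \<in> C n. \<exists>z \<in> C (n - 1). x = ml n (F n a) (ml n (pw n y p) (d (n - 1) z))"
        using u(1) z(1) a(1) by blast
    }
  qed
qed

section \<open>The completion of a saturated complex\<close>

context saturated_cplx
begin

lemma fil_quotient: "comm_quotient (grp M n) (fil p M r n)"
  using grpM fil_subgroup by (simp add: comm_quotient_def)

text \<open>
  Elements of the inverse limit are handled through sequences \<open>x\<close> in \<open>M\<close> of
  representatives, \<open>x\<^sub>r\<close> standing for the component modulo the \<open>r\<close>-th filtration step.
\<close>
definition coherent :: "int \<Rightarrow> (nat \<Rightarrow> 'a) \<Rightarrow> bool" where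
  "coherent n x \<longleftrightarrow> (\<forall>r. x r \<in> C n \<and> (\<exists>\<phi> \<in> fil p M r n. x (Suc r) = ml n \<phi> (x r)))"

definition limit :: "int \<Rightarrow> (nat \<Rightarrow> 'a) \<Rightarrow> nat \<Rightarrow> 'a set" where
  "limit n x = (\<lambda>r. fil p M r n #>\<^bsub>grp M n\<^esub> x r)"

lemma coherent_closed: "coherent n x \<Longrightarrow> x r \<in> C n"
  by (simp add: coherent_def)

lemma coherent_step:
  assumes "coherent n x"
  obtains \<phi> where "\<phi> \<in> fil p M r n" "x (Suc r) = ml n \<phi> (x r)"
  using assms by (auto simp: coherent_def)

lemma coherent_const: "x \<in> C n \<Longrightarrow> coherent n (\<lambda>_. x)"
  unfolding coherent_def using fil_e by (auto intro!: bexI[of _ "e n"])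

lemma coherent_ml:
  assumes "coherent n x" "coherent n y"
  shows "coherent n (\<lambda>r. ml n (x r) (y r))"
  unfolding coherent_def
proof (intro allI conjI)
  fix r
  note c = coherent_closed[OF assms(1)] coherent_closed[OF assms(2)]
  show "ml n (x r) (y r) \<in> C n" using c by simp
  obtain \<phi> \<psi> where h: "\<phi> \<in> fil p M r n" "x (Suc r) = ml n \<phi> (x r)"
    "\<psi> \<in> fil p M r n" "y (Suc r) = ml n \<psi> (y r)"
    using coherent_step[OF assms(1)] coherent_step[OF assms(2)] by metis
  then have "ml n (x (Suc r)) (y (Suc r)) = ml n (ml n \<phi> \<psi>) (ml n (x r) (y r))"
    using c fil_closed by (simp add: ac)
  then show "\<exists>\<chi> \<in> fil p M r n. ml n (x (Suc r)) (y (Suc r)) = ml n \<chi> (ml n (x r) (y r))"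
    using fil_ml h by blast
qed

lemma coherent_iv:
  assumes "coherent n x"
  shows "coherent n (\<lambda>r. iv n (x r))"
  unfolding coherent_def
proof (intro allI conjI)
  fix r
  note c = coherent_closed[OF assms(1)]
  show "iv n (x r) \<in> C n" using c by simp
  obtain \<phi> where h: "\<phi> \<in> fil p M r n" "x (Suc r) = ml n \<phi> (x r)"
    using coherent_step[OF assms] .
  then have "iv n (x (Suc r)) = ml n (iv n \<phi>) (iv n (x r))"
    using c fil_closed by (simp add: comm_group.inv_mult[OF grpM])
  then show "\<exists>\<chi> \<in> fil p M r n. iv n (x (Suc r)) = ml n \<chi> (iv n (x r))"
    using fil_iv h by blast
qed

lemma coherent_d:
  assumes "coherent n x"
  shows "coherent (n + 1) (\<lambda>r. d n (x r))"
  unfolding coherent_def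
proof (intro allI conjI)
  fix r
  note c = coherent_closed[OF assms(1)]
  show "d n (x r) \<in> C (n + 1)" using c by simp
  obtain \<phi> where h: "\<phi> \<in> fil p M r n" "x (Suc r) = ml n \<phi> (x r)"
    using coherent_step[OF assms] .
  then have "d n (x (Suc r)) = ml (n + 1) (d n \<phi>) (d n (x r))"
    using c fil_closed by (simp add: d_ml)
  then show "\<exists>\<chi> \<in> fil p M r (n + 1). d n (x (Suc r)) = ml (n + 1) \<chi> (d n (x r))"
    using fil_d h by blast
qed

lemma fil_induced_id:
  assumes "x \<in> C n"
  shows "induced (grp M n) (fil p M r n) (\<lambda>x. x) (fil p M (Suc r) n #>\<^bsub>grp M n\<^esub> x) =
    fil p M r n #>\<^bsub>grp M n\<^esub> x"
proof -
  interpret coset_map "grp M n" "fil p M (Suc r) n" "grp M n" "fil p M r n" "\<lambda>x. x"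
    using fil_quotient[of n r] fil_quotient[of n "Suc r"] fil_Suc[of r n]
    by (auto simp: coset_map_def coset_map_axioms_def hom_def)
  show ?thesis by (rule induced_coset[OF assms])
qed

lemma W_trunc_carrier: "carrier (W_trunc p M r n) = (\<lambda>x. fil p M r n #>\<^bsub>grp M n\<^esub> x) ` C n"
  by (simp add: W_trunc_def carrier_FactGroup)

lemma fil_coset_eq: "x \<in> C n \<Longrightarrow> y \<in> C n \<Longrightarrow>
    fil p M r n #>\<^bsub>grp M n\<^esub> x = fil p M r n #>\<^bsub>grp M n\<^esub> y \<longleftrightarrow> (\<exists>\<phi> \<in> fil p M r n. x = ml n \<phi> y)"
  using comm_quotient.coset_eq_iff[OF fil_quotient] .

lemma W_carrier: "carrier (grp (W p M) n) = limit n ` Collect (coherent n)"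
proof
  show "carrier (grp (W p M) n) \<subseteq> limit n ` Collect (coherent n)"
  proof
    fix X assume X: "X \<in> carrier (grp (W p M) n)"
    then have "X r \<in> (\<lambda>x. fil p M r n #>\<^bsub>grp M n\<^esub> x) ` C n" for r
      by (simp add: W_def W_grp_def PiE_iff W_trunc_carrier)
    then have "\<forall>r. \<exists>x. x \<in> C n \<and> X r = fil p M r n #>\<^bsub>grp M n\<^esub> x" by blast
    then obtain x where x: "\<forall>r. x r \<in> C n \<and> X r = fil p M r n #>\<^bsub>grp M n\<^esub> x r" by metis
    have "fil p M r n #>\<^bsub>grp M n\<^esub> x (Suc r) = fil p M r n #>\<^bsub>grp M n\<^esub> x r" for r
      using X x fil_induced_id[of "x (Suc r)" n r] by (simp add: W_def W_grp_def)
    then have "coherent n x" using x by (auto simp: coherent_def fil_coset_eq)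
    moreover have "X = limit n x" using x by (auto simp: limit_def)
    ultimately show "X \<in> limit n ` Collect (coherent n)" by auto
  qed
  show "limit n ` Collect (coherent n) \<subseteq> carrier (grp (W p M) n)"
  proof clarify
    fix x assume x: "coherent n x"
    have "fil p M r n #>\<^bsub>grp M n\<^esub> x (Suc r) = fil p M r n #>\<^bsub>grp M n\<^esub> x r" for r
      using x by (auto simp: coherent_def fil_coset_eq)
    then show "limit n x \<in> carrier (grp (W p M) n)"
      using coherent_closed[OF x] by (auto simp: W_def W_grp_def limit_def W_trunc_carrier fil_induced_id PiE_iff)
  qed
qed

lemma limit_in [simp]: "coherent n x \<Longrightarrow> limit n x \<in> carrier (grp (W p M) n)"
  by (simp add: W_carrier)

lemma W_rep:
  assumes "X \<in> carrier (grp (W p M) n)"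
  obtains x where "coherent n x" "X = limit n x"
  using assms by (auto simp: W_carrier)

lemma limit_eq_iff: "coherent n x \<Longrightarrow> coherent n y \<Longrightarrow>
    limit n x = limit n y \<longleftrightarrow> (\<forall>r. \<exists>\<phi> \<in> fil p M r n. x r = ml n \<phi> (y r))"
  by (simp add: limit_def fun_eq_iff fil_coset_eq coherent_closed)

lemma W_mult:
  assumes "coherent n x" "coherent n y"
  shows "limit n x \<otimes>\<^bsub>grp (W p M) n\<^esub> limit n y = limit n (\<lambda>r. ml n (x r) (y r))"
  using comm_quotient.Mod_mult[OF fil_quotient coherent_closed[OF assms(1)] coherent_closed[OF assms(2)]]
  by (simp add: W_def W_grp_def limit_def W_trunc_def fun_eq_iff)

lemma W_one: "\<one>\<^bsub>grp (W p M) n\<^esub> = limit n (\<lambda>_. e n)"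
  using comm_quotient.coset_trivial_iff[OF fil_quotient e_closed] fil_e
  by (simp add: W_def W_grp_def limit_def W_trunc_def fun_eq_iff)

lemma W_diff:
  assumes "coherent n x"
  shows "diff (W p M) n (limit n x) = limit (n + 1) (\<lambda>r. d n (x r))"
proof -
  have "coset_map (grp M n) (fil p M r n) (grp M (n + 1)) (fil p M r (n + 1)) (d n)" for r
    using fil_quotient fil_d d_hom by (simp add: coset_map_def coset_map_axioms_def)
  from coset_map.induced_coset[OF this coherent_closed[OF assms]]
  show ?thesis by (simp add: W_def limit_def)
qed

lemma coherent_pw: "coherent n x \<Longrightarrow> coherent n (\<lambda>r. pw n (x r) k)"
proof (induction k)
  case 0
  then show ?case using coherent_const[of "e n" n] by simp
next
  case (Suc k)
  then show ?case using coherent_ml[of n "\<lambda>r. pw n (x r) k" x] by simp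
qed

lemma W_pow:
  assumes "coherent n x"
  shows "limit n x [^]\<^bsub>grp (W p M) n\<^esub> (k::nat) = limit n (\<lambda>r. pw n (x r) k)"
  by (induction k) (simp_all add: W_one W_mult coherent_pw assms)

lemma W_complex: "cochain_complex (W p M)"
  unfolding cochain_complex_def
proof (intro conjI allI ballI)
  fix n
  show "comm_group (grp (W p M) n)"
  proof (rule comm_groupI)
    show "\<one>\<^bsub>grp (W p M) n\<^esub> \<in> carrier (grp (W p M) n)" by (simp add: W_one coherent_const)
    fix X assume "X \<in> carrier (grp (W p M) n)"
    then obtain x where x: "coherent n x" "X = limit n x" by (rule W_rep)
    note cx = coherent_closed[OF x(1)]
    show "\<one>\<^bsub>grp (W p M) n\<^esub> \<otimes>\<^bsub>grp (W p M) n\<^esub> X = X"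
      using x cx by (simp add: W_one W_mult coherent_const)
    show "\<exists>Y \<in> carrier (grp (W p M) n). Y \<otimes>\<^bsub>grp (W p M) n\<^esub> X = \<one>\<^bsub>grp (W p M) n\<^esub>"
      by (rule bexI[of _ "limit n (\<lambda>r. iv n (x r))"])
        (use x cx in \<open>simp_all add: W_one W_mult coherent_iv\<close>)
    fix Y assume "Y \<in> carrier (grp (W p M) n)"
    then obtain y where y: "coherent n y" "Y = limit n y" by (rule W_rep)
    note cy = coherent_closed[OF y(1)]
    show "X \<otimes>\<^bsub>grp (W p M) n\<^esub> Y \<in> carrier (grp (W p M) n)"
      using x y by (simp add: W_mult coherent_ml)
    show "X \<otimes>\<^bsub>grp (W p M) n\<^esub> Y = Y \<otimes>\<^bsub>grp (W p M) n\<^esub> X"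
      using x y cx cy by (simp add: W_mult comm)
    fix Z assume "Z \<in> carrier (grp (W p M) n)"
    then obtain z where z: "coherent n z" "Z = limit n z" by (rule W_rep)
    note cz = coherent_closed[OF z(1)]
    show "X \<otimes>\<^bsub>grp (W p M) n\<^esub> Y \<otimes>\<^bsub>grp (W p M) n\<^esub> Z =
        X \<otimes>\<^bsub>grp (W p M) n\<^esub> (Y \<otimes>\<^bsub>grp (W p M) n\<^esub> Z)"
      using x y z cx cy cz by (simp add: W_mult coherent_ml assoc)
  qed
  show "diff (W p M) n \<in> hom (grp (W p M) n) (grp (W p M) (n + 1))"
  proof (rule homI)
    fix X assume "X \<in> carrier (grp (W p M) n)"
    then obtain x where x: "coherent n x" "X = limit n x" by (rule W_rep)
    then show "diff (W p M) n X \<in> carrier (grp (W p M) (n + 1))" by (simp add: W_diff coherent_d)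
    fix Y assume "Y \<in> carrier (grp (W p M) n)"
    then obtain y where y: "coherent n y" "Y = limit n y" by (rule W_rep)
    show "diff (W p M) n (X \<otimes>\<^bsub>grp (W p M) n\<^esub> Y) =
        diff (W p M) n X \<otimes>\<^bsub>grp (W p M) (n + 1)\<^esub> diff (W p M) n Y"
      using x y coherent_closed[OF x(1)] coherent_closed[OF y(1)]
      by (simp add: W_mult W_diff coherent_ml coherent_d d_ml)
  qed
  fix X assume "X \<in> carrier (grp (W p M) n)"
  then obtain x where x: "coherent n x" "X = limit n x" by (rule W_rep)
  show "diff (W p M) (n + 1) (diff (W p M) n X) = \<one>\<^bsub>grp (W p M) (n + 1 + 1)\<^esub>"
    unfolding x(2) W_diff[OF x(1)] W_diff[OF coherent_d[OF x(1)]] W_one dd[OF coherent_closed[OF x(1)]] ..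
qed

lemma W_proj_limit: "W_proj p M n x = limit n (\<lambda>_. x)"
  by (simp add: W_proj_def limit_def fun_eq_iff)

text \<open>
  If \<open>dz\<close> is divisible by \<open>p\<close> in the limit, then \<open>z\<close> is represented by a sequence
  \<open>F x\<^sub>r\<close>. The elements \<open>x\<^sub>r\<close> exist by \<open>cocycle_mod_p_fil\<close>, and by \<open>F_fil\<close> they
  inherit the convergence of the \<open>F x\<^sub>r\<close>. The index is shifted, with \<open>x\<^sub>r\<close> chosen for
  \<open>z\<^sub>r\<^sub>+\<^sub>1\<close>, because \<open>cocycle_mod_p_fil\<close> concerns the steps from the first on.
\<close>
lemma frob_lift:
  assumes z: "coherent n z" and y: "coherent (n + 1) y"
    and eq: "diff (W p M) n (limit n z) = limit (n + 1) y [^]\<^bsub>grp (W p M) (n + 1)\<^esub> p"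
  shows "\<exists>x. (\<forall>r. x r \<in> C n) \<and> (\<forall>r. \<exists>\<phi> \<in> fil p M (Suc r) n. x (Suc r) = ml n \<phi> (x r)) \<and>
    (\<forall>r. \<exists>\<phi> \<in> fil p M r n. z r = ml n \<phi> (F n (x r)))"
proof -
  note cz = coherent_closed[OF z] and cy = coherent_closed[OF y]
  have "\<exists>x \<in> C n. \<exists>\<phi> \<in> fil p M (Suc r) n. z (Suc r) = ml n \<phi> (F n x)" for r
  proof -
    have "limit (n + 1) (\<lambda>r. d n (z r)) = limit (n + 1) (\<lambda>r. pw (n + 1) (y r) p)"
      using eq by (simp add: W_diff z W_pow y)
    then obtain \<phi> where "\<phi> \<in> fil p M (Suc r) (n + 1)"
      "d n (z (Suc r)) = ml (n + 1) \<phi> (pw (n + 1) (y (Suc r)) p)"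
      by (auto simp: limit_eq_iff coherent_d[OF z] coherent_pw[OF y])
    then show ?thesis
      using cocycle_mod_p_fil[OF cz[of "Suc r"] cy[of "Suc r"]] comm fil_closed cy pw_closed by metis
  qed
  then obtain x where x: "\<And>r. x r \<in> C n" "\<And>r. \<exists>\<phi> \<in> fil p M (Suc r) n. z (Suc r) = ml n \<phi> (F n (x r))"
    by metis
  have co: "fil p M s n #>\<^bsub>grp M n\<^esub> z s = fil p M s n #>\<^bsub>grp M n\<^esub> z (Suc s)" for s
    using z coherent_step[OF z, of s] by (metis cz fil_coset_eq)
  have zx: "fil p M (Suc r) n #>\<^bsub>grp M n\<^esub> z (Suc r) = fil p M (Suc r) n #>\<^bsub>grp M n\<^esub> F n (x r)" for r
    using x cz by (simp add: fil_coset_eq)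
  have zx': "fil p M r n #>\<^bsub>grp M n\<^esub> z r = fil p M r n #>\<^bsub>grp M n\<^esub> F n (x r)" for r
  proof -
    have "\<exists>\<phi> \<in> fil p M r n. z (Suc r) = ml n \<phi> (F n (x r))" using x(2)[of r] fil_Suc by blast
    then have "fil p M r n #>\<^bsub>grp M n\<^esub> z (Suc r) = fil p M r n #>\<^bsub>grp M n\<^esub> F n (x r)"
      using x(1) cz by (simp add: fil_coset_eq)
    then show ?thesis using co[of r] by simp
  qed
  have "\<exists>\<phi> \<in> fil p M (Suc r) n. x (Suc r) = ml n \<phi> (x r)" for r
  proof -
    have "fil p M (Suc r) n #>\<^bsub>grp M n\<^esub> F n (x (Suc r)) = fil p M (Suc r) n #>\<^bsub>grp M n\<^esub> F n (x r)"
      using zx'[of "Suc r"] zx[of r] by simp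
    then obtain \<phi> where \<phi>: "\<phi> \<in> fil p M (Suc r) n" "F n (x (Suc r)) = ml n \<phi> (F n (x r))"
      using x(1) by (auto simp: fil_coset_eq)
    obtain u where u: "u \<in> C n" "x (Suc r) = ml n u (x r)" using diff_ex x(1) by metis
    have "ml n (F n (x r)) (F n u) = ml n (F n (x r)) \<phi>"
      using \<phi> u x(1) fil_closed by (simp add: F_ml comm)
    then have "F n u = \<phi>" by (rule cancel[rotated 3]) (use u x(1) \<phi> fil_closed in auto)
    then show ?thesis using F_fil u \<phi>(1) by blast
  qed
  moreover have "\<exists>\<phi> \<in> fil p M r n. z r = ml n \<phi> (F n (x r))" for r
    using zx'[of r] x(1) cz by (simp add: fil_coset_eq)
  ultimately show ?thesis using x(1) by blast
qed

text \<open>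
  With \<open>x\<^sub>r\<^sub>+\<^sub>1 - x\<^sub>r = V\<^sup>r\<^sup>+\<^sup>1 u\<^sub>r + dV\<^sup>r\<^sup>+\<^sup>1 v\<^sub>r\<close>, the relations \<open>FV = p\<close> and \<open>FdV = d\<close> give
  \<open>F x\<^sub>r\<^sub>+\<^sub>1 - F x\<^sub>r = p V\<^sup>r u\<^sub>r + dV\<^sup>r v\<^sub>r\<close>. So \<open>\<alpha>\<close> and \<open>\<beta>\<close> are the partial sums of the
  series \<open>a + \<Sum> V\<^sup>r u\<^sub>r\<close> and \<open>b + \<Sum> V\<^sup>r v\<^sub>r\<close>, which converge for the filtration.
\<close>
lemma frob_series:
  assumes x: "\<And>r. x r \<in> C n" "\<And>r. \<exists>\<phi> \<in> fil p M (Suc r) n. x (Suc r) = ml n \<phi> (x r)"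
    and ab: "m \<in> C n" "a \<in> C n" "b \<in> C (n - 1)"
      "F n (x 0) = ml n m (ml n (pw n a p) (d (n - 1) b))"
  shows "\<exists>\<alpha> \<beta>. coherent n \<alpha> \<and> coherent (n - 1) \<beta> \<and>
    (\<forall>r. F n (x r) = ml n m (ml n (pw n (\<alpha> r) p) (d (n - 1) (\<beta> r))))"
proof -
  have "\<exists>u v. u \<in> C n \<and> v \<in> C (n - 1) \<and>
      x (Suc r) = ml n (ml n ((V n ^^ Suc r) u) (d (n - 1) ((V (n - 1) ^^ Suc r) v))) (x r)" for r
  proof -
    obtain \<phi> where \<phi>: "\<phi> \<in> fil p M (Suc r) n" "x (Suc r) = ml n \<phi> (x r)" using x(2) by blast
    show ?thesis by (rule filE[OF \<phi>(1)]) (use \<phi>(2) in blast)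
  qed
  then obtain u v where uv: "\<And>r. u r \<in> C n" "\<And>r. v r \<in> C (n - 1)"
    "\<And>r. x (Suc r) = ml n (ml n ((V n ^^ Suc r) (u r)) (d (n - 1) ((V (n - 1) ^^ Suc r) (v r)))) (x r)"
    by metis
  define \<alpha> where "\<alpha> = rec_nat a (\<lambda>r t. ml n ((V n ^^ r) (u r)) t)"
  define \<beta> where "\<beta> = rec_nat b (\<lambda>r t. ml (n - 1) ((V (n - 1) ^^ r) (v r)) t)"
  have \<alpha>: "\<alpha> 0 = a" "\<alpha> (Suc r) = ml n ((V n ^^ r) (u r)) (\<alpha> r)" for r by (simp_all add: \<alpha>_def)
  have \<beta>: "\<beta> 0 = b" "\<beta> (Suc r) = ml (n - 1) ((V (n - 1) ^^ r) (v r)) (\<beta> r)" for r by (simp_all add: \<beta>_def)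
  have c\<alpha>: "\<alpha> r \<in> C n" for r by (induction r) (simp_all add: \<alpha> ab uv)
  have c\<beta>: "\<beta> r \<in> C (n - 1)" for r by (induction r) (simp_all add: \<beta> ab uv)
  have "coherent n \<alpha>"
    unfolding coherent_def using c\<alpha> \<alpha>(2) fil_V uv(1) by blast
  moreover have "coherent (n - 1) \<beta>"
    unfolding coherent_def using c\<beta> \<beta>(2) fil_V uv(2) by blast
  moreover have "F n (x r) = ml n m (ml n (pw n (\<alpha> r) p) (d (n - 1) (\<beta> r)))" for r
  proof (induction r)
    case 0
    show ?case using ab(4) by (simp add: \<alpha> \<beta>)
  next
    case (Suc r)
    have 1: "F n ((V n ^^ Suc r) (u r)) = pw n ((V n ^^ r) (u r)) p" using uv by (simp add: FV)
    have 2: "F n (d (n - 1) ((V (n - 1) ^^ Suc r) (v r))) = d (n - 1) ((V (n - 1) ^^ r) (v r))"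
      using FdV[of "(V (n - 1) ^^ r) (v r)" "n - 1"] uv by simp
    have c: "(V n ^^ Suc r) (u r) \<in> C n" "(V (n - 1) ^^ Suc r) (v r) \<in> C (n - 1)"
      by (rule Vk_closed uv)+
    have "F n (x (Suc r)) = ml n (ml n (pw n ((V n ^^ r) (u r)) p) (d (n - 1) ((V (n - 1) ^^ r) (v r)))) (F n (x r))"
      unfolding uv(3) using c x(1) by (simp only: F_ml 1 2 ml_closed dp_closed)
    also have "\<dots> = ml n m (ml n (pw n (\<alpha> (Suc r)) p) (d (n - 1) (\<beta> (Suc r))))"
      using ab uv c\<alpha> c\<beta> by (simp add: Suc.IH \<alpha> \<beta> pw_ml dp_ml ac)
    finally show ?case .
  qed
  ultimately show ?thesis by blast
qed

end

section \<open>Comparison with the completed saturation\<close>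

context cartier_saturation
begin

theorem quasi_isomorphism_W:
  "quasi_isomorphism (mod_p p M) (mod_p p (W p N)) (mod_p_map p (W p N) (\<lambda>n x. W_proj p N n (i n x)))"
proof (rule quasi_isomorphism_mod_pI)
  have M: "cochain_complex M" using dieudonne by (simp add: dieudonne_complex_def)
  show "cochain_map M (W p N) (\<lambda>n x. W_proj p N n (i n x))"
    unfolding cochain_map_def
    by (auto simp: M N.W_complex N.W_proj_limit N.coherent_const N.W_mult i_ml i_d N.W_diff intro!: homI)
next
  fix n Z Y
  assume "Z \<in> carrier (grp (W p N) n)" "Y \<in> carrier (grp (W p N) (n + 1))"
    and eq: "diff (W p N) n Z = Y [^]\<^bsub>grp (W p N) (n + 1)\<^esub> p"
  then obtain z y where z: "N.coherent n z" "Z = N.limit n z" and y: "N.coherent (n + 1) y" "Y = N.limit (n + 1) y"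
    by (meson N.W_rep)
  obtain x where x: "\<And>r. x r \<in> N.C n" "\<And>r. \<exists>\<phi> \<in> fil p N (Suc r) n. x (Suc r) = N.ml n \<phi> (x r)"
    "\<And>r. \<exists>\<phi> \<in> fil p N r n. z r = N.ml n \<phi> (N.F n (x r))"
    using N.frob_lift[OF z(1) y(1)] eq z(2) y(2) by blast
  \<comment> \<open>\<open>F x\<^sub>0\<close> is a cocycle modulo \<open>p\<close> because \<open>dF = pFd\<close>, so it comes from \<open>M\<close> up to \<open>pN + dN\<close>.\<close>
  have "N.ddiv 1 n (N.F n (x 0)) (N.F (n + 1) (N.d n (x 0)))"
    using N.ddiv_F[OF N.ddiv_0[OF x(1)]] by simp
  then obtain m m' a b where m: "ddiv 1 n m m'" and ab: "a \<in> N.C n" "b \<in> N.C (n - 1)"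
    "N.F n (x 0) = N.ml n (i n m) (N.ml n (N.pw n a p) (N.d (n - 1) b))"
    using saturation_surj by meson
  note cm = ddiv_closed[OF m]
  obtain \<alpha> \<beta> where \<alpha>: "N.coherent n \<alpha>" and \<beta>: "N.coherent (n - 1) \<beta>" and
    F: "\<And>r. N.F n (x r) = N.ml n (i n m) (N.ml n (N.pw n (\<alpha> r) p) (N.d (n - 1) (\<beta> r)))"
    using N.frob_series[OF x(1,2) i_closed[OF cm(1)] ab] by blast
  have d\<beta>: "N.coherent n (\<lambda>r. N.d (n - 1) (\<beta> r))" using N.coherent_d[OF \<beta>] by simp
  have D\<beta>: "diff (W p N) (n - 1) (N.limit (n - 1) \<beta>) = N.limit n (\<lambda>r. N.d (n - 1) (\<beta> r))"
    using N.W_diff[OF \<beta>] by simp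
  note co = N.coherent_const[OF i_closed[OF cm(1)]] N.coherent_pw[OF \<alpha>] d\<beta>
  have "Z = N.limit n (\<lambda>r. N.ml n (i n m) (N.ml n (N.pw n (\<alpha> r) p) (N.d (n - 1) (\<beta> r))))"
    unfolding z(2) N.limit_eq_iff[OF z(1) N.coherent_ml[OF co(1) N.coherent_ml[OF co(2,3)]]]
    using x(3) F by simp
  also have "\<dots> = W_proj p N n (i n m) \<otimes>\<^bsub>grp (W p N) n\<^esub>
      (N.limit n \<alpha> [^]\<^bsub>grp (W p N) n\<^esub> p \<otimes>\<^bsub>grp (W p N) n\<^esub> diff (W p N) (n - 1) (N.limit (n - 1) \<beta>))"
    by (simp add: N.W_proj_limit N.W_pow[OF \<alpha>] D\<beta> N.W_mult N.coherent_ml co)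
  finally show "\<exists>m \<in> C n. \<exists>m' \<in> C (n + 1). d n m = pw (n + 1) m' p \<and>
      (\<exists>u \<in> carrier (grp (W p N) n). \<exists>t \<in> carrier (grp (W p N) (n - 1)).
        Z = W_proj p N n (i n m) \<otimes>\<^bsub>grp (W p N) n\<^esub>
          (u [^]\<^bsub>grp (W p N) n\<^esub> p \<otimes>\<^bsub>grp (W p N) n\<^esub> diff (W p N) (n - 1) t))"
    using cm ddiv_eq[OF m] N.limit_in[OF \<alpha>] N.limit_in[OF \<beta>] by (metis power_one_right)
next
  fix n m m' A B
  assume "m \<in> C n" "m' \<in> C (n + 1)" "d n m = pw (n + 1) m' p"
    and "A \<in> carrier (grp (W p N) n)" "B \<in> carrier (grp (W p N) (n - 1))"
    and eq: "W_proj p N n (i n m) =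
      A [^]\<^bsub>grp (W p N) n\<^esub> p \<otimes>\<^bsub>grp (W p N) n\<^esub> diff (W p N) (n - 1) B"
  then obtain a b where m: "ddiv 1 n m m'" and a: "N.coherent n a" "A = N.limit n a"
    and b: "N.coherent (n - 1) b" "B = N.limit (n - 1) b"
    by (auto simp: ddiv_def elim!: N.W_rep)
  note cm = ddiv_closed[OF m] and ca = N.coherent_closed[OF a(1)] and cb = N.coherent_closed[OF b(1)]
  have db: "N.coherent n (\<lambda>r. N.d (n - 1) (b r))" using N.coherent_d[OF b(1)] by simp
  have "N.limit n (\<lambda>_. i n m) = N.limit n (\<lambda>r. N.ml n (N.pw n (a r) p) (N.d (n - 1) (b r)))"
    using eq N.W_diff[OF b(1)] by (simp add: a(2) b(2) N.W_proj_limit N.W_pow[OF a(1)] N.W_mult N.coherent_pw[OF a(1)] db)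
  then obtain \<phi> where \<phi>: "\<phi> \<in> fil p N 1 n" "i n m = N.ml n \<phi> (N.ml n (N.pw n (a 1) p) (N.d (n - 1) (b 1)))"
    unfolding N.limit_eq_iff[OF N.coherent_const[OF i_closed[OF cm(1)]] N.coherent_ml[OF N.coherent_pw[OF a(1)] db]]
    by blast
  \<comment> \<open>The component with index 1 gives \<open>i m\<close> up to \<open>VN + dVN\<close>; as \<open>p\<close> divides \<open>d(i m)\<close>, the
    part in \<open>VN\<close> is divisible by \<open>p\<close>.\<close>
  obtain s t where st: "s \<in> N.C n" "t \<in> N.C (n - 1)" "\<phi> = N.ml n (N.V n s) (N.d (n - 1) (N.V (n - 1) t))"
    using \<phi>(1) by (rule N.filE) auto
  have "N.ml (n + 1) (N.pw (n + 1) (N.d n (a 1)) p) (N.d n (N.V n s)) = N.d n (i n m)"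
    unfolding \<phi>(2) st(3) using st ca cb by (simp add: N.d_ml N.d_pw N.comm)
  also have "\<dots> = N.pw (n + 1) (i (n + 1) m') p"
    using N.ddiv_eq[OF i_ddiv[OF m]] by simp
  finally have *: "N.ml (n + 1) (N.pw (n + 1) (N.d n (a 1)) p) (N.d n (N.V n s)) = N.pw (n + 1) (i (n + 1) m') p" .
  obtain w where w: "w \<in> N.C (n + 1)" "i (n + 1) m' = N.ml (n + 1) w (N.d n (a 1))"
    using N.diff_ex[of "i (n + 1) m'" "n + 1" "N.d n (a 1)"] cm ca by auto
  have "N.ml (n + 1) (N.pw (n + 1) (N.d n (a 1)) p) (N.d n (N.V n s)) =
      N.ml (n + 1) (N.pw (n + 1) (N.d n (a 1)) p) (N.pw (n + 1) w p)"
    unfolding * w(2) using w(1) ca by (simp add: N.pw_ml N.comm)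
  then have "N.d n (N.V n s) = N.pw (n + 1) w p"
    by (rule N.cancel[rotated 3]) (use w ca st in simp_all)
  then obtain c where c: "c \<in> N.C n" "N.V n s = N.pw n c p"
    using N.Vk_cocycle_mod_p[OF st(1) w(1), of 0] by auto
  have "i n m = N.ml n (N.pw n (N.ml n c (a 1)) p) (N.d (n - 1) (N.ml (n - 1) (N.V (n - 1) t) (b 1)))"
    unfolding \<phi>(2) st(3) c(2) using c(1) st ca cb by (simp add: N.pw_ml N.dp_ml N.ac)
  from saturation_inj[OF m _ _ this]
  show "\<exists>v \<in> C n. \<exists>t \<in> C (n - 1). m = ml n (pw n v p) (d (n - 1) t)"
    using c(1) st ca cb by simp
qed

end

theorem theorem1p2p3:
  fixes p :: nat
    and M :: "'a dieudonne" and N :: "'b dieudonne" and i :: "int \<Rightarrow> 'a \<Rightarrow> 'b"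
  assumes "prime p"
    and "dieudonne_complex p M"
    and "cartier_type p M"
    and "is_saturation p M N i"
  shows "quasi_isomorphism (mod_p p M) (mod_p p (W p N))
           (mod_p_map p (W p N) (\<lambda>n x. W_proj p N n (i n x)))"
proof -
  interpret cartier_cplx p M by (rule cartier_type_cplx[OF assms(3)])
  have N: "saturated p N" "dieudonne_mor p M N i"
    using assms(4) by (simp_all add: is_saturation_def saturation_among_def)
  interpret N: saturated_cplx p N using N(1) by unfold_locales (simp_all add: saturated_def)
  interpret cartier_saturation p M N i
  proof unfold_locales
    show "dieudonne_mor p M N i" by (rule N(2))
    show "\<exists>r. \<exists>x \<in> C n. (N.F n ^^ r) w = i n x" if "w \<in> N.C n" for n w
      using saturation_loc(2)[OF assms(4) that] .
    fix n x y assume xy: "x \<in> C n" "y \<in> C n" "i n x = i n y"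
    then obtain k where k: "(G n ^^ k) x = (G n ^^ k) y"
      using loc_eq[OF xy(1,2) saturation_loc(1)[OF assms(4) xy]] by blast
    have "(F n ^^ k) x = (F n ^^ k) y"
      by (rule pw_inj[OF tf, of _ n _ k]) (use xy k in \<open>simp_all add: Gk_eq\<close>)
    then show "\<exists>k. (F n ^^ k) x = (F n ^^ k) y" ..
  qed
  show ?thesis by (rule quasi_isomorphism_W)
qed

end
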